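(* Let $M$ be a complete Riemannian manifold. Let $f:M\to(-\infty,+\infty]$ be a lower semicontinuous function, and let $x_0\in M$ with $f(x_0)<+\infty$. Assume that there exist $\delta>0$ and $\rho>0$ such that $\|\zeta\|_x\ge\delta$ whenever $\zeta\in\partial_Pf(x)$ and $d(x,x_0)<\rho$. Then $$\inf\{f(x): d(x,x_0)<\rho\}\le f(x_0)-\rho\delta.$$
   Context: Riemannian manifolds are modelled on a real Hilbert space (finite or infinite dimensional); $d$ is the Riemannian distance and $\|\cdot\|_x$ the norm on $TM_x$. Proximal subdifferential: for a lower semicontinuous $g:X\to(-\infty,+\infty]$ on a Hilbert space $X$ and $x$ with $g(x)<+\infty$, $\zeta\in\partial_Pg(x)$ iff there are $\sigma,\eta>0$ with $g(y)\ge g(x)+\langle\zeta,y-x\rangle-\sigma\|y-x\|^2$ for all $y\in B(x,\eta)$. For lower semicontinuous $g:M\to(-\infty,+\infty]$ on a Riemannian manifold, $\partial_Pg(p):=\partial_P(g\circ\exp_p)(0)\subset TM_p$ (empty if $g(p)=+\infty$). *)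

theory Defs
  imports "HOL-Analysis.Analysis" "HOL-Library.Function_Algebras"
begin

section \<open>Smooth maps between normed spaces\<close>

text \<open>
  \<open>C\<^sup>\<infinity>\<close> in the sense of Frechet on an open set \<open>S\<close>. The \<open>k\<close>-th derivatives at a point \<open>x\<close>, for
  all \<open>k\<close> at once, are given as a function \<open>D x\<close> on lists: on lists of length \<open>k\<close> it is a bounded
  \<open>k\<close>-linear map, and the derivative of this map with respect to \<open>x\<close>, for the operator norm on
  bounded \<open>k\<close>-linear maps, is given by \<open>D x\<close> on lists of length \<open>k + 1\<close>. In infinite dimension the
  uniformity in \<open>vs\<close> matters: it makes this Frechet, not just directional, differentiability.
\<close>

definition smooth_on :: "'a::real_normed_vector set \<Rightarrow> ('a \<Rightarrow> 'b::real_normed_vector) \<Rightarrow> bool" where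
  "smooth_on S f \<longleftrightarrow> (\<exists>D :: 'a \<Rightarrow> 'a list \<Rightarrow> 'b. \<forall>x\<in>S.
     D x [] = f x \<and>
     (\<forall>us ws. linear (\<lambda>v. D x (us @ v # ws))) \<and>
     (\<forall>k. \<exists>C. \<forall>vs. length vs = k \<longrightarrow> norm (D x vs) \<le> C * prod_list (map norm vs)) \<and>
     (\<forall>k. \<forall>\<epsilon>>0. \<exists>\<eta>>0. \<forall>y\<in>S. norm (y - x) < \<eta> \<longrightarrow>
        (\<forall>vs. length vs = k \<longrightarrow>
           norm (D y vs - D x vs - D x ((y - x) # vs))
             \<le> \<epsilon> * norm (y - x) * prod_list (map norm vs))))"


section \<open>Smooth manifolds modelled on a Hilbert space\<close>

type_synonym ('m, 'e) chart = "'m set \<times> ('m \<Rightarrow> 'e)"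

abbreviation chart_dom :: "('m, 'e) chart \<Rightarrow> 'm set" where
  "chart_dom c \<equiv> fst c"

abbreviation chart_map :: "('m, 'e) chart \<Rightarrow> 'm \<Rightarrow> 'e" where
  "chart_map c \<equiv> snd c"

definition chart_img :: "('m, 'e) chart \<Rightarrow> 'e set" where
  "chart_img c = chart_map c ` chart_dom c"

definition chart_inv :: "('m, 'e) chart \<Rightarrow> 'e \<Rightarrow> 'm" where
  "chart_inv c = inv_into (chart_dom c) (chart_map c)"

definition transition :: "('m, 'e) chart \<Rightarrow> ('m, 'e) chart \<Rightarrow> 'e \<Rightarrow> 'e" where
  "transition c d = chart_map d \<circ> chart_inv c"

definition charts_at :: "('m, 'e) chart set \<Rightarrow> 'm \<Rightarrow> ('m, 'e) chart set" where
  "charts_at A p = {c \<in> A. p \<in> chart_dom c}"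

locale hilbert_manifold =
  fixes X :: "'m topology" and A :: "('m, 'e::{real_inner, complete_space}) chart set"
  assumes Hausdorff: "Hausdorff_space X"
    and covers: "(\<Union>c\<in>A. chart_dom c) = topspace X"
    and open_dom: "c \<in> A \<Longrightarrow> openin X (chart_dom c)"
    and open_img: "c \<in> A \<Longrightarrow> open (chart_img c)"
    and homeomorphic: "c \<in> A \<Longrightarrow>
      homeomorphic_map (subtopology X (chart_dom c)) (top_of_set (chart_img c)) (chart_map c)"
    and smooth_transition: "c \<in> A \<Longrightarrow> d \<in> A \<Longrightarrow>
      smooth_on (chart_map c ` (chart_dom c \<inter> chart_dom d)) (transition c d)"

text \<open>
  A tangent vector at \<open>p\<close> is the family of its coordinate representatives in all charts around \<open>p\<close>,
  related by the derivatives of the transition maps. It is extended by zero to the charts that do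
  not contain \<open>p\<close>, so that the pointwise operations on functions are those of the tangent space.
\<close>

definition tangent_space ::
    "('m, 'e::real_normed_vector) chart set \<Rightarrow> 'm \<Rightarrow> (('m, 'e) chart \<Rightarrow> 'e) set" where
  "tangent_space A p = {\<xi>.
     (\<forall>c. c \<notin> charts_at A p \<longrightarrow> \<xi> c = 0) \<and>
     (\<forall>c\<in>charts_at A p. \<forall>d\<in>charts_at A p.
        \<xi> d = frechet_derivative (transition c d) (at (chart_map c p)) (\<xi> c))}"

text \<open>The vector \<open>\<xi>\<close> is the derivative at time \<open>t\<close> of the curve \<open>\<gamma>\<close>, restricted to times in \<open>J\<close>.\<close>

definition has_velocity ::
    "('m, 'e::real_normed_vector) chart set \<Rightarrow> (real \<Rightarrow> 'm) \<Rightarrow> real set \<Rightarrow> real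
      \<Rightarrow> (('m, 'e) chart \<Rightarrow> 'e) \<Rightarrow> bool" where
  "has_velocity A \<gamma> J t \<xi> \<longleftrightarrow> \<xi> \<in> tangent_space A (\<gamma> t) \<and>
     (\<forall>c\<in>charts_at A (\<gamma> t). ((chart_map c \<circ> \<gamma>) has_vector_derivative \<xi> c) (at t within J))"


section \<open>Riemannian metrics\<close>

type_synonym ('m, 'e) metric =
  "'m \<Rightarrow> (('m, 'e) chart \<Rightarrow> 'e) \<Rightarrow> (('m, 'e) chart \<Rightarrow> 'e) \<Rightarrow> real"

definition tangent_norm :: "('m, 'e) metric \<Rightarrow> 'm \<Rightarrow> (('m, 'e) chart \<Rightarrow> 'e) \<Rightarrow> real" where
  "tangent_norm g p \<xi> = sqrt (g p \<xi> \<xi>)"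

text \<open>The coordinate representation of \<open>g\<close> in the chart \<open>c\<close>.\<close>

definition local_metric ::
    "('m, 'e::real_normed_vector) chart set \<Rightarrow> ('m, 'e) metric \<Rightarrow> ('m, 'e) chart
      \<Rightarrow> 'e \<Rightarrow> 'e \<Rightarrow>\<^sub>L 'e \<Rightarrow>\<^sub>L real" where
  "local_metric A g c x = (THE B. \<forall>\<xi>\<in>tangent_space A (chart_inv c x).
     \<forall>\<zeta>\<in>tangent_space A (chart_inv c x).
       g (chart_inv c x) \<xi> \<zeta> = blinfun_apply (blinfun_apply B (\<xi> c)) (\<zeta> c))"

text \<open>
  Each \<open>g p\<close> is a bounded symmetric bilinear form on the tangent space, and coercive: the norm it
  defines is a Hilbert space norm inducing the topology of the model space.
\<close>

locale riemannian_manifold = hilbert_manifold X A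
  for X :: "'m topology" and A :: "('m, 'e::{real_inner, complete_space}) chart set" +
  fixes g :: "('m, 'e) metric"
  assumes bounded_bilinear_metric: "c \<in> charts_at A p \<Longrightarrow>
      \<exists>B :: 'e \<Rightarrow>\<^sub>L 'e \<Rightarrow>\<^sub>L real. \<forall>\<xi>\<in>tangent_space A p. \<forall>\<zeta>\<in>tangent_space A p.
        g p \<xi> \<zeta> = blinfun_apply (blinfun_apply B (\<xi> c)) (\<zeta> c)"
    and symmetric: "p \<in> topspace X \<Longrightarrow> \<xi> \<in> tangent_space A p \<Longrightarrow> \<zeta> \<in> tangent_space A p \<Longrightarrow>
      g p \<xi> \<zeta> = g p \<zeta> \<xi>"
    and coercive: "c \<in> charts_at A p \<Longrightarrow>
      \<exists>m>0. \<forall>\<xi>\<in>tangent_space A p. g p \<xi> \<xi> \<ge> m * (norm (\<xi> c))\<^sup>2"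
    and smooth_metric: "c \<in> A \<Longrightarrow> smooth_on (chart_img c) (local_metric A g c)"


section \<open>Riemannian distance and completeness\<close>

definition C1_curve_on ::
    "('m, 'e::real_normed_vector) chart set \<Rightarrow> real set \<Rightarrow> (real \<Rightarrow> 'm) \<Rightarrow> bool" where
  "C1_curve_on A J \<gamma> \<longleftrightarrow> (\<exists>V. \<forall>t\<in>J. has_velocity A \<gamma> J t (V t) \<and>
     (\<forall>c\<in>charts_at A (\<gamma> t). continuous (at t within J) (\<lambda>s. V s c)))"

definition piecewise_C1_curve ::
    "'m topology \<Rightarrow> ('m, 'e::real_normed_vector) chart set \<Rightarrow> (real \<Rightarrow> 'm) \<Rightarrow> bool" where
  "piecewise_C1_curve X A \<gamma> \<longleftrightarrow> continuous_map (top_of_set {0..1}) X \<gamma> \<and>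
     (\<exists>ts. ts \<noteq> [] \<and> sorted_wrt (<) ts \<and> hd ts = 0 \<and> last ts = 1 \<and>
        (\<forall>i. Suc i < length ts \<longrightarrow> C1_curve_on A {ts ! i .. ts ! Suc i} \<gamma>))"

definition curve_length ::
    "('m, 'e::real_normed_vector) chart set \<Rightarrow> ('m, 'e) metric \<Rightarrow> (real \<Rightarrow> 'm) \<Rightarrow> real" where
  "curve_length A g \<gamma> = integral {0..1}
     (\<lambda>t. tangent_norm g (\<gamma> t) (THE \<xi>. has_velocity A \<gamma> {0..1} t \<xi>))"

text \<open>The distance is \<open>\<infinity>\<close> between points of different connected components.\<close>

definition riemannian_dist ::
    "'m topology \<Rightarrow> ('m, 'e::real_normed_vector) chart set \<Rightarrow> ('m, 'e) metric
      \<Rightarrow> 'm \<Rightarrow> 'm \<Rightarrow> ereal" where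
  "riemannian_dist X A g p q =
     (INF \<gamma>\<in>{\<gamma>. piecewise_C1_curve X A \<gamma> \<and> \<gamma> 0 = p \<and> \<gamma> 1 = q}. ereal (curve_length A g \<gamma>))"

locale complete_riemannian_manifold = riemannian_manifold X A g
  for X :: "'m topology" and A :: "('m, 'e::{real_inner, complete_space}) chart set"
    and g :: "('m, 'e) metric" +
  assumes complete:
    "\<lbrakk>\<And>n. s n \<in> topspace X;
      \<And>\<epsilon>::real. \<epsilon> > 0 \<Longrightarrow> \<exists>N. \<forall>m\<ge>N. \<forall>n\<ge>N. riemannian_dist X A g (s m) (s n) < ereal \<epsilon>\<rbrakk>
     \<Longrightarrow> \<exists>l\<in>topspace X. (\<lambda>n::nat. riemannian_dist X A g (s n) l) \<longlonglongrightarrow> 0"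


section \<open>Geodesics and the exponential map\<close>

text \<open>
  The Christoffel map of the Levi-Civita connection in the chart \<open>c\<close>, determined by the Koszul
  formula for coordinate vector fields.
\<close>

definition christoffel ::
    "('m, 'e::real_normed_vector) chart set \<Rightarrow> ('m, 'e) metric \<Rightarrow> ('m, 'e) chart
      \<Rightarrow> 'e \<Rightarrow> 'e \<Rightarrow> 'e \<Rightarrow> 'e" where
  "christoffel A g c x u v =
     (let G = local_metric A g c;
          dG = (\<lambda>a b b'. blinfun_apply (blinfun_apply (frechet_derivative G (at x) a) b) b')
      in THE z. \<forall>w. blinfun_apply (blinfun_apply (G x) z) w
           = (dG u v w + dG v u w - dG w u v) / 2)"

text \<open>Here \<open>V\<close> is the velocity field of the geodesic \<open>\<gamma>\<close>, and \<open>J\<close> is meant to be an interval.\<close>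

definition geodesic_on ::
    "'m topology \<Rightarrow> ('m, 'e::real_normed_vector) chart set \<Rightarrow> ('m, 'e) metric \<Rightarrow> real set
      \<Rightarrow> (real \<Rightarrow> 'm) \<Rightarrow> (real \<Rightarrow> ('m, 'e) chart \<Rightarrow> 'e) \<Rightarrow> bool" where
  "geodesic_on X A g J \<gamma> V \<longleftrightarrow> continuous_map (top_of_set J) X \<gamma> \<and>
     (\<forall>t\<in>J. has_velocity A \<gamma> J t (V t) \<and>
        (\<forall>c\<in>charts_at A (\<gamma> t). ((\<lambda>s. V s c) has_vector_derivative
             - christoffel A g c (chart_map c (\<gamma> t)) (V t c) (V t c)) (at t within J)))"

definition riemannian_exp ::
    "'m topology \<Rightarrow> ('m, 'e::real_normed_vector) chart set \<Rightarrow> ('m, 'e) metric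
      \<Rightarrow> 'm \<Rightarrow> (('m, 'e) chart \<Rightarrow> 'e) \<Rightarrow> 'm" where
  "riemannian_exp X A g p \<xi> =
     (THE q. \<exists>\<gamma> V. geodesic_on X A g {0..1} \<gamma> V \<and> \<gamma> 0 = p \<and> V 0 = \<xi> \<and> \<gamma> 1 = q)"


section \<open>Proximal subdifferentials\<close>

definition lower_semicontinuous_map :: "'m topology \<Rightarrow> ('m \<Rightarrow> ereal) \<Rightarrow> bool" where
  "lower_semicontinuous_map X f \<longleftrightarrow> (\<forall>a. openin X {x \<in> topspace X. f x > a})"

text \<open>
  The Hilbert space is given by a carrier \<open>H\<close> and an inner product \<open>ip\<close>, because the tangent spaces
  are not types and each carries its own inner product.
\<close>

definition proximal_subdifferential ::
    "'v::minus set \<Rightarrow> ('v \<Rightarrow> 'v \<Rightarrow> real) \<Rightarrow> ('v \<Rightarrow> ereal) \<Rightarrow> 'v \<Rightarrow> 'v set" where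
  "proximal_subdifferential H ip h x = {\<zeta> \<in> H. h x < \<infinity> \<and>
     (\<exists>\<sigma>>0. \<exists>\<eta>>0. \<forall>y\<in>H. sqrt (ip (y - x) (y - x)) < \<eta> \<longrightarrow>
        h y \<ge> h x + ereal (ip \<zeta> (y - x) - \<sigma> * (sqrt (ip (y - x) (y - x)))\<^sup>2))}"

text \<open>If \<open>f p = \<infinity>\<close> the set below is empty, since the exponential map at \<open>p\<close> maps \<open>0\<close> to \<open>p\<close>.\<close>

definition manifold_proximal_subdifferential ::
    "'m topology \<Rightarrow> ('m, 'e::real_normed_vector) chart set \<Rightarrow> ('m, 'e) metric
      \<Rightarrow> ('m \<Rightarrow> ereal) \<Rightarrow> 'm \<Rightarrow> (('m, 'e) chart \<Rightarrow> 'e) set" where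
  "manifold_proximal_subdifferential X A g f p =
     proximal_subdifferential (tangent_space A p) (g p) (f \<circ> riemannian_exp X A g p) 0"

end

theory Submission
  imports Defs
begin

text \<open>
  If the infimum were larger, Ekeland's principle for the complete distance would give a point \<open>q\<close> of
  the ball with \<open>f y \<ge> f q - K d(q, y)\<close> near \<open>q\<close> for some \<open>K < \<delta>\<close>. In a chart this says that \<open>f\<close> lies
  above a cone of slope about \<open>K\<close>. Rounding the cone and applying the Borwein-Preiss principle in
  the model Hilbert space yields a point near \<open>q\<close> at which \<open>f\<close> has a local quadratic minorant whose
  linear part has norm below \<open>\<delta>\<close>. Since the exponential map agrees with the chart up to second order,
  that linear part is a proximal subgradient, a contradiction. The exponential map is a definite
  description over geodesics, so this needs existence and uniqueness for the geodesic equation in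
  infinite dimension and its independence of the chart.
\<close>

section \<open>Real induction, coercive forms and smooth maps\<close>

text \<open>Balls of the model space need not be compact, so no minimum comes for free and each one
  is produced by a perturbation. Two kinds are needed: the distance is the right penalty where only
  completeness of the manifold is known, but it is not smooth at its centre, whereas a proximal
  subgradient demands a quadratic error, which the norm of the model space supplies.

  The gap \<open>K < \<delta>\<close> is a budget spent three times: on comparing the metric near
  \<open>q\<close> with the one frozen at \<open>q\<close>, on rounding the cone, and on the linear
  part of the Borwein-Preiss perturbation. On its other side, \<open>K\<close> exceeds the average
  slope of \<open>f\<close> over the ball, which keeps the Ekeland sequence uniformly away from the
  boundary, so that its limit stays in the open ball.

  The descriptions behind the exponential map and the distance range over all curves, including
  those that leave the chart. Real induction on time, with uniqueness of limits in a Hausdorff space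
  as its closed step, shows that the relevant ones do not. The geodesic equation is solved on all of
  \<open>{0..1}\<close>, but only for small initial velocities, which suffices because subgradients
  are local at 0.\<close>

lemma real_interval_induct:
  fixes a b :: real
  assumes closed: "\<And>t. a \<le> t \<Longrightarrow> t \<le> b \<Longrightarrow> (\<And>s. a \<le> s \<Longrightarrow> s < t \<Longrightarrow> P s) \<Longrightarrow> P t"
    and "open": "\<And>t. a \<le> t \<Longrightarrow> t < b \<Longrightarrow> (\<And>s. a \<le> s \<Longrightarrow> s \<le> t \<Longrightarrow> P s) \<Longrightarrow>
      \<exists>u>t. \<forall>s. t < s \<longrightarrow> s < u \<longrightarrow> s \<le> b \<longrightarrow> P s"
    and t: "a \<le> t" "t \<le> b"
  shows "P t"
proof (rule ccontr)
  assume nP: "\<not> P t"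
  \<comment> \<open>The infimum \<open>m\<close> of the failures is itself a success by
    \<open>closed\<close>; then \<open>open\<close> pushes every failure beyond some
    \<open>u > m\<close>.\<close>
  define N where "N = {s. a \<le> s \<and> s \<le> b \<and> \<not> P s}"
  have N: "t \<in> N" "bdd_below N" using nP t by (auto simp: N_def bdd_below_def)
  define m where "m = Inf N"
  have m: "a \<le> m" "m \<le> t"
    unfolding m_def using N by (auto intro!: cInf_greatest cInf_lower simp: N_def)
  have below: "P s" if "a \<le> s" "s < m" for s
    using cInf_lower[OF _ N(2), of s] that t m unfolding m_def N_def by force
  have Pm: "P m" using closed[of m] m t below by auto
  have "m < b" using m t Pm nP by (cases "m = b") auto
  then obtain u where u: "u > m" "\<And>s. m < s \<Longrightarrow> s < u \<Longrightarrow> s \<le> b \<Longrightarrow> P s"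
    using "open"[of m] m below Pm by (metis le_less)
  have "u \<le> m"
    unfolding m_def
  proof (rule cInf_greatest)
    show "N \<noteq> {}" using N by auto
    fix s assume "s \<in> N"
    then show "u \<le> s" using u(2)[of s] Pm below[of s] unfolding N_def
      by (metis linorder_not_less mem_Collect_eq not_less_iff_gr_or_eq)
  qed
  then show False using u by auto
qed

lemma quadratic_nonneg_imp_zero:
  fixes a b :: real
  assumes "\<And>t. 0 \<le> a * t + b * t\<^sup>2"
  shows "a = 0"
proof -
  \<comment> \<open>At this test point \<open>a * t + \<bar>b\<bar> * t\<^sup>2\<close> collapses to
    \<open>- s\<^sup>2\<close>; the \<open>+ 1\<close> keeps the denominator positive.\<close>
  define s where "s = - a / (\<bar>b\<bar> + 1)"
  have a: "a = - s * (\<bar>b\<bar> + 1)" by (simp add: s_def)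
  have "0 \<le> a * s + b * s\<^sup>2" by (rule assms)
  also have "\<dots> \<le> a * s + \<bar>b\<bar> * s\<^sup>2" by (simp add: mult_right_mono)
  also have "\<dots> = - s\<^sup>2" by (simp add: a power2_eq_square algebra_simps)
  finally have "s = 0" by simp
  then show ?thesis using a by simp
qed

text \<open>The representing vector minimises \<open>B z z - 2 l z\<close>; coercivity makes minimising sequences Cauchy.\<close>

lemma coercive_form_representation:
  fixes B :: "'a::{real_normed_vector,complete_space} \<Rightarrow> 'a \<Rightarrow> real"
  assumes bil: "bounded_bilinear B" and sym: "\<And>x y. B x y = B y x"
    and m: "m > 0" and coercive: "\<And>x. m * (norm x)\<^sup>2 \<le> B x x"
    and l: "bounded_linear l"
  shows "\<exists>z. \<forall>w. B z w = l w"
proof -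
  interpret B: bounded_bilinear B by fact
  interpret l: bounded_linear l by fact
  define \<Phi> where "\<Phi> z = B z z - 2 * l z" for z
  obtain K where K: "\<And>x. norm (l x) \<le> norm x * K" "K \<ge> 0"
    using l.nonneg_bounded by blast
  \<comment> \<open>Completing the square in \<open>norm z\<close>: the coercive term dominates the
    linear one.\<close>
  have lower: "- (K\<^sup>2 / m) \<le> \<Phi> z" for z
  proof -
    have "0 \<le> m * (norm z - K / m)\<^sup>2" using m by simp
    also have "\<dots> = m * (norm z)\<^sup>2 - 2 * (norm z * K) + K\<^sup>2 / m"
      using m by (simp add: power2_eq_square field_simps)
    also have "\<dots> \<le> \<Phi> z + K\<^sup>2 / m"
      using coercive[of z] K(1)[of z] unfolding \<Phi>_def by auto
    finally show ?thesis by simp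
  qed
  define I where "I = Inf (range \<Phi>)"
  have bdd: "bdd_below (range \<Phi>)" using lower by (auto simp: bdd_below_def)
  have I: "I \<le> \<Phi> z" for z unfolding I_def by (rule cInf_lower[OF _ bdd]) auto
  have "\<exists>z. \<Phi> z < I + inverse (real (Suc n))" for n
    using cInf_lessD[of "range \<Phi>" "I + inverse (real (Suc n))"] by (auto simp: I_def)
  then obtain z where z: "\<And>n. \<Phi> (z n) < I + inverse (real (Suc n))" by metis
  \<comment> \<open>Parallelogram identity, with the value at the midpoint of \<open>x\<close> and
    \<open>y\<close> bounded below by \<open>I\<close>.\<close>
  have par: "m * (norm (x - y))\<^sup>2 \<le> 2 * (\<Phi> x - I) + 2 * (\<Phi> y - I)" for x y
  proof -
    have "\<Phi> ((1/2) *\<^sub>R (x + y)) \<ge> I" by (rule I)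
    moreover have "4 * \<Phi> ((1/2) *\<^sub>R (x + y)) = 2 * \<Phi> x + 2 * \<Phi> y - B (x - y) (x - y)"
      unfolding \<Phi>_def using sym[of x y]
      by (simp add: B.add_left B.add_right B.diff_left B.diff_right B.scaleR_left B.scaleR_right
          l.add l.scaleR algebra_simps)
    ultimately show ?thesis using coercive[of "x - y"] by auto
  qed
  have "Cauchy z"
  proof (rule metric_CauchyI)
    fix e :: real assume "e > 0"
    then have "m * e\<^sup>2 / 4 > 0" using m by simp
    then obtain N where N: "inverse (real (Suc N)) < m * e\<^sup>2 / 4" using reals_Archimedean by blast
    have "dist (z i) (z j) < e" if "i \<ge> N" "j \<ge> N" for i j
    proof -
      have small: "\<Phi> (z k) - I < m * e\<^sup>2 / 4" if "k \<ge> N" for k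
      proof -
        have "inverse (real (Suc k)) \<le> inverse (real (Suc N))" using that by simp
        then show ?thesis using z[of k] N by linarith
      qed
      have "m * (norm (z i - z j))\<^sup>2 < m * e\<^sup>2"
        using par[of "z i" "z j"] small[OF that(1)] small[OF that(2)] by argo
      then have "(norm (z i - z j))\<^sup>2 < e\<^sup>2" using m by simp
      then show ?thesis using \<open>e > 0\<close> by (simp add: dist_norm power_less_imp_less_base)
    qed
    then show "\<exists>N. \<forall>i\<ge>N. \<forall>j\<ge>N. dist (z i) (z j) < e" by blast
  qed
  then obtain y where y: "z \<longlonglongrightarrow> y" using Cauchy_convergent convergent_def by blast
  have lim: "(\<lambda>n. \<Phi> (z n)) \<longlonglongrightarrow> \<Phi> y"
    unfolding \<Phi>_def by (intro tendsto_intros B.tendsto l.tendsto y)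
  have "\<Phi> y \<le> I + 0"
    by (rule LIMSEQ_le[OF lim tendsto_add[OF tendsto_const LIMSEQ_inverse_real_of_nat]])
      (use z less_imp_le in blast)
  then have min: "\<Phi> y \<le> \<Phi> x" for x using I[of x] by simp
  have "B y w = l w" for w
  proof -
    \<comment> \<open>First variation at the minimiser:
      \<open>\<Phi> (y + t *\<^sub>R w) - \<Phi> y\<close> is a quadratic polynomial in
      \<open>t\<close> without constant term.\<close>
    have "0 \<le> (2 * (B y w - l w)) * t + B w w * t\<^sup>2" for t
      using min[of "y + t *\<^sub>R w"] sym[of y w] unfolding \<Phi>_def
      by (simp add: B.add_left B.add_right B.scaleR_left B.scaleR_right
          l.add l.scaleR algebra_simps power2_eq_square)
    from quadratic_nonneg_imp_zero[OF this] show ?thesis by simp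
  qed
  then show ?thesis by blast
qed

lemma coercive_form_cancel:
  assumes bil: "bounded_bilinear B" and m: "m > 0"
    and coercive: "\<And>x. m * (norm x)\<^sup>2 \<le> (B x x :: real)"
    and eq: "\<And>w. B y w = B z w"
  shows "y = z"
proof -
  interpret B: bounded_bilinear B by fact
  have "B (y - z) (y - z) = 0" using eq[of "y - z"] by (simp add: B.diff_left)
  then have "m * (norm (y - z))\<^sup>2 \<le> 0" using coercive[of "y - z"] by simp
  then have "(norm (y - z))\<^sup>2 \<le> 0" using m by (simp add: mult_le_0_iff)
  then show ?thesis by simp
qed

lemma semidefinite_form_Cauchy_Schwarz:
  fixes B :: "'a::real_normed_vector \<Rightarrow> 'a \<Rightarrow> real"
  assumes bil: "bounded_bilinear B" and sym: "\<And>x y. B x y = B y x" and nn: "\<And>x. 0 \<le> B x x"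
  shows "\<bar>B x y\<bar> \<le> sqrt (B x x) * sqrt (B y y)"
proof -
  interpret B: bounded_bilinear B by fact
  have q: "0 \<le> B x x - 2 * t * B x y + t\<^sup>2 * B y y" for t
    using nn[of "x - t *\<^sub>R y"] sym[of x y]
    by (simp add: B.diff_left B.diff_right B.scaleR_left B.scaleR_right algebra_simps power2_eq_square)
  have "(B x y)\<^sup>2 \<le> B x x * B y y"
  proof (cases "B y y = 0")
    case True
    \<comment> \<open>Here \<open>q\<close> is affine in \<open>t\<close>, and a nonzero slope would
      allow the value -1, which this choice of \<open>t\<close> produces.\<close>
    have "0 \<le> B x x - 2 * ((B x x + 1) / (2 * B x y)) * B x y" if "B x y \<noteq> 0"
      using q[of "(B x x + 1) / (2 * B x y)"] True by simp
    then have "B x y = 0" by (cases "B x y = 0") auto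
    then show ?thesis using True by simp
  next
    case False
    then have pos: "B y y > 0" using nn[of y] by simp
    have "0 \<le> (B x x - 2 * (B x y / B y y) * B x y + (B x y / B y y)\<^sup>2 * B y y) * B y y"
      using q[of "B x y / B y y"] pos by simp
    also have "\<dots> = B x x * B y y - (B x y)\<^sup>2" using pos by (simp add: field_simps power2_eq_square)
    finally show ?thesis by simp
  qed
  then have "sqrt ((B x y)\<^sup>2) \<le> sqrt (B x x * B y y)" by (rule real_sqrt_le_mono)
  then show ?thesis by (simp add: real_sqrt_mult)
qed

text \<open>Peels one derivative off the tower in \<open>smooth_on\<close> and returns a smooth map
  again, so that it can be iterated to reach the second derivatives of transition maps and the third
  derivative of the metric.\<close>

lemma smooth_on_derivative:
  fixes f :: "'a::real_normed_vector \<Rightarrow> 'b::real_normed_vector"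
  assumes smooth: "smooth_on S f" and S: "open S"
  obtains f' where "\<And>x. x \<in> S \<Longrightarrow> (f has_derivative blinfun_apply (f' x)) (at x)" "smooth_on S f'"
proof -
  obtain D :: "'a \<Rightarrow> 'a list \<Rightarrow> 'b" where D: "\<forall>x\<in>S.
     D x [] = f x \<and>
     (\<forall>us ws. linear (\<lambda>v. D x (us @ v # ws))) \<and>
     (\<forall>k. \<exists>C. \<forall>vs. length vs = k \<longrightarrow> norm (D x vs) \<le> C * prod_list (map norm vs)) \<and>
     (\<forall>k. \<forall>\<epsilon>>0. \<exists>\<eta>>0. \<forall>y\<in>S. norm (y - x) < \<eta> \<longrightarrow>
        (\<forall>vs. length vs = k \<longrightarrow>
           norm (D y vs - D x vs - D x ((y - x) # vs))
             \<le> \<epsilon> * norm (y - x) * prod_list (map norm vs)))"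
    using smooth unfolding smooth_on_def by (elim exE)
  have D0: "D x [] = f x" if "x \<in> S" for x
    using bspec[OF D that] by (elim conjE)
  have lin: "linear (\<lambda>v. D x (us @ v # ws))" if "x \<in> S" for x us ws
    using bspec[OF D that] by (elim conjE allE)
  have bd: "\<exists>C. \<forall>vs. length vs = k \<longrightarrow> norm (D x vs) \<le> C * prod_list (map norm vs)" if "x \<in> S" for x k
    using bspec[OF D that] by (elim conjE) (erule spec)
  have df: "\<exists>\<eta>>0. \<forall>y\<in>S. norm (y - x) < \<eta> \<longrightarrow>
        (\<forall>vs. length vs = k \<longrightarrow> norm (D y vs - D x vs - D x ((y - x) # vs))
             \<le> \<epsilon> * norm (y - x) * prod_list (map norm vs))" if "x \<in> S" "\<epsilon> > 0" for x k \<epsilon>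
    using bspec[OF D that(1)] that(2) by blast
  have nnp: "0 \<le> prod_list (map norm vs)" for vs :: "'a list" by (induction vs) auto
  have bl: "bounded_linear (\<lambda>v. D x (vs @ [v]))" if x: "x \<in> S" for x vs
  proof -
    obtain C where C: "\<And>us. length us = Suc (length vs) \<Longrightarrow> norm (D x us) \<le> C * prod_list (map norm us)"
      using bd[OF x] by metis
    have "norm (D x (vs @ [v])) \<le> norm v * (C * prod_list (map norm vs))" for v
      using C[of "vs @ [v]"] by (simp add: mult_ac)
    then show ?thesis
      using lin[OF x, of vs "[]"] by (intro bounded_linear.intro bounded_linear_axioms.intro exI allI)
  qed
  \<comment> \<open>The new argument goes to the end of the list, because differentiation conses its
    direction at the head; the tower for the derivative is then again closed under
    differentiation.\<close>
  define D' where "D' x vs = Blinfun (\<lambda>v. D x (vs @ [v]))" for x vs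
  have D': "blinfun_apply (D' x vs) v = D x (vs @ [v])" if "x \<in> S" for x vs v
    unfolding D'_def by (simp add: bounded_linear_Blinfun_apply[OF bl[OF that]])
  have "(f has_derivative blinfun_apply (D' x [])) (at x)" if x: "x \<in> S" for x
    unfolding at_within_open[OF x S, symmetric] has_derivative_within_alt
  proof (intro conjI allI impI)
    show "bounded_linear (blinfun_apply (D' x []))" by (rule blinfun.bounded_linear_right)
    fix \<epsilon> :: real assume "\<epsilon> > 0"
    from df[OF x this, of 0] show "\<exists>d>0. \<forall>y\<in>S. norm (y - x) < d \<longrightarrow>
        norm (f y - f x - blinfun_apply (D' x []) (y - x)) \<le> \<epsilon> * norm (y - x)"
      using x by (simp add: D' D0)
  qed
  moreover have "smooth_on S (\<lambda>x. D' x [])"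
    unfolding smooth_on_def
  proof (intro exI[of _ D'] ballI conjI allI impI refl)
    fix x assume x: "x \<in> S"
    show "linear (\<lambda>v. D' x (us @ v # ws))" for us ws
    proof (rule linearI)
      fix a b and r :: real
      show "D' x (us @ (a + b) # ws) = D' x (us @ a # ws) + D' x (us @ b # ws)"
        using linear_add[OF lin[OF x]] by (intro blinfun_eqI) (simp add: D' x blinfun.add_left)
      show "D' x (us @ (r *\<^sub>R a) # ws) = r *\<^sub>R D' x (us @ a # ws)"
        using linear_scale[OF lin[OF x]] by (intro blinfun_eqI) (simp add: D' x blinfun.scaleR_left)
    qed
    show "\<exists>C. \<forall>vs. length vs = k \<longrightarrow> norm (D' x vs) \<le> C * prod_list (map norm vs)" for k
    proof -
      obtain C where C: "\<And>us. length us = Suc k \<Longrightarrow> norm (D x us) \<le> C * prod_list (map norm us)"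
        using bd[OF x] by metis
      have "norm (D' x vs) \<le> \<bar>C\<bar> * prod_list (map norm vs)" if "length vs = k" for vs
      proof (rule norm_blinfun_bound)
        show "0 \<le> \<bar>C\<bar> * prod_list (map norm vs)" using nnp by simp
        fix v
        have "norm (D x (vs @ [v])) \<le> C * prod_list (map norm (vs @ [v]))"
          using C[of "vs @ [v]"] that by simp
        also have "\<dots> \<le> \<bar>C\<bar> * prod_list (map norm (vs @ [v]))" by (rule mult_right_mono[OF _ nnp]) simp
        finally show "norm (blinfun_apply (D' x vs) v) \<le> \<bar>C\<bar> * prod_list (map norm vs) * norm v"
          by (simp add: D' x mult_ac)
      qed
      then show ?thesis by blast
    qed
    show "\<exists>\<eta>>0. \<forall>y\<in>S. norm (y - x) < \<eta> \<longrightarrow> (\<forall>vs. length vs = k \<longrightarrow>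
        norm (D' y vs - D' x vs - D' x ((y - x) # vs)) \<le> \<epsilon> * norm (y - x) * prod_list (map norm vs))"
      if e: "\<epsilon> > 0" for k and \<epsilon> :: real
    proof -
      obtain \<eta> where \<eta>: "\<eta> > 0" "\<And>y vs. y \<in> S \<Longrightarrow> norm (y - x) < \<eta> \<Longrightarrow> length vs = Suc k \<Longrightarrow>
          norm (D y vs - D x vs - D x ((y - x) # vs)) \<le> \<epsilon> * norm (y - x) * prod_list (map norm vs)"
        using df[OF x e, of "Suc k"] by metis
      have "norm (D' y vs - D' x vs - D' x ((y - x) # vs)) \<le> \<epsilon> * norm (y - x) * prod_list (map norm vs)"
        if y: "y \<in> S" "norm (y - x) < \<eta>" "length vs = k" for y vs
      proof (rule norm_blinfun_bound)
        show "0 \<le> \<epsilon> * norm (y - x) * prod_list (map norm vs)" using nnp \<open>\<epsilon> > 0\<close> by simp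
        show "norm (blinfun_apply (D' y vs - D' x vs - D' x ((y - x) # vs)) v)
            \<le> \<epsilon> * norm (y - x) * prod_list (map norm vs) * norm v" for v
          using \<eta>(2)[of y "vs @ [v]"] x y by (simp add: blinfun.diff_left D' mult_ac)
      qed
      with \<eta>(1) show ?thesis by blast
    qed
  qed
  ultimately show ?thesis by (rule that)
qed

text \<open>The second difference of \<open>f\<close> over the parallelogram spanned by
  \<open>s *\<^sub>R u\<close> and \<open>s *\<^sub>R v\<close> is symmetric in \<open>u\<close> and
  \<open>v\<close>, and up to \<open>\<epsilon> * s\<^sup>2\<close> it equals
  \<open>s\<^sup>2\<close> times the second derivative taken in either order.\<close>

lemma second_derivative_symmetric:
  fixes f :: "'a::real_normed_vector \<Rightarrow> 'b::real_normed_vector"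
  assumes S: "open S" "x \<in> S"
    and f': "\<And>y. y \<in> S \<Longrightarrow> (f has_derivative blinfun_apply (f' y)) (at y)"
    and f'': "(f' has_derivative f'') (at x)"
  shows "blinfun_apply (f'' u) v = blinfun_apply (f'' v) u"
proof -
  interpret f'': bounded_linear f'' using f'' by (rule has_derivative_bounded_linear)
  \<comment> \<open>The \<open>+ 1\<close> makes \<open>norm u + norm v < M\<close> strict, so all
    four corners stay strictly inside the radius \<open>s * M\<close> on which the estimates
    hold.\<close>
  define M where "M = norm u + norm v + 1"
  have M: "M > 0" "norm u \<le> M" "norm v \<le> M" "norm u + norm v < M" unfolding M_def
    by (auto simp: add_nonneg_pos)
  have est: "norm (blinfun_apply (f'' u) v - blinfun_apply (f'' v) u) \<le> 4 * M\<^sup>2 * \<epsilon>" if e: "\<epsilon> > 0" for \<epsilon>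
  proof -
    obtain \<delta>1 where \<delta>1: "\<delta>1 > 0" "\<And>y. norm (y - x) < \<delta>1 \<Longrightarrow> norm (f' y - f' x - f'' (y - x)) \<le> \<epsilon> * norm (y - x)"
      using f'' e unfolding has_derivative_at_alt by blast
    obtain \<delta>2 where \<delta>2: "\<delta>2 > 0" "\<And>y. norm (y - x) < \<delta>2 \<Longrightarrow> y \<in> S"
      using S by (metis open_contains_ball dist_norm mem_ball dist_commute subsetD)
    define s where "s = min \<delta>1 \<delta>2 / M"
    have s: "s > 0" "s * M \<le> \<delta>1" "s * M \<le> \<delta>2" using M \<delta>1 \<delta>2 by (auto simp: s_def)
    have half: "norm (f (x + s *\<^sub>R a + s *\<^sub>R b) - f (x + s *\<^sub>R a) - f (x + s *\<^sub>R b) + f x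
         - (s * s) *\<^sub>R blinfun_apply (f'' b) a) \<le> 2 * (s * s) * M\<^sup>2 * \<epsilon>"
      if ab: "norm a + norm b < M" for a b
    proof -
      \<comment> \<open>The second difference along the side \<open>a\<close>, minus its expected
        linear growth. In its derivative \<open>f'\<close> is expanded twice around
        \<open>x\<close>; the linear parts cancel and only the two remainders survive.\<close>
      define \<psi> where "\<psi> t = f (x + (s * t) *\<^sub>R a + s *\<^sub>R b) - f (x + (s * t) *\<^sub>R a)
         - t *\<^sub>R (s * s) *\<^sub>R blinfun_apply (f'' b) a" for t
      define \<psi>' where "\<psi>' t = s *\<^sub>R blinfun_apply (f' (x + (s * t) *\<^sub>R a + s *\<^sub>R b)) a
         - s *\<^sub>R blinfun_apply (f' (x + (s * t) *\<^sub>R a)) a - (s * s) *\<^sub>R blinfun_apply (f'' b) a" for t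
      have near: "norm ((s * t) *\<^sub>R a + s *\<^sub>R c) < s * M" if "t \<in> {0..1}" "norm c \<le> norm b" for t c
      proof -
        have "norm ((s * t) *\<^sub>R a + s *\<^sub>R c) \<le> s * t * norm a + s * norm c"
          using norm_triangle_ineq[of "(s * t) *\<^sub>R a" "s *\<^sub>R c"] s that by simp
        also have "\<dots> \<le> s * 1 * norm a + s * norm b"
          using that s by (intro add_mono mult_right_mono mult_left_mono) auto
        also have "\<dots> < s * M" using ab s by (simp add: distrib_left[symmetric])
        finally show ?thesis .
      qed
      have R: "norm (f' (x + h) - f' x - f'' h) \<le> \<epsilon> * (s * M)" if "norm h < s * M" for h
      proof -
        have "norm (f' (x + h) - f' x - f'' h) \<le> \<epsilon> * norm h" using \<delta>1(2)[of "x + h"] that s by simp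
        also have "\<dots> \<le> \<epsilon> * (s * M)" using e that by (intro mult_left_mono) auto
        finally show ?thesis .
      qed
      have deriv: "(\<psi> has_derivative (\<lambda>h. h *\<^sub>R \<psi>' t)) (at t within {0..1})" if t: "t \<in> {0..1}" for t
      proof -
        have 1: "x + (s * t) *\<^sub>R a + s *\<^sub>R b \<in> S" using \<delta>2(2)[of "x + (s * t) *\<^sub>R a + s *\<^sub>R b"] near[OF t, of b] s
          by (simp add: algebra_simps)
        have 2: "x + (s * t) *\<^sub>R a \<in> S" using \<delta>2(2)[of "x + (s * t) *\<^sub>R a"] near[OF t, of 0] s by simp
        have "((\<lambda>t. f (x + (s * t) *\<^sub>R a + s *\<^sub>R b)) has_derivative
            (\<lambda>h. blinfun_apply (f' (x + (s * t) *\<^sub>R a + s *\<^sub>R b)) ((s * h) *\<^sub>R a))) (at t within {0..1})"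
          by (rule has_derivative_compose[of "\<lambda>t. x + (s * t) *\<^sub>R a + s *\<^sub>R b" _ t _ f, OF _ f'[OF 1]]) (auto intro!: derivative_eq_intros)
        moreover have "((\<lambda>t. f (x + (s * t) *\<^sub>R a)) has_derivative
            (\<lambda>h. blinfun_apply (f' (x + (s * t) *\<^sub>R a)) ((s * h) *\<^sub>R a))) (at t within {0..1})"
          by (rule has_derivative_compose[of "\<lambda>t. x + (s * t) *\<^sub>R a" _ t _ f, OF _ f'[OF 2]]) (auto intro!: derivative_eq_intros)
        ultimately show ?thesis
          unfolding \<psi>_def \<psi>'_def
          by (auto intro!: derivative_eq_intros simp: blinfun.scaleR_right algebra_simps)
      qed
      have bound: "norm (\<psi>' t) \<le> 2 * (s * s) * M\<^sup>2 * \<epsilon>" if t: "t \<in> {0..1}" for t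
      proof -
        define h1 where "h1 = (s * t) *\<^sub>R a + s *\<^sub>R b"
        define h2 where "h2 = (s * t) *\<^sub>R a"
        define R1 where "R1 = f' (x + h1) - f' x - f'' h1"
        define R2 where "R2 = f' (x + h2) - f' x - f'' h2"
        have "norm R1 \<le> \<epsilon> * (s * M)" "norm R2 \<le> \<epsilon> * (s * M)"
          using R[of h1] R[of h2] near[OF t, of b] near[OF t, of 0] by (auto simp: h1_def h2_def R1_def R2_def)
        then have R12: "norm (R1 - R2) \<le> 2 * \<epsilon> * (s * M)" using norm_triangle_ineq4[of R1 R2] by linarith
        have "f'' h1 - f'' h2 = s *\<^sub>R f'' b" by (simp add: h1_def h2_def f''.add f''.scaleR)
        then have eq: "R1 - R2 = f' (x + h1) - f' (x + h2) - s *\<^sub>R f'' b"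
          unfolding R1_def R2_def by (simp add: algebra_simps)
        have "\<psi>' t = s *\<^sub>R blinfun_apply (R1 - R2) a"
          unfolding \<psi>'_def eq by (simp add: h1_def h2_def blinfun.diff_left blinfun.add_left blinfun.scaleR_left algebra_simps)
        then have "norm (\<psi>' t) = s * norm (blinfun_apply (R1 - R2) a)" using s by simp
        also have "\<dots> \<le> s * (norm (R1 - R2) * norm a)" using s norm_blinfun by (intro mult_left_mono) auto
        also have "\<dots> \<le> s * (2 * \<epsilon> * (s * M) * M)"
          using R12 s M e ab by (intro mult_left_mono mult_mono) (auto simp: order_trans[OF _ less_imp_le[OF ab]])
        finally show ?thesis by (simp add: power2_eq_square algebra_simps)
      qed
      have "norm (\<psi> 1 - \<psi> 0) \<le> 2 * (s * s) * M\<^sup>2 * \<epsilon> * norm (1 - 0 :: real)"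
      proof (rule differentiable_bound[OF convex_closed_interval])
        show "onorm (\<lambda>h. h *\<^sub>R \<psi>' t) \<le> 2 * (s * s) * M\<^sup>2 * \<epsilon>" if "t \<in> {0..1}" for t
          using bound[OF that] onorm_scaleR_left[OF bounded_linear_ident, of "\<psi>' t"] by (simp add: onorm_id)
      qed (use deriv in auto)
      then show ?thesis by (simp add: \<psi>_def algebra_simps)
    qed
    define \<Delta> where "\<Delta> = f (x + s *\<^sub>R u + s *\<^sub>R v) - f (x + s *\<^sub>R u) - f (x + s *\<^sub>R v) + f x"
    have 1: "norm (\<Delta> - (s * s) *\<^sub>R blinfun_apply (f'' v) u) \<le> 2 * (s * s) * M\<^sup>2 * \<epsilon>"
      using half[of u v] M unfolding \<Delta>_def by simp
    have 2: "norm (\<Delta> - (s * s) *\<^sub>R blinfun_apply (f'' u) v) \<le> 2 * (s * s) * M\<^sup>2 * \<epsilon>"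
      using half[of v u] M unfolding \<Delta>_def by (simp add: algebra_simps)
    have "(s * s) * norm (blinfun_apply (f'' u) v - blinfun_apply (f'' v) u)
       = norm ((\<Delta> - (s * s) *\<^sub>R blinfun_apply (f'' v) u) - (\<Delta> - (s * s) *\<^sub>R blinfun_apply (f'' u) v))"
      using s by (simp add: scaleR_diff_right[symmetric])
    also have "\<dots> \<le> 2 * (s * s) * M\<^sup>2 * \<epsilon> + 2 * (s * s) * M\<^sup>2 * \<epsilon>"
      by (rule order_trans[OF norm_triangle_ineq4 add_mono[OF 1 2]])
    also have "\<dots> = (s * s) * (4 * M\<^sup>2 * \<epsilon>)" by simp
    finally show ?thesis using s by simp
  qed
  have "norm (blinfun_apply (f'' u) v - blinfun_apply (f'' v) u) \<le> 0 + e" if "e > 0" for e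
  proof -
    have "4 * M\<^sup>2 * (e / (4 * M\<^sup>2)) = e" using M by simp
    then show ?thesis using est[of "e / (4 * M\<^sup>2)"] that M by simp
  qed
  then have "norm (blinfun_apply (f'' u) v - blinfun_apply (f'' v) u) \<le> 0" by (rule field_le_epsilon)
  then show ?thesis by simp
qed

section \<open>Ordinary differential equations in Hilbert space\<close>

text \<open>Smallness is demanded of the field instead of the time interval: over unit time the
  bound \<open>r\<close> keeps the integral operator inside the ball, and \<open>L < 1\<close> makes
  it a contraction in the supremum norm.\<close>

lemma picard_banach:
  fixes F :: "'a::banach \<Rightarrow> 'a"
  assumes r: "r \<ge> 0" and L: "0 \<le> L" "L < 1"
    and bound: "\<And>y. y \<in> cball y0 r \<Longrightarrow> norm (F y) \<le> r"
    and lip: "\<And>y z. y \<in> cball y0 r \<Longrightarrow> z \<in> cball y0 r \<Longrightarrow> norm (F y - F z) \<le> L * norm (y - z)"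
  obtains y where "y 0 = y0" "\<And>t. t \<in> {0..1} \<Longrightarrow> y t \<in> cball y0 r"
    "\<And>t. t \<in> {0..1} \<Longrightarrow> (y has_vector_derivative F (y t)) (at t within {0..1})"
proof -
  \<comment> \<open>Clamping time to \<open>{0..1}\<close> turns the iterates into bounded
    continuous functions on the whole line, where the complete space of such functions is
    available.\<close>
  define cl where "cl t = max 0 (min 1 t)" for t :: real
  have cl: "cl t \<in> {0..1}" "t \<in> {0..1} \<Longrightarrow> cl t = t" for t by (auto simp: cl_def)
  have cont_cl: "continuous_on UNIV cl" unfolding cl_def by (intro continuous_intros)
  define S where "S = PiC (UNIV :: real set) (\<lambda>_. cball y0 r)"
  have S: "u \<in> S \<longleftrightarrow> (\<forall>t. apply_bcontfun u t \<in> cball y0 r)" for u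
    unfolding S_def mem_PiC_iff by auto
  have contF: "continuous_on (cball y0 r) F"
  proof (rule continuous_on_iff[THEN iffD2, rule_format])
    fix x e assume x: "x \<in> cball y0 r" and "e > (0::real)"
    have "dist (F y) (F x) < e" if y: "y \<in> cball y0 r" "dist y x < e" for y
    proof -
      have "norm (F y - F x) \<le> 1 * norm (y - x)"
        using lip[OF y(1) x] L by (meson less_imp_le mult_right_mono norm_ge_zero order_trans)
      then show ?thesis using y(2) by (simp add: dist_norm)
    qed
    then show "\<exists>d>0. \<forall>y\<in>cball y0 r. dist y x < d \<longrightarrow> dist (F y) (F x) < e"
      using \<open>e > 0\<close> by blast
  qed
  have contFu: "continuous_on T (\<lambda>s. F (apply_bcontfun u s))" if "u \<in> S" for u T
    using that unfolding S
    by (intro continuous_on_compose2[OF contF] continuous_on_apply_bcontfun) auto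
  define h where "h u t = y0 + integral {0..cl t} (\<lambda>s. F (apply_bcontfun u s))" for u t
  have int_bound: "norm (integral {0..cl t} k) \<le> B"
    if "continuous_on {0..1} k" "\<And>s. s \<in> {0..1} \<Longrightarrow> norm (k s) \<le> B" for B t and k :: "real \<Rightarrow> 'a"
  proof -
    have B: "B \<ge> 0" using that(2)[of 0] by (smt (verit) norm_ge_zero atLeastAtMost_iff)
    have "norm (integral {0..cl t} k) \<le> B * (cl t - 0)"
      using cl(1)[of t] by (intro integral_bound continuous_on_subset[OF that(1)] that(2)) auto
    also have "\<dots> \<le> B" using B cl(1)[of t] by (simp add: mult_left_le)
    finally show ?thesis .
  qed
  have cont_h: "continuous_on UNIV (h u)" if "u \<in> S" for u
  proof -
    have "continuous_on {0..1} (\<lambda>t. integral {0..t} (\<lambda>s. F (apply_bcontfun u s)))"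
      by (intro indefinite_integral_continuous_1 integrable_continuous_real contFu that)
    then have "continuous_on UNIV (\<lambda>t. integral {0..cl t} (\<lambda>s. F (apply_bcontfun u s)))"
      by (rule continuous_on_compose2[OF _ cont_cl]) (use cl in auto)
    then show ?thesis unfolding h_def by (intro continuous_intros)
  qed
  have h_ball: "h u t \<in> cball y0 r" if "u \<in> S" for u t
    using int_bound[OF contFu[OF that], of r t] bound that S
    unfolding h_def by (simp add: dist_norm)
  define \<Phi> where "\<Phi> u = Bcontfun (h u)" for u
  have \<Phi>: "apply_bcontfun (\<Phi> u) = h u" if "u \<in> S" for u
  proof -
    have "h u \<in> bcontfun"
      using cont_h[OF that] h_ball[OF that]
      by (auto simp: bcontfun_def intro!: bounded_subset[OF bounded_cball[of y0 r]])
    then show ?thesis unfolding \<Phi>_def by (simp add: Bcontfun_inverse)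
  qed
  have "\<exists>!u\<in>S. \<Phi> u = u"
  proof (rule Banach_fix[OF _ _ L])
    show "complete S" unfolding S_def complete_eq_closed by (intro closed_PiC) auto
    show "S \<noteq> {}" using S[of "const_bcontfun y0"] r by (auto simp: const_bcontfun.rep_eq)
    show "\<Phi> ` S \<subseteq> S" using h_ball \<Phi> by (auto simp: S)
    show "dist (\<Phi> u) (\<Phi> v) \<le> L * dist u v" if u: "u \<in> S" and v: "v \<in> S" for u v
    proof (rule dist_bound)
      fix t
      have "h u t - h v t = integral {0..cl t} (\<lambda>s. F (apply_bcontfun u s) - F (apply_bcontfun v s))"
        unfolding h_def by (simp add: integral_diff integrable_continuous_real contFu u v)
      also have "norm \<dots> \<le> L * dist u v"
      proof (rule int_bound)
        show "continuous_on {0..1} (\<lambda>s. F (apply_bcontfun u s) - F (apply_bcontfun v s))"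
          by (intro continuous_intros contFu u v)
        fix s :: real
        have "norm (F (apply_bcontfun u s) - F (apply_bcontfun v s))
            \<le> L * norm (apply_bcontfun u s - apply_bcontfun v s)"
          using u v by (intro lip) (auto simp: S)
        also have "\<dots> \<le> L * dist u v"
          using dist_bounded[of u s v] L by (intro mult_left_mono) (auto simp: dist_norm)
        finally show "norm (F (apply_bcontfun u s) - F (apply_bcontfun v s)) \<le> L * dist u v" .
      qed
      finally show "dist (apply_bcontfun (\<Phi> u) t) (apply_bcontfun (\<Phi> v) t) \<le> L * dist u v"
        by (simp add: \<Phi> u v dist_norm)
    qed
  qed
  then obtain u where u: "u \<in> S" "\<Phi> u = u" by blast
  have eq: "apply_bcontfun u t = y0 + integral {0..t} (\<lambda>s. F (apply_bcontfun u s))" if "t \<in> {0..1}" for t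
    using \<Phi>[OF u(1)] u(2) cl(2)[OF that] unfolding h_def by metis
  show ?thesis
  proof (rule that[of "apply_bcontfun u"])
    show "apply_bcontfun u 0 = y0" using eq[of 0] by simp
    show "apply_bcontfun u t \<in> cball y0 r" for t using u S by auto
    fix t :: real assume t: "t \<in> {0..1}"
    have "((\<lambda>t. integral {0..t} (\<lambda>s. F (apply_bcontfun u s))) has_vector_derivative F (apply_bcontfun u t))
        (at t within {0..1})"
      by (rule integral_has_vector_derivative[OF contFu[OF u(1)] t])
    then have "((\<lambda>t. y0 + integral {0..t} (\<lambda>s. F (apply_bcontfun u s))) has_vector_derivative
        F (apply_bcontfun u t)) (at t within {0..1})"
      by (auto intro!: derivative_eq_intros)
    then show "(apply_bcontfun u has_vector_derivative F (apply_bcontfun u t)) (at t within {0..1})"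
      by (rule has_vector_derivative_transform[OF t, rotated]) (use eq in auto)
  qed
qed

text \<open>
  The sort \<open>{real_inner,complete_space}\<close> is not a subsort of class \<open>banach\<close>, so the integrals in the
  Picard iteration are taken in the dual, which is isometric to the space.
\<close>

lemma picard_hilbert:
  fixes F :: "'a::{real_inner,complete_space} \<Rightarrow> 'a"
  assumes r: "r \<ge> 0" and L: "0 \<le> L" "L < 1"
    and bound: "\<And>y. y \<in> cball y0 r \<Longrightarrow> norm (F y) \<le> r"
    and lip: "\<And>y z. y \<in> cball y0 r \<Longrightarrow> z \<in> cball y0 r \<Longrightarrow> norm (F y - F z) \<le> L * norm (y - z)"
  obtains y where "y 0 = y0" "\<And>t. t \<in> {0..1} \<Longrightarrow> y t \<in> cball y0 r"
    "\<And>t. t \<in> {0..1} \<Longrightarrow> (y has_vector_derivative F (y t)) (at t within {0..1})"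
proof -
  define j :: "'a \<Rightarrow> 'a \<Rightarrow>\<^sub>L real" where "j = blinfun_inner_right"
  have j_app: "blinfun_apply (j x) y = x \<bullet> y" for x y by (simp add: j_def)
  interpret j: bounded_linear j unfolding j_def by (rule bounded_linear_blinfun_inner_right)
  have norm_j: "norm (j x) = norm x" for x
  proof (rule antisym)
    show "norm (j x) \<le> norm x"
      by (rule norm_blinfun_bound) (auto simp: j_app Cauchy_Schwarz_ineq2)
    have "norm x * norm x \<le> norm (j x) * norm x"
      using norm_blinfun[of "j x" x] by (simp add: j_app norm_eq_sqrt_inner)
    then show "norm x \<le> norm (j x)" by (cases "x = 0") auto
  qed
  \<comment> \<open>Riesz representation: the inner product is a coercive form with constant
    1.\<close>
  have surj: "\<exists>x. j x = \<phi>" for \<phi>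
  proof -
    obtain x where "\<And>w. x \<bullet> w = blinfun_apply \<phi> w"
      using coercive_form_representation[OF bounded_bilinear_inner inner_commute zero_less_one _
          blinfun.bounded_linear_right, of \<phi>]
      by (auto simp: power2_norm_eq_inner)
    then show ?thesis by (intro exI[of _ x] blinfun_eqI) (simp add: j_app)
  qed
  define k where "k = inv j"
  have jk: "j (k \<phi>) = \<phi>" for \<phi> unfolding k_def using surj by (metis f_inv_into_f rangeI)
  have kj: "k (j x) = x" for x
    using norm_j[of "k (j x) - x"] by (simp add: j.diff jk)
  have norm_k: "norm (k \<phi>) = norm \<phi>" for \<phi> using norm_j[of "k \<phi>"] jk by simp
  have k_diff: "k (\<phi> - \<psi>) = k \<phi> - k \<psi>" for \<phi> \<psi> by (metis j.diff jk kj)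
  have k_bl: "bounded_linear k"
    by (rule bounded_linear_intro[where K = 1])
      (use jk kj norm_k in \<open>metis j.add\<close>, use jk kj j.scaleR in metis, use norm_k in auto)
  have k_ball: "k \<phi> \<in> cball y0 r" if "\<phi> \<in> cball (j y0) r" for \<phi>
    using that norm_k[of "j y0 - \<phi>"] by (simp add: dist_norm k_diff kj)
  obtain u where u: "u 0 = j y0" "\<And>t. t \<in> {0..1} \<Longrightarrow> u t \<in> cball (j y0) r"
    "\<And>t. t \<in> {0..1} \<Longrightarrow> (u has_vector_derivative j (F (k (u t)))) (at t within {0..1})"
  proof (rule picard_banach[OF r L, of "j y0" "\<lambda>\<phi>. j (F (k \<phi>))"])
    show "norm (j (F (k \<phi>))) \<le> r" if "\<phi> \<in> cball (j y0) r" for \<phi>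
      using bound[OF k_ball[OF that]] by (simp add: norm_j)
    show "norm (j (F (k \<phi>)) - j (F (k \<psi>))) \<le> L * norm (\<phi> - \<psi>)"
      if "\<phi> \<in> cball (j y0) r" "\<psi> \<in> cball (j y0) r" for \<phi> \<psi>
      using lip[OF k_ball[OF that(1)] k_ball[OF that(2)]]
      by (metis j.diff norm_j norm_k k_diff)
  qed blast
  show ?thesis
  proof (rule that[of "k \<circ> u"])
    show "(k \<circ> u) 0 = y0" by (simp add: u kj)
    show "(k \<circ> u) t \<in> cball y0 r" if "t \<in> {0..1}" for t using k_ball u(2)[OF that] by simp
    show "((k \<circ> u) has_vector_derivative F ((k \<circ> u) t)) (at t within {0..1})" if "t \<in> {0..1}" for t
      using bounded_linear.has_vector_derivative[OF k_bl u(3)[OF that]] by (simp add: o_def kj)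
  qed
qed

text \<open>
  Writing the velocity as \<open>s *\<^sub>R w\<close> with \<open>s = norm \<xi>\<close>, homogeneity turns the equation into
  \<open>x' = s *\<^sub>R w\<close>, \<open>w' = s *\<^sub>R F x w\<close>, which is a contraction problem for small \<open>s\<close>.
\<close>

lemma second_order_ode_small_velocity:
  fixes F :: "'a::{real_inner,complete_space} \<Rightarrow> 'a \<Rightarrow> 'a"
  assumes R: "R > 0"
    and hom: "\<And>x v s. x \<in> cball x0 R \<Longrightarrow> F x (s *\<^sub>R v) = s\<^sup>2 *\<^sub>R F x v"
    and bound: "\<And>x v. x \<in> cball x0 R \<Longrightarrow> norm (F x v) \<le> C * (norm v)\<^sup>2"
    and lip: "\<And>x y u v. x \<in> cball x0 R \<Longrightarrow> y \<in> cball x0 R \<Longrightarrow> norm u \<le> 2 \<Longrightarrow> norm v \<le> 2 \<Longrightarrow>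
      norm (F x u - F y v) \<le> L * (norm (x - y) + norm (u - v))"
  obtains \<eta> K where "\<eta> > 0" "\<And>\<xi>. norm \<xi> < \<eta> \<Longrightarrow> \<exists>x v. x 0 = x0 \<and> v 0 = \<xi> \<and>
     (\<forall>t\<in>{0..1}. x t \<in> cball x0 R \<and> (x has_vector_derivative v t) (at t within {0..1}) \<and>
        (v has_vector_derivative F (x t) (v t)) (at t within {0..1})) \<and>
     norm (x 1 - x0 - \<xi>) \<le> K * (norm \<xi>)\<^sup>2"
proof -
  define C' where "C' = \<bar>C\<bar>"
  define L' where "L' = \<bar>L\<bar>"
  \<comment> \<open>The cap at 1 keeps \<open>w\<close> within norm 2 of the origin, since it starts
    with norm at most 1; this is the range covered by \<open>lip\<close>.\<close>
  define r where "r = min R 1"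
  have r: "r > 0" "r \<le> R" "r \<le> 1" using R by (auto simp: r_def)
  \<comment> \<open>The first part of the denominator serves
    \<open>s * (2 + 4 * C') \<le> r\<close>, which bounds the field by the radius; the second serves
    \<open>s * (1 + 2 * L') \<le> 1/2\<close>, the contraction constant.\<close>
  define \<eta> where "\<eta> = r / (2 + 4 * C' + 2 * (1 + 2 * L'))"
  have pos: "C' \<ge> 0" "L' \<ge> 0" by (auto simp: C'_def L'_def)
  have \<eta>: "\<eta> > 0" unfolding \<eta>_def using r pos by (intro divide_pos_pos) auto
  have "\<exists>x v. x 0 = x0 \<and> v 0 = \<xi> \<and>
     (\<forall>t\<in>{0..1}. x t \<in> cball x0 R \<and> (x has_vector_derivative v t) (at t within {0..1}) \<and>
        (v has_vector_derivative F (x t) (v t)) (at t within {0..1})) \<and>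
     norm (x 1 - x0 - \<xi>) \<le> 4 * C' * (norm \<xi>)\<^sup>2" if small: "norm \<xi> < \<eta>" for \<xi>
  proof -
    define s where "s = norm \<xi>"
    have "s * (2 + 4 * C' + 2 * (1 + 2 * L')) \<le> r"
    proof -
      have "s * (2 + 4 * C' + 2 * (1 + 2 * L')) \<le> \<eta> * (2 + 4 * C' + 2 * (1 + 2 * L'))"
        using small pos by (intro mult_right_mono) (auto simp: s_def)
      then show ?thesis using pos unfolding \<eta>_def by (simp add: add_nonneg_pos)
    qed
    moreover have s0: "s \<ge> 0" by (simp add: s_def)
    moreover have "s * (1 + 2 * L') \<ge> 0" "s * (2 + 4 * C') \<ge> 0" using s0 pos by simp_all
    ultimately have s: "s * (2 + 4 * C') \<le> r" "s * (1 + 2 * L') \<le> 1/2"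
      using r(3) unfolding distrib_left[of s "2 + 4 * C'" "2 * (1 + 2 * L')"]
      by (auto simp: algebra_simps)
    \<comment> \<open>For \<open>\<xi> = 0\<close> division by zero gives \<open>w0 = 0\<close>, and
      both facts below still hold.\<close>
    define w0 where "w0 = (1 / norm \<xi>) *\<^sub>R \<xi>"
    have w0: "norm w0 \<le> 1" "s *\<^sub>R w0 = \<xi>" by (auto simp: w0_def s_def)
    define \<Phi> where "\<Phi> p = (s *\<^sub>R snd p, s *\<^sub>R F (fst p) (snd p))" for p
    have ball: "fst p \<in> cball x0 R" "norm (snd p) \<le> 2" if "p \<in> cball (x0, w0) r" for p
    proof -
      have "dist x0 (fst p) \<le> r" "dist w0 (snd p) \<le> r"
        using that dist_fst_le[of "(x0, w0)" p] dist_snd_le[of "(x0, w0)" p] by auto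
      then show "fst p \<in> cball x0 R" "norm (snd p) \<le> 2"
        using r w0(1) norm_triangle_sub[of "snd p" w0] by (auto simp: dist_norm norm_minus_commute)
    qed
    obtain p where p: "p 0 = (x0, w0)" "\<And>t. t \<in> {0..1} \<Longrightarrow> p t \<in> cball (x0, w0) r"
      "\<And>t. t \<in> {0..1} \<Longrightarrow> (p has_vector_derivative \<Phi> (p t)) (at t within {0..1})"
    proof (rule picard_hilbert[of r "1/2" "(x0, w0)" \<Phi>])
      show "norm (\<Phi> q) \<le> r" if q: "q \<in> cball (x0, w0) r" for q
      proof -
        have "norm (F (fst q) (snd q)) \<le> C * (norm (snd q))\<^sup>2" by (rule bound[OF ball(1)[OF q]])
        also have "\<dots> \<le> C' * 2\<^sup>2"
          using ball(2)[OF q] by (intro mult_mono power_mono) (auto simp: C'_def)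
        finally have "norm (F (fst q) (snd q)) \<le> 4 * C'" by simp
        moreover have "norm (\<Phi> q) \<le> norm (s *\<^sub>R snd q) + norm (s *\<^sub>R F (fst q) (snd q))"
          unfolding \<Phi>_def by (rule norm_Pair_le)
        moreover have "norm (s *\<^sub>R snd q) \<le> s * 2" using s0 ball(2)[OF q] by (simp add: mult_left_mono)
        moreover have "norm (s *\<^sub>R F (fst q) (snd q)) \<le> s * norm (F (fst q) (snd q))" using s0 by simp
        moreover have "s * norm (F (fst q) (snd q)) \<le> s * (4 * C')"
          using s0 calculation(1) by (intro mult_left_mono)
        ultimately have "norm (\<Phi> q) \<le> s * 2 + s * (4 * C')" by linarith
        then show ?thesis using s by (simp add: algebra_simps)
      qed
      show "norm (\<Phi> q - \<Phi> q') \<le> 1/2 * norm (q - q')"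
        if q: "q \<in> cball (x0, w0) r" "q' \<in> cball (x0, w0) r" for q q'
      proof -
        have fs: "norm (fst q - fst q') \<le> norm (q - q')" "norm (snd q - snd q') \<le> norm (q - q')"
          by (metis norm_fst_le fst_diff prod.collapse, metis norm_snd_le snd_diff prod.collapse)
        have "norm (F (fst q) (snd q) - F (fst q') (snd q'))
            \<le> L * (norm (fst q - fst q') + norm (snd q - snd q'))"
          by (intro lip ball q)
        also have "\<dots> \<le> L' * (2 * norm (q - q'))"
          using fs by (intro mult_mono) (auto simp: L'_def)
        finally have 1: "norm (F (fst q) (snd q) - F (fst q') (snd q')) \<le> 2 * L' * norm (q - q')" by simp
        have "\<Phi> q - \<Phi> q' = (s *\<^sub>R (snd q - snd q'), s *\<^sub>R (F (fst q) (snd q) - F (fst q') (snd q')))"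
          by (simp add: \<Phi>_def scaleR_diff_right)
        then have "norm (\<Phi> q - \<Phi> q') \<le> s * norm (snd q - snd q') + s * norm (F (fst q) (snd q) - F (fst q') (snd q'))"
          using norm_Pair_le s0 by (metis abs_of_nonneg norm_scaleR)
        also have "\<dots> \<le> s * norm (q - q') + s * (2 * L' * norm (q - q'))"
          using fs 1 s0 by (intro add_mono mult_left_mono)
        also have "\<dots> = (s * (1 + 2 * L')) * norm (q - q')" by (simp add: algebra_simps)
        also have "\<dots> \<le> 1/2 * norm (q - q')" using s by (intro mult_right_mono) auto
        finally show ?thesis .
      qed
    qed (use r in auto)
    define x where "x t = fst (p t)" for t
    define v where "v t = s *\<^sub>R snd (p t)" for t
    have x': "(x has_vector_derivative v t) (at t within {0..1})" if "t \<in> {0..1}" for t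
      using bounded_linear.has_vector_derivative[OF bounded_linear_fst p(3)[OF that]]
      by (simp add: x_def[abs_def] v_def \<Phi>_def)
    have v': "(v has_vector_derivative F (x t) (v t)) (at t within {0..1})" if "t \<in> {0..1}" for t
      using bounded_linear.has_vector_derivative[OF bounded_linear_scaleR_right[of s]
          bounded_linear.has_vector_derivative[OF bounded_linear_snd p(3)[OF that]]]
      by (simp add: x_def v_def[abs_def] \<Phi>_def hom[OF ball(1)[OF p(2)[OF that]]] power2_eq_square)
    have Fb: "norm (F (x t) (v t)) \<le> 4 * C' * s\<^sup>2" if "t \<in> {0..1}" for t
    proof -
      have "norm (F (x t) (v t)) \<le> C * (norm (v t))\<^sup>2"
        unfolding x_def by (rule bound[OF ball(1)[OF p(2)[OF that]]])
      also have "\<dots> \<le> C' * (2 * s)\<^sup>2"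
        using ball(2)[OF p(2)[OF that]] s0 by (intro mult_mono power_mono) (auto simp: C'_def v_def mult_left_mono mult.commute)
      finally show ?thesis by (simp add: power2_eq_square)
    qed
    \<comment> \<open>The acceleration is of order \<open>s\<^sup>2\<close>; integrating it once
      controls the change of velocity, integrating it twice the deviation of the endpoint from
      \<open>x0 + \<xi>\<close>.\<close>
    have v_near: "norm (v t - \<xi>) \<le> 4 * C' * s\<^sup>2" if t: "t \<in> {0..1}" for t
    proof -
      have "norm (v t - v 0) \<le> 4 * C' * s\<^sup>2 * norm (t - 0)"
      proof (rule differentiable_bound[of "{0..1}" v "\<lambda>t h. h *\<^sub>R F (x t) (v t)"])
        show "onorm (\<lambda>h. h *\<^sub>R F (x t) (v t)) \<le> 4 * C' * s\<^sup>2" if "t \<in> {0..1}" for t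
          using Fb[OF that] onorm_scaleR_left[OF bounded_linear_ident, of "F (x t) (v t)"] by (simp add: onorm_id)
      qed (use v' t in \<open>auto simp: has_vector_derivative_def\<close>)
      also have "\<dots> \<le> 4 * C' * s\<^sup>2" using t pos by (simp add: mult_left_le)
      finally show ?thesis using p(1) w0 by (simp add: v_def)
    qed
    have "norm ((x 1 - 1 *\<^sub>R \<xi>) - (x 0 - 0 *\<^sub>R \<xi>)) \<le> 4 * C' * s\<^sup>2 * norm (1 - 0 :: real)"
    proof (rule differentiable_bound[of "{0..1}" "\<lambda>t. x t - t *\<^sub>R \<xi>" "\<lambda>t h. h *\<^sub>R (v t - \<xi>)"])
      show "onorm (\<lambda>h. h *\<^sub>R (v t - \<xi>)) \<le> 4 * C' * s\<^sup>2" if "t \<in> {0..1}" for t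
        using v_near[OF that] onorm_scaleR_left[OF bounded_linear_ident, of "v t - \<xi>"] by (simp add: onorm_id)
      show "((\<lambda>t. x t - t *\<^sub>R \<xi>) has_derivative (\<lambda>h. h *\<^sub>R (v t - \<xi>))) (at t within {0..1})" if "t \<in> {0..1}" for t
        using x'[OF that] unfolding has_vector_derivative_def
        by (auto intro!: derivative_eq_intros simp: scaleR_diff_right)
    qed auto
    then have "norm (x 1 - x0 - \<xi>) \<le> 4 * C' * (norm \<xi>)\<^sup>2"
      using p(1) by (simp add: x_def s_def algebra_simps)
    moreover have "x 0 = x0" "v 0 = \<xi>" using p(1) w0 by (auto simp: x_def v_def)
    ultimately show ?thesis
      using x' v' ball(1)[OF p(2)] by (intro exI[of _ x] exI[of _ v]) (auto simp: x_def)
  qed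
  with \<eta> show ?thesis by (rule that)
qed

text \<open>Gronwall: the squared distance damped by \<open>exp (- 2 * L * t)\<close> is
  nonincreasing and starts at 0. The Lipschitz bound is asked for along the two solutions
  only.\<close>

lemma ode_unique:
  fixes y z :: "real \<Rightarrow> 'a::real_inner"
  assumes ab: "a \<le> b"
    and y: "\<And>t. t \<in> {a..b} \<Longrightarrow> (y has_vector_derivative y' t) (at t within {a..b})"
    and z: "\<And>t. t \<in> {a..b} \<Longrightarrow> (z has_vector_derivative z' t) (at t within {a..b})"
    and lip: "\<And>t. t \<in> {a..b} \<Longrightarrow> norm (y' t - z' t) \<le> L * norm (y t - z t)"
    and init: "y a = z a"
  shows "y b = z b"
proof -
  define \<phi> where "\<phi> t = ((y t - z t) \<bullet> (y t - z t)) * exp (- 2 * L * t)" for t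
  define \<phi>' where "\<phi>' t = (2 * ((y' t - z' t) \<bullet> (y t - z t)) - 2 * L * ((y t - z t) \<bullet> (y t - z t))) * exp (- 2 * L * t)" for t
  have d: "(\<phi> has_real_derivative \<phi>' t) (at t within {a..b})" if "t \<in> {a..b}" for t
  proof -
    have "(\<phi> has_derivative (\<lambda>h. h * \<phi>' t)) (at t within {a..b})"
      using y[OF that] z[OF that] unfolding has_vector_derivative_def \<phi>_def
      by (auto intro!: derivative_eq_intros simp: \<phi>'_def inner_diff_left inner_diff_right inner_commute algebra_simps)
    then show ?thesis by (simp add: has_field_derivative_def mult_commute_abs)
  qed
  have "\<phi>' t \<le> 0" if "t \<in> {a..b}" for t
  proof -
    have "(y' t - z' t) \<bullet> (y t - z t) \<le> norm (y' t - z' t) * norm (y t - z t)" by (rule norm_cauchy_schwarz)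
    also have "\<dots> \<le> L * norm (y t - z t) * norm (y t - z t)" by (intro mult_right_mono lip that) auto
    also have "\<dots> = L * ((y t - z t) \<bullet> (y t - z t))" by (simp add: dot_square_norm power2_eq_square)
    finally show ?thesis unfolding \<phi>'_def by (intro mult_nonpos_nonneg) auto
  qed
  have "\<phi> b \<le> \<phi> a"
  proof (intro DERIV_nonpos_imp_decreasing_open[OF ab])
    show "\<exists>y. (\<phi> has_real_derivative y) (at t) \<and> y \<le> 0" if "a < t" "t < b" for t
      using d[of t] \<open>\<And>t. t \<in> {a..b} \<Longrightarrow> \<phi>' t \<le> 0\<close>[of t] that at_within_Icc_at[OF that] by auto
    show "continuous_on {a..b} \<phi>" by (rule DERIV_continuous_on[OF d])
  qed
  then have "(y b - z b) \<bullet> (y b - z b) * exp (- 2 * L * b) \<le> 0" using init by (simp add: \<phi>_def)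
  then have "(y b - z b) \<bullet> (y b - z b) \<le> 0" by (simp add: mult_le_0_iff)
  then have "y b - z b = 0" by (metis antisym inner_eq_zero_iff inner_ge_zero)
  then show ?thesis by simp
qed

section \<open>Variational principles\<close>

text \<open>The hypothesis \<open>limit\<close> stands for completeness of \<open>D\<close> together with lower semicontinuity of \<open>F\<close>.\<close>

lemma ekeland_pseudometric:
  fixes D :: "'m \<Rightarrow> 'm \<Rightarrow> real" and F :: "'m \<Rightarrow> real"
  assumes x0: "x0 \<in> B" and K: "K > 0"
    and nonneg: "\<And>x y. x \<in> B \<Longrightarrow> y \<in> B \<Longrightarrow> 0 \<le> D x y"
    and refl: "\<And>x. x \<in> B \<Longrightarrow> D x x = 0"
    and sym: "\<And>x y. x \<in> B \<Longrightarrow> y \<in> B \<Longrightarrow> D x y = D y x"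
    and triangle: "\<And>x y z. x \<in> B \<Longrightarrow> y \<in> B \<Longrightarrow> z \<in> B \<Longrightarrow> D x z \<le> D x y + D y z"
    and lower: "\<And>x. x \<in> B \<Longrightarrow> m \<le> F x"
    and limit: "\<And>s. (\<And>n. s n \<in> B) \<Longrightarrow> (\<And>n. F (s n) + K * D x0 (s n) \<le> F x0) \<Longrightarrow>
      (\<And>i j. i \<le> j \<Longrightarrow> F (s j) \<le> F (s i)) \<Longrightarrow>
      (\<And>e. e > 0 \<Longrightarrow> \<exists>N. \<forall>i\<ge>N. \<forall>j\<ge>N. D (s i) (s j) < e) \<Longrightarrow>
      \<exists>l\<in>B. (\<lambda>n. D (s n) l) \<longlonglongrightarrow> 0 \<and> (\<forall>n. F l \<le> F (s n))"
  obtains x where "x \<in> B" "\<And>y. y \<in> B \<Longrightarrow> F x - K * D x y \<le> F y"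
proof -
  \<comment> \<open>The Ekeland preorder: \<open>y\<close> improves on \<open>x\<close> by at least
    \<open>K\<close> times their distance.\<close>
  define S where "S x = {y \<in> B. F y + K * D x y \<le> F x}" for x
  have S_trans: "z \<in> S x" if "y \<in> S x" "z \<in> S y" "x \<in> B" for x y z
  proof -
    have "K * D x z \<le> K * (D x y + D y z)" using triangle[of x y z] that K by (auto simp: S_def)
    then show ?thesis using that by (auto simp: S_def distrib_left)
  qed
  have S_refl: "x \<in> S x" if "x \<in> B" for x using that refl by (simp add: S_def)
  \<comment> \<open>Each term lies in the set of improvements of its predecessor and nearly
    minimises \<open>F\<close> there. The clause about \<open>n = 0\<close> only pins the start of
    the dependent choice to \<open>x0\<close>.\<close>
  have "\<exists>s. \<forall>n. (s n \<in> B \<and> (n = 0 \<longrightarrow> s n = x0)) \<and>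
      (s (Suc n) \<in> S (s n) \<and> (\<forall>y\<in>S (s n). F (s (Suc n)) \<le> F y + inverse (real (Suc n))))"
  proof (rule dependent_nat_choice)
    show "\<exists>x. x \<in> B \<and> (0 = 0 \<longrightarrow> x = x0)" using x0 by auto
    fix x and n :: nat assume x: "x \<in> B \<and> (n = 0 \<longrightarrow> x = x0)"
    have bdd: "bdd_below (F ` S x)" using lower by (auto simp: bdd_below_def S_def)
    have ne: "F ` S x \<noteq> {}" using S_refl x by auto
    obtain y where y: "y \<in> S x" "F y < Inf (F ` S x) + inverse (real (Suc n))"
      using cInf_lessD[OF ne, of "Inf (F ` S x) + inverse (real (Suc n))"] by auto
    have "F y \<le> F z + inverse (real (Suc n))" if "z \<in> S x" for z
      using y(2) cInf_lower[OF imageI[OF that] bdd] by linarith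
    with y(1) show "\<exists>y. (y \<in> B \<and> (Suc n = 0 \<longrightarrow> y = x0)) \<and>
        (y \<in> S x \<and> (\<forall>z\<in>S x. F y \<le> F z + inverse (real (Suc n))))"
      by (intro exI[of _ y]) (auto simp: S_def)
  qed
  then obtain s where s: "\<And>n. s n \<in> B" "s 0 = x0" "\<And>n. s (Suc n) \<in> S (s n)"
    "\<And>n y. y \<in> S (s n) \<Longrightarrow> F (s (Suc n)) \<le> F y + inverse (real (Suc n))" by blast
  have sS: "s j \<in> S (s i)" if "i \<le> j" for i j
    using that by (induction j rule: dec_induct) (use S_refl S_trans s in blast)+
  have dec: "F (s j) \<le> F (s i)" if "i \<le> j" for i j
  proof -
    have "0 \<le> K * D (s i) (s j)" using K nonneg s(1) by simp
    then show ?thesis using sS[OF that] by (simp add: S_def)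
  qed
  have Dle: "K * D (s i) (s j) \<le> F (s i) - F (s j)" if "i \<le> j" for i j
    using sS[OF that] by (simp add: S_def)
  have "Cauchy (\<lambda>n. F (s n))"
    by (intro convergent_Cauchy Bseq_monoseq_convergent decseq_imp_monoseq decseq_bounded[of _ m])
      (use dec lower s(1) in \<open>auto simp: decseq_def\<close>)
  then have "\<exists>N. \<forall>i\<ge>N. \<forall>j\<ge>N. D (s i) (s j) < e" if e: "e > 0" for e
  proof -
    obtain N where N: "\<And>i j. i \<ge> N \<Longrightarrow> j \<ge> N \<Longrightarrow> dist (F (s i)) (F (s j)) < K * e"
      using metric_CauchyD[OF \<open>Cauchy _\<close>, of "K * e"] K e by auto
    have "D (s i) (s j) < e" if "i \<ge> N" "j \<ge> N" for i j
    proof -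
      have "K * D (s i) (s j) < K * e"
        using Dle[of i j] Dle[of j i] N[OF that] sym[OF s(1) s(1), of i j]
        by (cases "i \<le> j") (auto simp: dist_real_def)
      then show ?thesis using K by simp
    qed
    then show ?thesis by blast
  qed
  from limit[OF s(1) _ dec this] obtain l where l: "l \<in> B" "(\<lambda>n. D (s n) l) \<longlonglongrightarrow> 0" "\<And>n. F l \<le> F (s n)"
    using sS[of 0] s(2) by (auto simp: S_def)
  \<comment> \<open>The triangle inequality through \<open>s j\<close>, then \<open>j\<close> to
    infinity.\<close>
  have lS: "l \<in> S (s n)" for n
  proof -
    have "K * D (s n) l \<le> F (s n) - F l + K * D (s j) l" if "j \<ge> n" for j
    proof -
      have "K * D (s n) l \<le> K * (D (s n) (s j) + D (s j) l)"
        using triangle[OF s(1) s(1) l(1), of n j] K by simp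
      then show ?thesis using Dle[OF that] l(3)[of j] by (simp add: distrib_left)
    qed
    moreover have "(\<lambda>j. F (s n) - F l + K * D (s j) l) \<longlonglongrightarrow> F (s n) - F l + K * 0"
      by (intro tendsto_intros l)
    ultimately have "K * D (s n) l \<le> F (s n) - F l + K * 0"
      by (intro LIMSEQ_le_const[of _ _ "K * D (s n) l"]) auto
    then show ?thesis using l(1) by (simp add: S_def)
  qed
  \<comment> \<open>A violating \<open>y\<close> would improve on \<open>l\<close>, hence on every
    \<open>s n\<close>; near minimality then forces \<open>F l \<le> F y\<close> in the
    limit.\<close>
  have "F l - K * D l y \<le> F y" if y: "y \<in> B" for y
  proof (rule ccontr)
    assume "\<not> F l - K * D l y \<le> F y"
    then have lt: "F y + K * D l y < F l" by simp
    then have "y \<in> S (s n)" for n using S_trans[OF lS _ s(1), of y n] y by (simp add: S_def)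
    then have "F l \<le> F y + inverse (real (Suc n))" for n
      using s(4)[of y n] l(3)[of "Suc n"] by force
    then have "F l \<le> F y + 0"
      by (intro LIMSEQ_le_const[OF tendsto_add[OF tendsto_const LIMSEQ_inverse_real_of_nat]]) auto
    then show False using lt nonneg[OF l(1) y] K by (smt (verit) mult_nonneg_nonneg)
  qed
  with l(1) show ?thesis by (rule that)
qed

text \<open>
  The Borwein-Preiss construction: the \<open>n\<close>-th point nearly minimises \<open>h\<close> plus small quadratics centred
  at the previous points, and the sum of all these quadratics is again quadratic.
\<close>

lemma borwein_preiss:
  fixes S :: "'a::{real_inner,complete_space} set" and h :: "'a \<Rightarrow> real"
  assumes v0: "v0 \<in> S" and SR: "\<And>x. x \<in> S \<Longrightarrow> norm x \<le> R"
    and lower: "\<And>x. x \<in> S \<Longrightarrow> b \<le> h x"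
    and closed: "\<And>s l c. (\<And>n. s n \<in> S) \<Longrightarrow> s \<longlonglongrightarrow> l \<Longrightarrow> (\<And>n. h (s n) \<le> c) \<Longrightarrow> l \<in> S \<and> h l \<le> c"
    and \<kappa>: "\<kappa> > 0"
  obtains w and \<zeta> :: "'a \<Rightarrow>\<^sub>L real" where "w \<in> S" "h w \<le> h v0" "norm \<zeta> \<le> 4 * \<kappa> * R"
    "\<And>x. x \<in> S \<Longrightarrow> h w + blinfun_apply \<zeta> (x - w) - \<kappa> * (norm (x - w))\<^sup>2 \<le> h x"
proof -
  \<comment> \<open>The weights add up to \<open>\<kappa>\<close>, so the sum of all quadratics has
    leading coefficient exactly \<open>\<kappa>\<close>.\<close>
  define \<mu> where "\<mu> i = \<kappa> * (1/2) ^ Suc i" for i :: nat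
  have \<mu>: "\<mu> i > 0" for i using \<kappa> by (simp add: \<mu>_def)
  have sum\<mu>: "\<mu> sums \<kappa>"
    using sums_mult[OF power_half_series, of \<kappa>] by (simp add: \<mu>_def[abs_def])
  \<comment> \<open>Near minimality bounds the squared step by
    \<open>\<epsilon> i / \<mu> i\<close>; this tolerance turns the steps into powers of
    1/2.\<close>
  define \<epsilon> where "\<epsilon> i = \<mu> i * (1/4) ^ i" for i
  have \<epsilon>: "\<epsilon> i > 0" for i using \<mu> by (simp add: \<epsilon>_def)
  define P where "P n p \<longleftrightarrow> snd p \<in> S \<and> (\<forall>x\<in>S. b \<le> fst p x) \<and> (n = 0 \<longrightarrow> p = (h, v0))"
    for n :: nat and p :: "('a \<Rightarrow> real) \<times> 'a"
  define Q where "Q n p q \<longleftrightarrow> fst q = (\<lambda>x. fst p x + \<mu> n * (norm (x - snd p))\<^sup>2) \<and>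
      fst q (snd q) \<le> fst p (snd p) \<and> (\<forall>x\<in>S. fst q (snd q) \<le> fst q x + \<epsilon> (Suc n))"
    for n and p q :: "('a \<Rightarrow> real) \<times> 'a"
  have "\<exists>\<sigma>. \<forall>n. P n (\<sigma> n) \<and> Q n (\<sigma> n) (\<sigma> (Suc n))"
  proof (rule dependent_nat_choice)
    show "\<exists>p. P 0 p" using v0 lower by (auto simp: P_def)
    fix p n assume p: "P n p"
    define H where "H x = fst p x + \<mu> n * (norm (x - snd p))\<^sup>2" for x
    have Hb: "b \<le> H x" if "x \<in> S" for x
    proof -
      have "0 \<le> \<mu> n * (norm (x - snd p))\<^sup>2" using \<mu>[of n] by simp
      then show ?thesis using p that by (auto simp: H_def P_def intro: add_increasing2)
    qed
    \<comment> \<open>The old point is kept if it is already nearly minimal. Otherwise some point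
      lies below it by more than the tolerance, and any near minimiser then beats it.\<close>
    have "\<exists>y\<in>S. H y \<le> H (snd p) \<and> (\<forall>x\<in>S. H y \<le> H x + \<epsilon> (Suc n))"
    proof (cases "\<forall>x\<in>S. H (snd p) \<le> H x + \<epsilon> (Suc n)")
      case True
      then show ?thesis using p by (auto simp: P_def)
    next
      case False
      have bdd: "bdd_below (H ` S)" using Hb by (auto simp: bdd_below_def)
      obtain y where y: "y \<in> S" "H y < Inf (H ` S) + \<epsilon> (Suc n)"
        using cInf_lessD[of "H ` S" "Inf (H ` S) + \<epsilon> (Suc n)"] v0 \<epsilon> by auto
      have near: "H y \<le> H x + \<epsilon> (Suc n)" if "x \<in> S" for x
        using y(2) cInf_lower[OF imageI[OF that] bdd] by linarith
      obtain x where "x \<in> S" "H x + \<epsilon> (Suc n) < H (snd p)" using False by force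
      then have "H y \<le> H (snd p)" using near[of x] by simp
      with y(1) near show ?thesis by blast
    qed
    then obtain y where "y \<in> S" "H y \<le> H (snd p)" "\<forall>x\<in>S. H y \<le> H x + \<epsilon> (Suc n)" by blast
    then show "\<exists>q. P (Suc n) q \<and> Q n p q"
      using Hb by (intro exI[of _ "(H, y)"]) (auto simp: P_def Q_def H_def[abs_def])
  qed
  then obtain \<sigma> where \<sigma>: "\<And>n. P n (\<sigma> n)" "\<And>n. Q n (\<sigma> n) (\<sigma> (Suc n))" by blast
  define H where "H n = fst (\<sigma> n)" for n
  define v where "v n = snd (\<sigma> n)" for n
  have vS: "v n \<in> S" for n using \<sigma>(1)[of n] by (simp add: P_def v_def)
  have H0: "H 0 = h" "v 0 = v0" using \<sigma>(1)[of 0] by (auto simp: P_def H_def v_def)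
  have HS: "H (Suc n) x = H n x + \<mu> n * (norm (x - v n))\<^sup>2" for n x
    using \<sigma>(2)[of n] by (simp add: Q_def H_def v_def)
  have Hv_dec: "H (Suc n) (v (Suc n)) \<le> H n (v n)" for n
    using \<sigma>(2)[of n] unfolding Q_def H_def v_def by blast
  have near: "H (Suc n) (v (Suc n)) \<le> H (Suc n) x + \<epsilon> (Suc n)" if "x \<in> S" for n x
    using \<sigma>(2)[of n] that unfolding Q_def H_def v_def by blast
  have H_sum: "H n x = h x + (\<Sum>i<n. \<mu> i * (norm (x - v i))\<^sup>2)" for n x
    by (induction n) (auto simp: H0 HS)
  have step: "norm (v (Suc (Suc n)) - v (Suc n)) \<le> (1/2) ^ Suc n" for n
  proof -
    have "\<mu> (Suc n) * (norm (v (Suc (Suc n)) - v (Suc n)))\<^sup>2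
        = H (Suc (Suc n)) (v (Suc (Suc n))) - H (Suc n) (v (Suc (Suc n)))" by (simp add: HS)
    also have "\<dots> \<le> \<epsilon> (Suc n)" using Hv_dec[of "Suc n"] near[OF vS, of n "Suc (Suc n)"] by linarith
    finally have "(norm (v (Suc (Suc n)) - v (Suc n)))\<^sup>2 \<le> (1/4) ^ Suc n"
      using \<mu>[of "Suc n"] by (simp add: \<epsilon>_def)
    also have "\<dots> = ((1/2) ^ Suc n)\<^sup>2" by (simp add: power2_eq_square power_mult_distrib[symmetric])
    finally show ?thesis by (rule power2_le_imp_le) simp
  qed
  have geo: "norm (v (Suc n + k) - v (Suc n)) \<le> 2 * (1/2) ^ Suc n - 2 * (1/2) ^ (Suc n + k)" for n k
  proof (induction k)
    case (Suc k)
    have "norm (v (Suc n + Suc k) - v (Suc n)) \<le> norm (v (Suc (Suc (n + k))) - v (Suc (n + k))) + norm (v (Suc n + k) - v (Suc n))"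
      using norm_triangle_ineq[of "v (Suc (Suc (n + k))) - v (Suc (n + k))" "v (Suc n + k) - v (Suc n)"] by simp
    then show ?case using step[of "n + k"] Suc by simp
  qed simp
  have "Cauchy v"
  proof (rule CauchyI')
    fix e :: real assume "e > 0"
    then obtain n where n: "(1/2 :: real) ^ n < e / 4"
      using real_arch_pow_inv[of "e/4" "1/2"] by auto
    have "norm (v i - v j) < e" if "i \<ge> Suc n" "j > i" for i j
    proof -
      obtain p where p: "i = Suc p" "p \<ge> n" using \<open>i \<ge> Suc n\<close> by (metis Suc_le_D Suc_le_mono)
      obtain k where k: "j = Suc p + k" using \<open>j > i\<close> p by (metis less_imp_le le_iff_add)
      have "norm (v i - v j) \<le> 2 * (1/2) ^ Suc p - 2 * (1/2) ^ (Suc p + k)"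
        using geo[of p k] by (simp add: p k norm_minus_commute)
      also have "\<dots> \<le> 2 * (1/2) ^ Suc p" by simp
      also have "\<dots> \<le> (1/2) ^ n" using power_decreasing[OF p(2), of "1/2 :: real"] by simp
      finally show ?thesis using n \<open>e > 0\<close> by simp
    qed
    then show "\<exists>M. \<forall>m\<ge>M. \<forall>n>m. dist (v m) (v n) < e" unfolding dist_norm by blast
  qed
  then obtain w where w: "v \<longlonglongrightarrow> w" using Cauchy_convergent convergent_def by blast
  have Hv_le: "H n (v n) \<le> h v0" for n
    by (induction n) (use H0 Hv_dec in \<open>auto intro: order_trans\<close>)
  have h_le: "h x \<le> H n x" for n x
    unfolding H_sum using \<mu> by (auto intro!: sum_nonneg simp: less_imp_le)
  have wS: "w \<in> S" "h w \<le> h v0"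
    using closed[OF vS w, of "h v0"] h_le Hv_le by (meson order_trans)+
  define \<Psi> where "\<Psi> x = (\<Sum>i. \<mu> i * (norm (x - v i))\<^sup>2)" for x
  have summ: "summable (\<lambda>i. \<mu> i * (norm (x - v i))\<^sup>2)" if "x \<in> S" for x
  proof (rule summable_comparison_test')
    show "summable (\<lambda>i. \<mu> i * (2 * R)\<^sup>2)" using sum\<mu> by (intro summable_mult2) (rule sums_summable)
    fix i
    have "norm (x - v i) \<le> 2 * R" using norm_triangle_ineq4[of x "v i"] SR[OF that] SR[OF vS[of i]] by simp
    from power_mono[OF this norm_ge_zero, of 2]
    show "norm (\<mu> i * (norm (x - v i))\<^sup>2) \<le> \<mu> i * (2 * R)\<^sup>2"
      using \<mu>[of i] by simp
  qed
  have min: "h w + \<Psi> w \<le> h x + \<Psi> x" if x: "x \<in> S" for x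
  proof -
    \<comment> \<open>Only the first \<open>j\<close> quadratics are kept, since a finite sum passes
      to the limit along \<open>v\<close>; dropping the others is harmless because they are
      nonnegative. Letting \<open>j\<close> grow restores \<open>\<Psi> w\<close>.\<close>
    have fin: "h w + (\<Sum>i<j. \<mu> i * (norm (w - v i))\<^sup>2) \<le> h x + \<Psi> x" for j
    proof (rule field_le_epsilon)
      fix e :: real assume e: "e > 0"
      have "(\<lambda>n. (\<Sum>i<j. \<mu> i * (norm (v n - v i))\<^sup>2)) \<longlonglongrightarrow> (\<Sum>i<j. \<mu> i * (norm (w - v i))\<^sup>2)"
        by (intro tendsto_intros w)
      then have "eventually (\<lambda>n. dist (\<Sum>i<j. \<mu> i * (norm (v n - v i))\<^sup>2) (\<Sum>i<j. \<mu> i * (norm (w - v i))\<^sup>2) < e/2) sequentially"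
        by (rule tendstoD) (use e in simp)
      moreover have "eventually (\<lambda>n. \<epsilon> n < e/2) sequentially"
      proof -
        have "\<epsilon> = (\<lambda>n. (\<kappa>/2) * (1/8) ^ n)"
          by (auto simp: \<epsilon>_def \<mu>_def power_mult_distrib[symmetric])
        moreover have "(\<lambda>n. (\<kappa>/2) * (1/8) ^ n) \<longlonglongrightarrow> (\<kappa>/2) * 0"
          by (intro tendsto_intros LIMSEQ_realpow_zero) auto
        ultimately have "\<epsilon> \<longlonglongrightarrow> 0" by simp
        then show ?thesis using e by (intro order_tendstoD(2)) auto
      qed
      moreover have "eventually (\<lambda>n. n \<ge> Suc j) sequentially" by (rule eventually_ge_at_top)
      ultimately have "eventually (\<lambda>n. h (v n) \<le> h x + \<Psi> x + e - (\<Sum>i<j. \<mu> i * (norm (w - v i))\<^sup>2)) sequentially"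
      proof eventually_elim
        case (elim n)
        have "H n (v n) \<le> H n x + \<epsilon> n" using near[OF x, of "n - 1"] elim by (cases n) auto
        moreover have "H n x \<le> h x + \<Psi> x"
          unfolding H_sum \<Psi>_def using \<mu> by (intro add_left_mono sum_le_suminf summ x) (auto simp: less_imp_le)
        moreover have "h (v n) + (\<Sum>i<j. \<mu> i * (norm (v n - v i))\<^sup>2) \<le> H n (v n)"
          unfolding H_sum using elim \<mu> by (intro add_left_mono sum_mono2) (auto simp: less_imp_le)
        ultimately show ?case using elim unfolding dist_real_def by linarith
      qed
      then obtain N where N: "\<And>n. n \<ge> N \<Longrightarrow> h (v n) \<le> h x + \<Psi> x + e - (\<Sum>i<j. \<mu> i * (norm (w - v i))\<^sup>2)"
        by (auto simp: eventually_sequentially)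
      have "h w \<le> h x + \<Psi> x + e - (\<Sum>i<j. \<mu> i * (norm (w - v i))\<^sup>2)"
        using closed[of "\<lambda>n. v (n + N)" w] vS LIMSEQ_ignore_initial_segment[OF w, of N] N by auto
      then show "h w + (\<Sum>i<j. \<mu> i * (norm (w - v i))\<^sup>2) \<le> h x + \<Psi> x + e" by simp
    qed
    have "(\<lambda>j. h w + (\<Sum>i<j. \<mu> i * (norm (w - v i))\<^sup>2)) \<longlonglongrightarrow> h w + \<Psi> w"
      unfolding \<Psi>_def by (intro tendsto_intros summable_LIMSEQ summ wS)
    then show ?thesis by (rule LIMSEQ_le_const2) (use fin in auto)
  qed
  \<comment> \<open>Minus the derivative of \<open>\<Psi>\<close> at \<open>w\<close>. It comes from
    \<open>norm (x - v i)\<close> squared minus \<open>norm (w - v i)\<close> squared being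
    \<open>norm (x - w)\<close> squared plus twice the inner product of \<open>w - v i\<close> and
    \<open>x - w\<close>. The series is summed in the dual, which has sort
    \<open>banach\<close>.\<close>
  define \<zeta> where "\<zeta> = (\<Sum>i. (- 2 * \<mu> i) *\<^sub>R blinfun_inner_right (w - v i))"
  have bnd: "norm ((- 2 * \<mu> i) *\<^sub>R blinfun_inner_right (w - v i)) \<le> \<mu> i * (4 * R)" for i
  proof -
    have "norm (blinfun_inner_right (w - v i)) \<le> norm (w - v i)"
      by (rule norm_blinfun_bound) (auto simp: Cauchy_Schwarz_ineq2)
    also have "\<dots> \<le> 2 * R" using norm_triangle_ineq4[of w "v i"] SR[OF wS(1)] SR[OF vS[of i]] by simp
    finally show ?thesis using \<mu>[of i] by simp
  qed
  have s4: "(\<lambda>i. \<mu> i * (4 * R)) sums (\<kappa> * (4 * R))" using sums_mult2[OF sum\<mu>] .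
  have s\<zeta>: "summable (\<lambda>i. (- 2 * \<mu> i) *\<^sub>R blinfun_inner_right (w - v i))"
    by (rule summable_comparison_test'[OF sums_summable[OF s4] bnd])
  have "norm \<zeta> \<le> (\<Sum>i. \<mu> i * (4 * R))"
    unfolding \<zeta>_def by (rule norm_suminf_le[OF bnd sums_summable[OF s4]])
  then have n\<zeta>: "norm \<zeta> \<le> 4 * \<kappa> * R" using sums_unique[OF s4] by simp
  show ?thesis
  proof (rule that[OF wS n\<zeta>])
    fix x assume x: "x \<in> S"
    have "(\<lambda>i. \<mu> i * (norm (x - v i))\<^sup>2 - \<mu> i * (norm (w - v i))\<^sup>2) sums (\<Psi> x - \<Psi> w)"
      unfolding \<Psi>_def by (intro sums_diff summable_sums summ x wS)
    moreover have "(\<lambda>i. \<mu> i * (norm (x - w))\<^sup>2 - blinfun_apply ((- 2 * \<mu> i) *\<^sub>R blinfun_inner_right (w - v i)) (x - w))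
        sums (\<kappa> * (norm (x - w))\<^sup>2 - blinfun_apply \<zeta> (x - w))"
      unfolding \<zeta>_def
      by (intro sums_diff sums_mult2[OF sum\<mu>] bounded_linear.sums[OF blinfun.bounded_linear_left] summable_sums s\<zeta>)
    moreover have "\<mu> i * (norm (x - v i))\<^sup>2 - \<mu> i * (norm (w - v i))\<^sup>2
       = \<mu> i * (norm (x - w))\<^sup>2 - blinfun_apply ((- 2 * \<mu> i) *\<^sub>R blinfun_inner_right (w - v i)) (x - w)" for i
      by (simp add: blinfun.scaleR_left blinfun.minus_left power2_norm_eq_inner inner_diff_left inner_diff_right inner_commute algebra_simps)
    ultimately have "\<Psi> x - \<Psi> w = \<kappa> * (norm (x - w))\<^sup>2 - blinfun_apply \<zeta> (x - w)"
      using sums_unique2 by (metis (no_types, lifting) sums_cong)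
    then show "h w + blinfun_apply \<zeta> (x - w) - \<kappa> * (norm (x - w))\<^sup>2 \<le> h x" using min[OF x] by simp
  qed
qed

text \<open>
  The cone \<open>K * sqrt (B x x)\<close> is rounded to \<open>K1 * sqrt (B x x + s\<^sup>2)\<close>, whose slope is still below \<open>K'\<close> and
  which has quadratic upper bounds because the square root is concave.
\<close>

lemma proximal_touching:
  fixes S :: "'a::{real_inner,complete_space} set" and h :: "'a \<Rightarrow> real"
  assumes bil: "bounded_bilinear B" and sym: "\<And>x y. B x y = B y x"
    and m: "m > 0" and coercive: "\<And>x. m * (norm x)\<^sup>2 \<le> B x x"
    and r: "r > 0" and Sr: "\<And>x. x \<in> S \<Longrightarrow> norm x \<le> r" and zero: "0 \<in> S"
    and closed: "\<And>s l c. (\<And>n. s n \<in> S) \<Longrightarrow> s \<longlonglongrightarrow> l \<Longrightarrow> (\<And>n. h (s n) \<le> c) \<Longrightarrow> l \<in> S \<and> h l \<le> c"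
    and cone: "\<And>x. x \<in> S \<Longrightarrow> h 0 - K * sqrt (B x x) \<le> h x"
    and K: "0 \<le> K" "K < K'"
  obtains v l \<sigma> where "v \<in> S" "norm v < r" "\<sigma> \<ge> 0" "bounded_linear l" "\<And>w. \<bar>l w\<bar> \<le> K' * sqrt (B w w)"
    "\<And>x. x \<in> S \<Longrightarrow> h v + l (x - v) - \<sigma> * (norm (x - v))\<^sup>2 \<le> h x"
proof -
  interpret B: bounded_bilinear B by fact
  have nn: "0 \<le> B x x" for x using coercive[of x] m by (smt (verit) mult_nonneg_nonneg zero_le_power2)
  have sq: "sqrt m * norm x \<le> sqrt (B x x)" for x
    using real_sqrt_le_mono[OF coercive[of x]] by (simp add: real_sqrt_mult)
  \<comment> \<open>Half of the gap pays for the rounded cone, the other half for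
    \<open>\<zeta>\<close>.\<close>
  define K1 where "K1 = (K + K') / 2"
  have K1: "K < K1" "K1 < K'" "K1 > 0" using K by (auto simp: K1_def)
  have sm: "sqrt m > 0" using m by simp
  \<comment> \<open>Rounding raises the value at the centre by \<open>K1 * s\<close>. This is half
    of what the steeper cone gains on the sphere of radius \<open>r\<close>, so the perturbed
    minimiser cannot lie on that sphere.\<close>
  define s where "s = (K1 - K) * (sqrt m * r) / (2 * K1)"
  have s: "s > 0" "K1 * s < (K1 - K) * (sqrt m * r)" using K1 sm r by (auto simp: s_def)
  \<comment> \<open>Makes the norm bound for \<open>\<zeta>\<close> equal to
    \<open>(K' - K1) * sqrt m\<close>, and \<open>sqrt m * norm w\<close> is at most the norm of
    \<open>w\<close> for \<open>B\<close>.\<close>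
  define \<kappa> where "\<kappa> = (K' - K1) * sqrt m / (4 * r)"
  have \<kappa>: "\<kappa> > 0" "4 * \<kappa> * r = (K' - K1) * sqrt m" using K1 sm r by (auto simp: \<kappa>_def)
  define \<phi> where "\<phi> x = K1 * sqrt (B x x + s\<^sup>2)" for x
  have \<phi>_ge: "K1 * sqrt (B x x) \<le> \<phi> x" for x unfolding \<phi>_def using K1 by simp
  have \<phi>0: "\<phi> 0 = K1 * s" using s by (simp add: \<phi>_def B.zero_left)
  have below: "h 0 + (K1 - K) * sqrt (B x x) \<le> h x + \<phi> x" if "x \<in> S" for x
    using cone[OF that] \<phi>_ge[of x] by (simp add: left_diff_distrib)
  \<comment> \<open>\<open>h\<close> has closed sublevel sets and \<open>\<phi>\<close> is
    continuous: on a tail of the sequence \<open>\<phi>\<close> may be replaced by its limit up to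
    \<open>e\<close>.\<close>
  have cl: "l \<in> S \<and> h l + \<phi> l \<le> c"
    if p: "\<And>n. p n \<in> S" "p \<longlonglongrightarrow> l" "\<And>n. h (p n) + \<phi> (p n) \<le> c" for p l c
  proof -
    have lim: "(\<lambda>n. \<phi> (p n)) \<longlonglongrightarrow> \<phi> l" unfolding \<phi>_def by (intro tendsto_intros B.tendsto p)
    have "l \<in> S \<and> h l \<le> c - \<phi> l + e" if "e > 0" for e
    proof -
      obtain N where N: "\<And>n. n \<ge> N \<Longrightarrow> dist (\<phi> (p n)) (\<phi> l) < e"
        using lim \<open>e > 0\<close> unfolding lim_sequentially by blast
      have "h (p (n + N)) \<le> c - \<phi> l + e" for n
        using N[of "n + N"] p(3)[of "n + N"] by (auto simp: dist_real_def)
      then show ?thesis using closed[of "\<lambda>n. p (n + N)" l] p(1) LIMSEQ_ignore_initial_segment[OF p(2)] by auto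
    qed
    note close = this
    have "h l \<le> c - \<phi> l" by (rule field_le_epsilon) (use close in blast)
    then show ?thesis using close[OF zero_less_one] by simp
  qed
  obtain v and \<zeta> :: "'a \<Rightarrow>\<^sub>L real" where v: "v \<in> S" "h v + \<phi> v \<le> h 0 + \<phi> 0" "norm \<zeta> \<le> 4 * \<kappa> * r"
    "\<And>x. x \<in> S \<Longrightarrow> h v + \<phi> v + blinfun_apply \<zeta> (x - v) - \<kappa> * (norm (x - v))\<^sup>2 \<le> h x + \<phi> x"
  proof (rule borwein_preiss[OF zero Sr _ cl \<kappa>(1)])
    show "h 0 \<le> h x + \<phi> x" if "x \<in> S" for x
      using below[OF that] K1 nn[of x] by (smt (verit) mult_nonneg_nonneg real_sqrt_ge_zero)
  qed auto
  have vr: "norm v < r"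
  proof (rule ccontr)
    assume "\<not> norm v < r"
    then have "norm v = r" using Sr[OF v(1)] by simp
    then have "(K1 - K) * (sqrt m * r) \<le> (K1 - K) * sqrt (B v v)" using sq[of v] K1 by simp
    then show False using below[OF v(1)] v(2) s \<phi>0 by linarith
  qed
  define q where "q = sqrt (B v v + s\<^sup>2)"
  have q: "q > 0" "q\<^sup>2 = B v v + s\<^sup>2" "sqrt (B v v) \<le> q"
    unfolding q_def using s nn[of v] by (auto intro: add_nonneg_pos)
  obtain Cb where Cb: "\<And>x y. norm (B x y) \<le> norm x * norm y * Cb" "Cb \<ge> 0" using B.nonneg_bounded by blast
  \<comment> \<open>The Borwein-Preiss functional minus the derivative of the rounded cone at
    \<open>v\<close>.\<close>
  define l where "l w = blinfun_apply \<zeta> w - K1 * (B v w / q)" for w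
  have upper: "\<phi> x \<le> \<phi> v + K1 * (B v (x - v) / q) + K1 * Cb / (2 * q) * (norm (x - v))\<^sup>2" for x
  proof -
    define a where "a = sqrt (B x x + s\<^sup>2)"
    have a2: "a\<^sup>2 = B x x + s\<^sup>2" unfolding a_def using nn[of x] by simp
    have "0 \<le> (a - q)\<^sup>2" by simp
    then have "2 * a * q \<le> a\<^sup>2 + q\<^sup>2" by (simp add: power2_diff)
    also have "\<dots> = 2 * q\<^sup>2 + 2 * B v (x - v) + B (x - v) (x - v)"
      unfolding a2 q(2) using sym[of x v] by (simp add: B.diff_left B.diff_right)
    also have "B (x - v) (x - v) \<le> Cb * (norm (x - v))\<^sup>2"
      using Cb(1)[of "x - v" "x - v"] by (simp add: power2_eq_square mult_ac)
    finally have "a \<le> (2 * q\<^sup>2 + 2 * B v (x - v) + Cb * (norm (x - v))\<^sup>2) / (2 * q)"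
      using q by (simp add: pos_le_divide_eq mult_ac)
    also have "\<dots> = q + B v (x - v) / q + Cb / (2 * q) * (norm (x - v))\<^sup>2"
      using q by (simp add: field_simps power2_eq_square)
    finally have "K1 * a \<le> K1 * (q + B v (x - v) / q + Cb / (2 * q) * (norm (x - v))\<^sup>2)"
      using K1 by (intro mult_left_mono) auto
    then show ?thesis unfolding \<phi>_def a_def[symmetric] q_def[symmetric] by (simp add: algebra_simps)
  qed
  show ?thesis
  proof (rule that[of v "\<kappa> + K1 * Cb / (2 * q)" l])
    show "0 \<le> \<kappa> + K1 * Cb / (2 * q)" using \<kappa> K1 Cb q by simp
    show "bounded_linear l"
      unfolding l_def
      by (intro bounded_linear_sub blinfun.bounded_linear_right bounded_linear_const_mult
          bounded_linear_compose[OF bounded_linear_divide] B.bounded_linear_right)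
    fix w
    have "\<bar>B v w\<bar> \<le> q * sqrt (B w w)"
      using semidefinite_form_Cauchy_Schwarz[OF bil sym nn, of v w] q(3) nn[of w]
      by (meson mult_right_mono order_trans real_sqrt_ge_zero)
    then have "\<bar>K1 * (B v w / q)\<bar> \<le> K1 * sqrt (B w w)"
      using q K1 by (simp add: abs_mult pos_divide_le_eq mult_ac)
    moreover have "\<bar>blinfun_apply \<zeta> w\<bar> \<le> (K' - K1) * sqrt (B w w)"
    proof -
      have "\<bar>blinfun_apply \<zeta> w\<bar> \<le> norm \<zeta> * norm w" using norm_blinfun[of \<zeta> w] by simp
      also have "\<dots> \<le> (K' - K1) * sqrt m * norm w" using v(3) \<kappa>(2) by (intro mult_right_mono) auto
      also have "\<dots> \<le> (K' - K1) * sqrt (B w w)" using mult_left_mono[OF sq[of w], of "K' - K1"] K1 by simp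
      finally show ?thesis .
    qed
    ultimately show "\<bar>l w\<bar> \<le> K' * sqrt (B w w)" unfolding l_def left_diff_distrib
      using abs_triangle_ineq4[of "blinfun_apply \<zeta> w" "K1 * (B v w / q)"] by linarith
  next
    fix x assume "x \<in> S"
    from v(4)[OF this] upper[of x]
    show "h v + l (x - v) - (\<kappa> + K1 * Cb / (2 * q)) * (norm (x - v))\<^sup>2 \<le> h x"
      unfolding l_def by (simp add: algebra_simps)
  qed (use v vr in auto)
qed

section \<open>Charts, tangent vectors and the metric\<close>

text \<open>Given by a condition on points, so that membership unfolds directly;
  \<open>overlap_image\<close> identifies it with the set on which transitions are assumed
  smooth.\<close>

definition overlap :: "('m, 'e) chart \<Rightarrow> ('m, 'e) chart \<Rightarrow> 'e set" where
  "overlap c d = {x \<in> chart_img c. chart_inv c x \<in> chart_dom d}"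

text \<open>For a chart \<open>c\<close> around \<open>p\<close>, the inverse of evaluating a
  tangent vector in \<open>c\<close> (see \<open>tangent_lift_chart\<close> and
  \<open>tangent_lift_eq\<close>). The value 0 in the other charts is forced by
  \<open>tangent_space\<close>.\<close>

definition tangent_lift ::
    "('m, 'e::real_normed_vector) chart set \<Rightarrow> 'm \<Rightarrow> ('m, 'e) chart \<Rightarrow> 'e \<Rightarrow> ('m, 'e) chart \<Rightarrow> 'e" where
  "tangent_lift A p c e = (\<lambda>d. if d \<in> charts_at A p
     then frechet_derivative (transition c d) (at (chart_map c p)) e else 0)"

section \<open>Charts, transition maps and tangent vectors\<close>

context hilbert_manifold
begin

lemma chart_dom_subset: "c \<in> A \<Longrightarrow> chart_dom c \<subseteq> topspace X"
  using open_dom openin_subset by blast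

lemma inj_chart: "c \<in> A \<Longrightarrow> inj_on (chart_map c) (chart_dom c)"
  using homeomorphic_imp_injective_map[OF homeomorphic[of c]] chart_dom_subset[of c]
  by (simp add: inf.absorb2)

lemma chart_inv_map [simp]: "c \<in> A \<Longrightarrow> p \<in> chart_dom c \<Longrightarrow> chart_inv c (chart_map c p) = p"
  unfolding chart_inv_def by (rule inv_into_f_f[OF inj_chart])

lemma chart_map_inv [simp]: "x \<in> chart_img c \<Longrightarrow> chart_map c (chart_inv c x) = x"
  unfolding chart_inv_def chart_img_def by (rule f_inv_into_f)

lemma chart_inv_dom: "x \<in> chart_img c \<Longrightarrow> chart_inv c x \<in> chart_dom c"
  unfolding chart_inv_def chart_img_def by (rule inv_into_into)

lemma chart_map_img: "p \<in> chart_dom c \<Longrightarrow> chart_map c p \<in> chart_img c"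
  unfolding chart_img_def by (rule imageI)

lemma charts_at_iff: "c \<in> charts_at A p \<longleftrightarrow> c \<in> A \<and> p \<in> chart_dom c"
  by (simp add: charts_at_def)

lemma charts_at_inv: "c \<in> A \<Longrightarrow> x \<in> chart_img c \<Longrightarrow> c \<in> charts_at A (chart_inv c x)"
  by (simp add: charts_at_iff chart_inv_dom)

lemma charts_at_nonempty: "p \<in> topspace X \<Longrightarrow> \<exists>c. c \<in> charts_at A p"
  using covers unfolding charts_at_def by blast

lemma charts_at_topspace: "c \<in> charts_at A p \<Longrightarrow> p \<in> topspace X"
  unfolding charts_at_iff using chart_dom_subset by blast

lemma openin_chart_preimage:
  assumes c: "c \<in> A" and U: "open U"
  shows "openin X {p \<in> chart_dom c. chart_map c p \<in> U}"
proof -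
  have "continuous_map (subtopology X (chart_dom c)) (top_of_set (chart_img c)) (chart_map c)"
    by (rule homeomorphic_imp_continuous_map[OF homeomorphic[OF c]])
  then have "continuous_map (subtopology X (chart_dom c)) euclidean (chart_map c)"
    using continuous_map_into_fulltopology by blast
  then have "openin (subtopology X (chart_dom c)) {p \<in> topspace (subtopology X (chart_dom c)). chart_map c p \<in> U}"
    using U by (auto simp: continuous_map_def)
  moreover have "topspace (subtopology X (chart_dom c)) = chart_dom c"
    using chart_dom_subset[OF c] by auto
  ultimately have "openin (subtopology X (chart_dom c)) {p \<in> chart_dom c. chart_map c p \<in> U}" by metis
  then show ?thesis by (rule openin_trans_full[OF _ open_dom[OF c]])
qed

lemma open_chart_image:
  assumes c: "c \<in> A" and V: "openin X V"
  shows "open {x \<in> chart_img c. chart_inv c x \<in> V}"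
proof -
  have "openin (subtopology X (chart_dom c)) (chart_dom c \<inter> V)"
    using V by (simp add: openin_subtopology_Int2)
  then have "openin (top_of_set (chart_img c)) (chart_map c ` (chart_dom c \<inter> V))"
    using homeomorphic_imp_open_map[OF homeomorphic[OF c]] by (auto simp: open_map_def)
  moreover have "chart_map c ` (chart_dom c \<inter> V) = {x \<in> chart_img c. chart_inv c x \<in> V}"
  proof (intro equalityI subsetI)
    fix x assume "x \<in> {x \<in> chart_img c. chart_inv c x \<in> V}"
    then show "x \<in> chart_map c ` (chart_dom c \<inter> V)"
      by (intro image_eqI[of _ _ "chart_inv c x"]) (auto simp: chart_inv_dom)
  qed (use c in \<open>auto simp: chart_map_img\<close>)
  ultimately show ?thesis using openin_open_eq[OF open_img[OF c]] by simp
qed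

lemma overlap_image: "c \<in> A \<Longrightarrow> overlap c d = chart_map c ` (chart_dom c \<inter> chart_dom d)"
proof (intro equalityI subsetI)
  fix x assume "x \<in> overlap c d"
  then show "x \<in> chart_map c ` (chart_dom c \<inter> chart_dom d)"
    by (intro image_eqI[of _ _ "chart_inv c x"]) (auto simp: chart_inv_dom overlap_def)
qed (auto simp: overlap_def chart_map_img)

lemma open_overlap: "c \<in> A \<Longrightarrow> d \<in> A \<Longrightarrow> open (overlap c d)"
  unfolding overlap_def by (intro open_chart_image open_dom)

lemma overlap_self: "c \<in> A \<Longrightarrow> overlap c c = chart_img c"
  by (auto simp: overlap_def chart_inv_dom)

lemma overlap_chart_map: "c \<in> charts_at A p \<Longrightarrow> d \<in> charts_at A p \<Longrightarrow> chart_map c p \<in> overlap c d"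
  by (auto simp: overlap_def charts_at_iff chart_map_img)

lemma transition_inv: "x \<in> overlap c d \<Longrightarrow> d \<in> A \<Longrightarrow> chart_inv d (transition c d x) = chart_inv c x"
  by (simp add: transition_def overlap_def)

lemma transition_img: "x \<in> overlap c d \<Longrightarrow> transition c d x \<in> chart_img d"
  by (simp add: transition_def overlap_def chart_map_img)

text \<open>Second derivatives of transitions are the inhomogeneous term in the transformation of
  Christoffel maps, and their symmetry is what makes that law come out.\<close>

lemma transition_C2:
  assumes "c \<in> A" "d \<in> A"
  obtains T T2 where
    "\<And>x. x \<in> overlap c d \<Longrightarrow> (transition c d has_derivative blinfun_apply (T x)) (at x)"
    "\<And>x. x \<in> overlap c d \<Longrightarrow> (T has_derivative blinfun_apply (T2 x)) (at x)"
    "\<And>x. x \<in> overlap c d \<Longrightarrow> frechet_derivative (transition c d) (at x) = blinfun_apply (T x)"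
    "\<And>x u v. x \<in> overlap c d \<Longrightarrow> blinfun_apply (blinfun_apply (T2 x) u) v = blinfun_apply (blinfun_apply (T2 x) v) u"
proof -
  have sm: "smooth_on (overlap c d) (transition c d)" using smooth_transition[OF assms] assms by (simp add: overlap_image)
  have op: "open (overlap c d)" by (rule open_overlap[OF assms])
  obtain T where T: "\<And>x. x \<in> overlap c d \<Longrightarrow> (transition c d has_derivative blinfun_apply (T x)) (at x)"
    "smooth_on (overlap c d) T" using smooth_on_derivative[OF sm op] by blast
  obtain T2 where T2: "\<And>x. x \<in> overlap c d \<Longrightarrow> (T has_derivative blinfun_apply (T2 x)) (at x)"
    using smooth_on_derivative[OF T(2) op] by blast
  show ?thesis
    using second_derivative_symmetric[OF op _ T(1) T2]
    by (intro that[of T T2] T T2 frechet_derivative_at[OF T(1), symmetric]) auto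
qed

lemma transition_derivative:
  assumes "c \<in> A" "d \<in> A" "x \<in> overlap c d"
  shows "(transition c d has_derivative frechet_derivative (transition c d) (at x)) (at x)"
  using transition_C2[OF assms(1,2)] assms(3) by metis

lemma transition_derivative_linear:
  assumes "c \<in> A" "d \<in> A" "x \<in> overlap c d"
  shows "bounded_linear (frechet_derivative (transition c d) (at x))"
  by (rule has_derivative_bounded_linear[OF transition_derivative[OF assms]])

text \<open>Chain rule: on the common overlap the transition from \<open>c\<close> to
  \<open>e\<close> factors through \<open>d\<close>. This is what makes lifted vectors compatible in
  all pairs of charts.\<close>

lemma transition_cocycle:
  assumes A: "c \<in> A" "d \<in> A" "e \<in> A" and x: "x \<in> overlap c d" "x \<in> overlap c e"
  shows "frechet_derivative (transition d e) (at (transition c d x)) (frechet_derivative (transition c d) (at x) v)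
    = frechet_derivative (transition c e) (at x) v"
proof -
  have y: "transition c d x \<in> overlap d e"
    using x A by (auto simp: overlap_def transition_def chart_map_img)
  have "((\<lambda>y. transition d e (transition c d y)) has_derivative
      (\<lambda>v. frechet_derivative (transition d e) (at (transition c d x)) (frechet_derivative (transition c d) (at x) v))) (at x)"
    by (rule has_derivative_compose[OF transition_derivative[OF A(1,2) x(1)] transition_derivative[OF A(2,3) y]])
  then have "(transition c e has_derivative
      (\<lambda>v. frechet_derivative (transition d e) (at (transition c d x)) (frechet_derivative (transition c d) (at x) v))) (at x)"
  proof (rule has_derivative_transform_within_open[OF _ open_Int[OF open_overlap[OF A(1,2)] open_overlap[OF A(1,3)]]])
    show "x \<in> overlap c d \<inter> overlap c e" using x by simp
    show "transition d e (transition c d y) = transition c e y" if "y \<in> overlap c d \<inter> overlap c e" for y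
      using that A transition_inv[of y c d] by (simp add: transition_def)
  qed
  from has_derivative_unique[OF this transition_derivative[OF A(1,3) x(2)]] show ?thesis by metis
qed

lemma transition_self:
  assumes c: "c \<in> A" and x: "x \<in> chart_img c"
  shows "frechet_derivative (transition c c) (at x) v = v"
proof -
  have "((\<lambda>y. y) has_derivative (\<lambda>v. v)) (at x)" by (rule has_derivative_ident)
  then have "(transition c c has_derivative (\<lambda>v. v)) (at x)"
    by (rule has_derivative_transform_within_open[OF _ open_img[OF c] x])
      (simp add: transition_def)
  from frechet_derivative_at[OF this] show ?thesis by metis
qed

lemma transition_right_inverse:
  assumes "c \<in> A" "d \<in> A" "x \<in> overlap c d"
  shows "frechet_derivative (transition c d) (at x) (frechet_derivative (transition d c) (at (transition c d x)) v) = v"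
proof -
  have xc: "x \<in> chart_img c" using assms(3) by (simp add: overlap_def)
  have yd: "transition c d x \<in> chart_img d" by (rule transition_img[OF assms(3)])
  have y: "transition c d x \<in> overlap d c"
    unfolding overlap_def using yd transition_inv[OF assms(3,2)] chart_inv_dom[OF xc] by simp
  have yy: "transition d c (transition c d x) = x"
    unfolding transition_def[of d c] using transition_inv[OF assms(3,2)] xc by simp
  have "transition c d x \<in> overlap d d" using yd by (simp add: overlap_self assms(2))
  from transition_cocycle[OF assms(2,1,2) y this, of v] show ?thesis
    unfolding yy transition_self[OF assms(2) yd] .
qed

lemma tangent_lift_chart: "c \<in> charts_at A p \<Longrightarrow> tangent_lift A p c e c = e"
  by (simp add: tangent_lift_def transition_self charts_at_iff chart_map_img)

lemma tangent_lift_in: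
  assumes c: "c \<in> charts_at A p"
  shows "tangent_lift A p c e \<in> tangent_space A p"
  unfolding tangent_space_def
proof (intro CollectI conjI allI impI ballI)
  fix d d' assume d: "d \<in> charts_at A p" "d' \<in> charts_at A p"
  have "transition c d (chart_map c p) = chart_map d p"
    using c by (simp add: transition_def charts_at_iff)
  then show "tangent_lift A p c e d' = frechet_derivative (transition d d') (at (chart_map d p)) (tangent_lift A p c e d)"
    using transition_cocycle[of c d d' "chart_map c p" e] c d overlap_chart_map
    by (simp add: tangent_lift_def charts_at_iff)
qed (simp add: tangent_lift_def)

lemma tangent_transition:
  "c \<in> charts_at A p \<Longrightarrow> d \<in> charts_at A p \<Longrightarrow> \<xi> \<in> tangent_space A p \<Longrightarrow>
    \<xi> d = frechet_derivative (transition c d) (at (chart_map c p)) (\<xi> c)"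
  unfolding tangent_space_def by blast

lemma tangent_outside: "\<xi> \<in> tangent_space A p \<Longrightarrow> c \<notin> charts_at A p \<Longrightarrow> \<xi> c = 0"
  unfolding tangent_space_def by blast

lemma tangent_lift_eq:
  assumes "c \<in> charts_at A p" "\<xi> \<in> tangent_space A p"
  shows "tangent_lift A p c (\<xi> c) = \<xi>"
proof
  fix d show "tangent_lift A p c (\<xi> c) d = \<xi> d"
    using tangent_transition[OF assms(1) _ assms(2), of d] tangent_outside[OF assms(2), of d]
    by (simp only: tangent_lift_def split: if_split) simp
qed

lemma tangent_space_scaleR:
  assumes "\<xi> \<in> tangent_space A p"
  shows "(\<lambda>c. r *\<^sub>R \<xi> c) \<in> tangent_space A p"
  unfolding tangent_space_def
proof (intro CollectI conjI allI impI ballI)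
  fix c d assume cd: "c \<in> charts_at A p" "d \<in> charts_at A p"
  have "linear (frechet_derivative (transition c d) (at (chart_map c p)))"
    using cd by (intro bounded_linear.linear transition_derivative_linear overlap_chart_map) (auto simp: charts_at_iff)
  then show "r *\<^sub>R \<xi> d = frechet_derivative (transition c d) (at (chart_map c p)) (r *\<^sub>R \<xi> c)"
    using tangent_transition[OF cd assms] linear_scale by metis
qed (simp add: tangent_outside[OF assms])

lemma zero_tangent: "p \<in> topspace X \<Longrightarrow> 0 \<in> tangent_space A p"
  using charts_at_nonempty[of p] tangent_space_scaleR[OF tangent_lift_in, of _ p 0]
  by (auto simp: zero_fun_def)

text \<open>Chain rule in every other chart. Curves are built in a single chart, and this turns
  their coordinate derivative into an intrinsic velocity.\<close>

lemma has_velocity_lift: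
  assumes c: "c \<in> A" and J: "t \<in> J" "\<And>s. s \<in> J \<Longrightarrow> x s \<in> chart_img c"
    and x: "(x has_vector_derivative e) (at t within J)"
  shows "has_velocity A (\<lambda>s. chart_inv c (x s)) J t (tangent_lift A (chart_inv c (x t)) c e)"
proof -
  have ct: "c \<in> charts_at A (chart_inv c (x t))" by (rule charts_at_inv[OF c J(2)[OF J(1)]])
  show ?thesis
    unfolding has_velocity_def
  proof (intro conjI ballI)
    show "tangent_lift A (chart_inv c (x t)) c e \<in> tangent_space A (chart_inv c (x t))"
      by (rule tangent_lift_in[OF ct])
    fix d assume d: "d \<in> charts_at A (chart_inv c (x t))"
    have xt: "x t \<in> overlap c d" using d J by (auto simp: overlap_def charts_at_iff)
    have "((\<lambda>s. transition c d (x s)) has_derivative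
        (\<lambda>h. frechet_derivative (transition c d) (at (x t)) (h *\<^sub>R e))) (at t within J)"
      by (rule has_derivative_compose[OF x[unfolded has_vector_derivative_def] transition_derivative])
        (use c d xt in \<open>auto simp: charts_at_iff\<close>)
    moreover have "linear (frechet_derivative (transition c d) (at (x t)))"
      using c d xt by (intro bounded_linear.linear transition_derivative_linear) (auto simp: charts_at_iff)
    ultimately show "((chart_map d \<circ> (\<lambda>s. chart_inv c (x s))) has_vector_derivative
        tangent_lift A (chart_inv c (x t)) c e d) (at t within J)"
      using d J by (simp add: has_vector_derivative_def tangent_lift_def transition_def o_def linear_scale)
  qed
qed

end

section \<open>The metric in coordinates\<close>

context riemannian_manifold
begin

abbreviation metric_in :: "('m, 'e) chart \<Rightarrow> 'e \<Rightarrow> 'e \<Rightarrow>\<^sub>L 'e \<Rightarrow>\<^sub>L real" where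
  "metric_in c x \<equiv> local_metric A g c x"

text \<open>Resolves the definite description in \<open>local_metric\<close>: every pair of
  coordinate vectors is realised by lifted tangent vectors, so the representing form is
  unique.\<close>

lemma local_metric_eq:
  assumes c: "c \<in> charts_at A p" and \<xi>: "\<xi> \<in> tangent_space A p" "\<zeta> \<in> tangent_space A p"
  shows "g p \<xi> \<zeta> = blinfun_apply (blinfun_apply (metric_in c (chart_map c p)) (\<xi> c)) (\<zeta> c)"
proof -
  let ?P = "\<lambda>B :: 'e \<Rightarrow>\<^sub>L 'e \<Rightarrow>\<^sub>L real. \<forall>\<xi>\<in>tangent_space A p. \<forall>\<zeta>\<in>tangent_space A p.
      g p \<xi> \<zeta> = blinfun_apply (blinfun_apply B (\<xi> c)) (\<zeta> c)"
  have p: "chart_inv c (chart_map c p) = p" using c by (simp add: charts_at_iff)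
  obtain B where B: "?P B" using bounded_bilinear_metric[OF c] by blast
  have "B' = B" if "?P B'" for B'
  proof (intro blinfun_eqI)
    fix u v
    show "blinfun_apply (blinfun_apply B' u) v = blinfun_apply (blinfun_apply B u) v"
      using B that tangent_lift_in[OF c, of u] tangent_lift_in[OF c, of v] tangent_lift_chart[OF c] by metis
  qed
  with B have "?P (THE B. ?P B)" by (rule theI)
  then show ?thesis using \<xi> unfolding local_metric_def p by blast
qed

lemma metric_in_eq:
  assumes "c \<in> A" "x \<in> chart_img c"
  shows "blinfun_apply (blinfun_apply (metric_in c x) u) v
    = g (chart_inv c x) (tangent_lift A (chart_inv c x) c u) (tangent_lift A (chart_inv c x) c v)"
  using local_metric_eq[OF charts_at_inv[OF assms] tangent_lift_in tangent_lift_in] charts_at_inv[OF assms] assms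
  by (simp add: tangent_lift_chart)

lemma metric_in_sym:
  assumes "c \<in> A" "x \<in> chart_img c"
  shows "blinfun_apply (blinfun_apply (metric_in c x) u) v = blinfun_apply (blinfun_apply (metric_in c x) v) u"
  unfolding metric_in_eq[OF assms]
  by (rule symmetric) (use charts_at_inv[OF assms] charts_at_topspace tangent_lift_in in blast)+

lemma metric_in_coercive:
  assumes "c \<in> A" "x \<in> chart_img c"
  obtains m where "m > 0" "\<And>u. m * (norm u)\<^sup>2 \<le> blinfun_apply (blinfun_apply (metric_in c x) u) u"
proof -
  have c: "c \<in> charts_at A (chart_inv c x)" by (rule charts_at_inv[OF assms])
  obtain m where m: "m > 0" "\<forall>\<xi>\<in>tangent_space A (chart_inv c x). m * (norm (\<xi> c))\<^sup>2 \<le> g (chart_inv c x) \<xi> \<xi>"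
    using coercive[OF c] by auto
  show ?thesis
  proof (rule that[OF m(1)])
    fix u show "m * (norm u)\<^sup>2 \<le> blinfun_apply (blinfun_apply (metric_in c x) u) u"
      using bspec[OF m(2) tangent_lift_in[OF c, of u]] by (simp add: metric_in_eq[OF assms] tangent_lift_chart[OF c])
  qed
qed

lemma metric_in_transition:
  assumes A: "c \<in> A" "d \<in> A" and x: "x \<in> overlap c d"
  shows "blinfun_apply (blinfun_apply (metric_in c x) u) v
    = blinfun_apply (blinfun_apply (metric_in d (transition c d x))
        (frechet_derivative (transition c d) (at x) u)) (frechet_derivative (transition c d) (at x) v)"
proof -
  define p where "p = chart_inv c x"
  have xc: "x \<in> chart_img c" using x by (simp add: overlap_def)
  have c: "c \<in> charts_at A p" and d: "d \<in> charts_at A p"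
    using A x by (auto simp: p_def overlap_def charts_at_iff chart_inv_dom)
  have "transition c d x = chart_map d p" by (simp add: transition_def p_def)
  moreover have "tangent_lift A p c w d = frechet_derivative (transition c d) (at x) w" for w
    using d xc by (simp add: tangent_lift_def p_def)
  ultimately show ?thesis
    unfolding metric_in_eq[OF A(1) xc] p_def[symmetric]
    using local_metric_eq[OF d tangent_lift_in[OF c, of u] tangent_lift_in[OF c, of v]] by simp
qed

end

section \<open>Christoffel maps\<close>

lemma bounded_bilinear_blinfun_form:
  fixes G :: "'a::real_normed_vector \<Rightarrow>\<^sub>L 'a \<Rightarrow>\<^sub>L 'b::real_normed_vector"
  shows "bounded_bilinear (\<lambda>u v. blinfun_apply (blinfun_apply G u) v)"
  by (rule bounded_bilinear.comp1[OF bounded_bilinear_blinfun_apply blinfun.bounded_linear_right])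

lemma norm_blinfun2_le:
  fixes G :: "'a::real_normed_vector \<Rightarrow>\<^sub>L 'b::real_normed_vector \<Rightarrow>\<^sub>L 'c::real_normed_vector"
  shows "norm (blinfun_apply (blinfun_apply G u) v) \<le> norm G * norm u * norm v"
  by (meson mult_right_mono norm_blinfun norm_ge_zero order_trans)

lemma norm_blinfun3_le:
  fixes G :: "'a::real_normed_vector \<Rightarrow>\<^sub>L 'b::real_normed_vector \<Rightarrow>\<^sub>L 'c::real_normed_vector \<Rightarrow>\<^sub>L 'd::real_normed_vector"
  shows "norm (blinfun_apply (blinfun_apply (blinfun_apply G u) v) w) \<le> norm G * norm u * norm v * norm w"
  by (rule order_trans[OF norm_blinfun2_le]) (intro mult_right_mono norm_blinfun norm_ge_zero)

text \<open>The Christoffel symbol of the first kind. Taking only the derivative \<open>D\<close> of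
  the metric as data lets it be estimated separately from the inversion of the metric.\<close>

definition koszul :: "('a::real_normed_vector \<Rightarrow>\<^sub>L 'a \<Rightarrow>\<^sub>L 'a \<Rightarrow>\<^sub>L real) \<Rightarrow> 'a \<Rightarrow> 'a \<Rightarrow> 'a \<Rightarrow> real" where
  "koszul D u v w = (blinfun_apply (blinfun_apply (blinfun_apply D u) v) w
     + blinfun_apply (blinfun_apply (blinfun_apply D v) u) w
     - blinfun_apply (blinfun_apply (blinfun_apply D w) u) v) / 2"

lemma bounded_linear_koszul: "bounded_linear (koszul D u v)"
  unfolding koszul_def
  by (intro bounded_linear_compose[OF bounded_linear_divide] bounded_linear_sub bounded_linear_add
      blinfun.bounded_linear_right bounded_linear_compose[OF blinfun.bounded_linear_left])

lemma koszul_diag_bound: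
  assumes "norm D \<le> M"
  shows "\<bar>koszul D u u w\<bar> \<le> 2 * M * (norm u)\<^sup>2 * norm w"
proof -
  have b: "\<bar>blinfun_apply (blinfun_apply (blinfun_apply D x) y) z\<bar> \<le> M * norm x * norm y * norm z" for x y z
    using norm_blinfun3_le[of D x y z] assms
    by (simp, meson mult_right_mono norm_ge_zero order_trans)
  have "M \<ge> 0" using assms norm_ge_zero order_trans by blast
  then have "0 \<le> M * (norm u)\<^sup>2 * norm w" by simp
  then show ?thesis
    using b[of u u w] b[of w u u] unfolding koszul_def by (simp add: power2_eq_square mult_ac abs_le_iff)
qed

text \<open>The quadratic dependence on the vector telescopes: replace one slot at a time, so each
  term contains \<open>u - v\<close> once and \<open>u\<close> or \<open>v\<close> once.\<close>

lemma koszul_diff_bound: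
  assumes M: "norm D \<le> M"
  shows "\<bar>koszul D u u w - koszul D v v w\<bar> \<le> 2 * M * (norm (u - v) * (norm u + norm v)) * norm w"
proof -
  have b: "\<bar>blinfun_apply (blinfun_apply (blinfun_apply D x) y) z\<bar> \<le> M * norm x * norm y * norm z" for x y z
    using norm_blinfun3_le[of D x y z] assms
    by (simp, meson mult_right_mono norm_ge_zero order_trans)
  define p where "p = M * norm (u - v) * norm u * norm w"
  define q where "q = M * norm (u - v) * norm v * norm w"
  have "M \<ge> 0" using assms norm_ge_zero order_trans by blast
  then have nn: "0 \<le> p" "0 \<le> q" by (auto simp: p_def q_def)
  let ?D = "\<lambda>x y z. blinfun_apply (blinfun_apply (blinfun_apply D x) y) z"
  have "koszul D u u w - koszul D v v w
      = ?D (u - v) u w + ?D v (u - v) w - (?D w (u - v) u + ?D w v (u - v)) / 2"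
    unfolding koszul_def
    by (simp add: blinfun.diff_left blinfun.diff_right field_simps)
  moreover have "\<bar>?D (u - v) u w\<bar> \<le> p" "\<bar>?D v (u - v) w\<bar> \<le> q"
    "\<bar>?D w (u - v) u\<bar> \<le> p" "\<bar>?D w v (u - v)\<bar> \<le> q"
    using b[of "u - v" u w] b[of v "u - v" w] b[of w "u - v" u] b[of w v "u - v"]
    by (simp_all add: p_def q_def mult_ac)
  moreover have "\<bar>a1 + a2 - (a3 + a4) / 2\<bar> \<le> 2 * p + 2 * q"
    if "\<bar>a1\<bar> \<le> p" "\<bar>a2\<bar> \<le> q" "\<bar>a3\<bar> \<le> p" "\<bar>a4\<bar> \<le> q" for a1 a2 a3 a4
    using that nn unfolding abs_le_iff by argo
  ultimately have "\<bar>koszul D u u w - koszul D v v w\<bar> \<le> 2 * p + 2 * q" by metis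
  also have "\<dots> = 2 * M * (norm (u - v) * (norm u + norm v)) * norm w"
    by (simp add: p_def q_def algebra_simps)
  finally show ?thesis .
qed

lemma koszul_diff: "koszul (D - E) u v w = koszul D u v w - koszul E u v w"
  by (simp add: koszul_def blinfun.diff_left field_simps)

text \<open>Test the equation with its own solution: coercivity bounds
  \<open>m * (norm z)\<^sup>2\<close> by a multiple of \<open>norm z\<close>, and one factor
  cancels.\<close>

lemma koszul_solution_bound:
  assumes m: "m > 0" and G: "m * (norm z)\<^sup>2 \<le> blinfun_apply (blinfun_apply G z) z"
    and z: "blinfun_apply (blinfun_apply G z) z = koszul D u u z" and M: "norm D \<le> M"
  shows "norm z \<le> 2 * M / m * (norm u)\<^sup>2"
proof (cases "z = 0")
  case True
  have "M \<ge> 0" using M norm_ge_zero order_trans by blast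
  with True m show ?thesis by simp
next
  case False
  have "m * (norm z)\<^sup>2 \<le> 2 * M * (norm u)\<^sup>2 * norm z"
    using G koszul_diag_bound[OF M, of u z] unfolding z by linarith
  then have "m * norm z \<le> 2 * M * (norm u)\<^sup>2"
    using False by (simp add: power2_eq_square[of "norm z"] mult.assoc[symmetric])
  then show ?thesis using m by (simp add: field_simps)
qed

text \<open>Subtract the two equations and test with \<open>z - y\<close>. Three errors remain: the
  change of the vector, the change of the metric derivative, and \<open>G - H\<close> applied to
  \<open>y\<close>, which is controlled by \<open>koszul_solution_bound\<close>. The bound stays
  homogeneous of degree two in the vectors, as needed for rescaled velocities.\<close>

lemma koszul_solution_lipschitz:
  fixes G H :: "'a::real_normed_vector \<Rightarrow>\<^sub>L 'a \<Rightarrow>\<^sub>L real"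
  assumes m: "m > 0" and coercive: "\<And>w. m * (norm w)\<^sup>2 \<le> blinfun_apply (blinfun_apply G w) w"
      "\<And>w. m * (norm w)\<^sup>2 \<le> blinfun_apply (blinfun_apply H w) w"
    and z: "\<And>w. blinfun_apply (blinfun_apply G z) w = koszul dG u u w"
    and y: "\<And>w. blinfun_apply (blinfun_apply H y) w = koszul dH v v w"
    and M: "norm dG \<le> M" "norm dH \<le> M" "norm (G - H) \<le> M * r" "norm (dG - dH) \<le> M * r" and r: "r \<ge> 0"
  shows "norm (z - y) \<le> ((2 * M) / m + (2 * M + 2 * M\<^sup>2 / m) / m) * (norm (u - v) * (norm u + norm v) + r * (norm v)\<^sup>2)"
proof -
  have M0: "M \<ge> 0" using M(1) norm_ge_zero order_trans by blast
  have Mr: "M * r \<ge> 0" using M(3) norm_ge_zero order_trans by blast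
  define a where "a = norm (u - v) * (norm u + norm v)"
  define b where "b = (norm v)\<^sup>2"
  have ab: "a \<ge> 0" "b \<ge> 0" by (auto simp: a_def b_def)
  have yb: "norm y \<le> 2 * M / m * b"
    unfolding b_def by (rule koszul_solution_bound[OF m coercive(2) y M(2)])
  define w where "w = z - y"
  have "m * (norm w)\<^sup>2 \<le> blinfun_apply (blinfun_apply G w) w" by (rule coercive)
  also have "\<dots> = (koszul dG u u w - koszul dG v v w) + koszul (dG - dH) v v w
      - blinfun_apply (blinfun_apply (G - H) y) w"
    using z[of w] y[of w] blinfun.diff_left[of G H y] blinfun.diff_right[of G z y, folded w_def]
    by (simp add: koszul_diff blinfun.diff_left)
  also have "\<dots> \<le> 2 * M * a * norm w + 2 * (M * r) * b * norm w + (M * r) * (2 * M / m * b) * norm w"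
  proof -
    have "\<bar>blinfun_apply (blinfun_apply (G - H) y) w\<bar> \<le> norm (G - H) * norm y * norm w"
      using norm_blinfun2_le[of "G - H" y w] by simp
    also have "\<dots> \<le> (M * r) * (2 * M / m * b) * norm w"
      using M(3) yb Mr by (intro mult_right_mono mult_mono) auto
    finally show ?thesis
      using koszul_diff_bound[OF M(1), of u w v] koszul_diag_bound[OF M(4), of v w]
      unfolding a_def[symmetric] b_def[symmetric] by (simp add: abs_le_iff)
  qed
  finally have quad: "m * (norm w)\<^sup>2 \<le> (2 * M * a + (2 * M + 2 * M\<^sup>2 / m) * (r * b)) * norm w"
    by (simp add: algebra_simps power2_eq_square)
  then have "m * norm w \<le> 2 * M * a + (2 * M + 2 * M\<^sup>2 / m) * (r * b)"
  proof (cases "w = 0")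
    case True
    then show ?thesis using M0 r ab m by simp
  next
    case False
    then have "norm w > 0" by simp
    with quad show ?thesis
      by (simp add: power2_eq_square[of "norm w"] mult.assoc[symmetric])
  qed
  then have "norm w \<le> (2 * M / m) * a + ((2 * M + 2 * M\<^sup>2 / m) / m) * (r * b)"
    using m by (simp add: field_simps)
  also have "\<dots> \<le> ((2 * M) / m + (2 * M + 2 * M\<^sup>2 / m) / m) * (a + r * b)"
  proof -
    have "0 \<le> (2 * M / m) * (r * b)" "0 \<le> ((2 * M + 2 * M\<^sup>2 / m) / m) * a"
      using M0 m ab r by auto
    then show ?thesis unfolding distrib_right distrib_left by linarith
  qed
  finally show ?thesis unfolding a_def b_def w_def .
qed

text \<open>Continuity of \<open>f'\<close> at the centre bounds it by
  \<open>norm (f' x0) + 1\<close> nearby, in place of compactness of closed balls; the mean value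
  inequality gives the rest.\<close>

lemma C1_locally_bounded_lipschitz:
  fixes f :: "'a::real_normed_vector \<Rightarrow> 'b::real_normed_vector"
  assumes S: "open S" "x0 \<in> S" and f': "\<And>x. x \<in> S \<Longrightarrow> (f has_derivative blinfun_apply (f' x)) (at x)"
    and cont: "isCont f' x0"
  obtains r M where "r > 0" "cball x0 r \<subseteq> S" "M \<ge> 0"
    "\<And>x y. x \<in> cball x0 r \<Longrightarrow> y \<in> cball x0 r \<Longrightarrow> norm (f x - f y) \<le> M * norm (x - y)"
    "\<And>x. x \<in> cball x0 r \<Longrightarrow> norm (f x) \<le> M"
proof -
  obtain r1 where r1: "r1 > 0" "cball x0 r1 \<subseteq> S" using S open_contains_cball by blast
  obtain r2 where r2: "r2 > 0" "\<And>x. dist x x0 < r2 \<Longrightarrow> dist (f' x) (f' x0) < 1"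
    using cont unfolding continuous_at_eps_delta by (metis zero_less_one)
  define r where "r = min r1 (min (r2 / 2) 1)"
  have r: "r > 0" "r \<le> r1" "r < r2" "r \<le> 1" using r1 r2 by (auto simp: r_def)
  define L where "L = norm (f' x0) + 1"
  have lip: "norm (f x - f y) \<le> L * norm (x - y)" if "x \<in> cball x0 r" "y \<in> cball x0 r" for x y
  proof (rule differentiable_bound[OF convex_cball _ _ that])
    fix z assume z: "z \<in> cball x0 r"
    have "z \<in> S" using z r(2) r1(2) subset_cball[OF r(2), of x0] by blast
    from f'[OF this] show "(f has_derivative blinfun_apply (f' z)) (at z within cball x0 r)"
      by (rule has_derivative_at_withinI)
    have "norm (f' z - f' x0) < 1" using r2(2)[of z] z r by (simp add: dist_commute[of z] dist_norm norm_minus_commute)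
    then have "norm (f' z) \<le> L" unfolding L_def by (smt (verit) norm_triangle_sub)
    then show "onorm (blinfun_apply (f' z)) \<le> L" by (simp add: norm_blinfun.rep_eq)
  qed
  have bnd: "norm (f x) \<le> norm (f x0) + L" if "x \<in> cball x0 r" for x
  proof -
    have "norm (f x - f x0) \<le> L * norm (x - x0)" using lip[OF that] r by simp
    also have "\<dots> \<le> L * 1" using that r by (intro mult_left_mono) (auto simp: L_def dist_norm norm_minus_commute)
    finally show ?thesis by (smt (verit) norm_triangle_sub)
  qed
  show ?thesis
  proof (rule that[of r "norm (f x0) + L"])
    fix x y assume xy: "x \<in> cball x0 r" "y \<in> cball x0 r"
    have "L * norm (x - y) \<le> (norm (f x0) + L) * norm (x - y)" by (intro mult_right_mono) auto
    then show "norm (f x - f y) \<le> (norm (f x0) + L) * norm (x - y)" using lip[OF xy] by linarith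
  qed (use r r1 bnd in \<open>auto simp: L_def\<close>)
qed

section \<open>The Christoffel map of a chart\<close>

context riemannian_manifold
begin

lemma metric_in_C2:
  assumes c: "c \<in> A"
  obtains G' G'' where
    "\<And>x. x \<in> chart_img c \<Longrightarrow> (metric_in c has_derivative blinfun_apply (G' x)) (at x)"
    "\<And>x. x \<in> chart_img c \<Longrightarrow> (G' has_derivative blinfun_apply (G'' x)) (at x)"
    "\<And>x. x \<in> chart_img c \<Longrightarrow> isCont G'' x"
proof -
  obtain G' where G': "\<And>x. x \<in> chart_img c \<Longrightarrow> (metric_in c has_derivative blinfun_apply (G' x)) (at x)"
    "smooth_on (chart_img c) G'" using smooth_on_derivative[OF smooth_metric[OF c] open_img[OF c]] by blast
  obtain G'' where G'': "\<And>x. x \<in> chart_img c \<Longrightarrow> (G' has_derivative blinfun_apply (G'' x)) (at x)"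
    "smooth_on (chart_img c) G''" using smooth_on_derivative[OF G'(2) open_img[OF c]] by blast
  \<comment> \<open>The third derivative serves only to make \<open>G''\<close> continuous, hence
    \<open>G'\<close> locally Lipschitz.\<close>
  obtain G3 where "\<And>x. x \<in> chart_img c \<Longrightarrow> (G'' has_derivative blinfun_apply (G3 x)) (at x)"
    using smooth_on_derivative[OF G''(2) open_img[OF c]] by blast
  then have "isCont G'' x" if "x \<in> chart_img c" for x
    using has_derivative_continuous that by blast
  with G'(1) G''(1) show ?thesis by (rule that)
qed

text \<open>Coercivity makes the metric nondegenerate, so the Koszul identity determines its
  solution; later identities for Christoffel maps are proved by exhibiting a solution.\<close>

lemma christoffel_unique:
  assumes c: "c \<in> A" and x: "x \<in> chart_img c"
    and G': "(metric_in c has_derivative blinfun_apply G') (at x)"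
    and z: "\<And>w. blinfun_apply (blinfun_apply (metric_in c x) z) w = koszul G' u v w"
  shows "christoffel A g c x u v = z"
proof -
  obtain m where m: "m > 0" "\<And>u. m * (norm u)\<^sup>2 \<le> blinfun_apply (blinfun_apply (metric_in c x) u) u"
    using metric_in_coercive[OF c x] by blast
  have fd: "frechet_derivative (local_metric A g c) (at x) = blinfun_apply G'"
    using frechet_derivative_at[OF G'] by simp
  show ?thesis
    unfolding christoffel_def Let_def fd koszul_def[symmetric]
  proof (rule the_equality)
    show "\<forall>w. blinfun_apply (blinfun_apply (metric_in c x) z) w = koszul G' u v w" using z by simp
    fix y assume "\<forall>w. blinfun_apply (blinfun_apply (metric_in c x) y) w = koszul G' u v w"
    then show "y = z"
      using z by (intro coercive_form_cancel[OF bounded_bilinear_blinfun_form m]) simp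
  qed
qed

text \<open>Existence is Riesz representation for the metric at \<open>x\<close>, the Koszul
  expression being a bounded functional of \<open>w\<close>.\<close>

lemma christoffel_koszul:
  assumes c: "c \<in> A" and x: "x \<in> chart_img c"
    and G': "(metric_in c has_derivative blinfun_apply G') (at x)"
  shows "blinfun_apply (blinfun_apply (metric_in c x) (christoffel A g c x u v)) w = koszul G' u v w"
proof -
  obtain m where m: "m > 0" "\<And>u. m * (norm u)\<^sup>2 \<le> blinfun_apply (blinfun_apply (metric_in c x) u) u"
    using metric_in_coercive[OF c x] by blast
  obtain z where z: "\<And>w. blinfun_apply (blinfun_apply (metric_in c x) z) w = koszul G' u v w"
    using coercive_form_representation[OF bounded_bilinear_blinfun_form metric_in_sym[OF c x] m bounded_linear_koszul]
    by blast
  show ?thesis unfolding christoffel_unique[OF c x G' z] by (rule z)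
qed

lemma christoffel_scaleR:
  assumes c: "c \<in> A" and x: "x \<in> chart_img c"
  shows "christoffel A g c x (s *\<^sub>R v) (s *\<^sub>R v) = s\<^sup>2 *\<^sub>R christoffel A g c x v v"
proof -
  obtain G' where G': "(metric_in c has_derivative blinfun_apply (G' x)) (at x)"
    using metric_in_C2[OF c] x by metis
  show ?thesis
    by (rule christoffel_unique[OF c x G'])
      (simp add: blinfun.scaleR_left blinfun.scaleR_right christoffel_koszul[OF c x G'] koszul_def
        power2_eq_square algebra_simps)
qed

text \<open>The geodesic equation is independent of the chart.\<close>

lemma christoffel_transition:
  assumes A: "c \<in> A" "d \<in> A"
    and T: "\<And>x. x \<in> overlap c d \<Longrightarrow> (transition c d has_derivative blinfun_apply (T x)) (at x)"
    and T2: "\<And>x. x \<in> overlap c d \<Longrightarrow> (T has_derivative blinfun_apply (T2 x)) (at x)"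
    and fd: "\<And>x. x \<in> overlap c d \<Longrightarrow> frechet_derivative (transition c d) (at x) = blinfun_apply (T x)"
    and sym: "\<And>x u v. x \<in> overlap c d \<Longrightarrow>
      blinfun_apply (blinfun_apply (T2 x) u) v = blinfun_apply (blinfun_apply (T2 x) v) u"
    and x: "x \<in> overlap c d"
  shows "christoffel A g d (transition c d x) (blinfun_apply (T x) v) (blinfun_apply (T x) v)
    = blinfun_apply (T x) (christoffel A g c x v v) - blinfun_apply (blinfun_apply (T2 x) v) v"
proof -
  define y where "y = transition c d x"
  have xc: "x \<in> chart_img c" using x by (simp add: overlap_def)
  have yd: "y \<in> chart_img d" unfolding y_def by (rule transition_img[OF x])
  obtain Gc where Gc: "(metric_in c has_derivative blinfun_apply (Gc x)) (at x)"
    using metric_in_C2[OF A(1)] xc by metis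
  obtain Gd where Gd: "(metric_in d has_derivative blinfun_apply (Gd y)) (at y)"
    using metric_in_C2[OF A(2)] yd by metis
  let ?g = "\<lambda>a b. blinfun_apply (blinfun_apply (metric_in d y) a) b"
  have gsym: "?g a b = ?g b a" for a b by (rule metric_in_sym[OF A(2) yd])
  let ?T = "blinfun_apply (T x)" and ?S = "\<lambda>a b. blinfun_apply (blinfun_apply (T2 x) a) b"
  \<comment> \<open>Product rule for the identity that pulls the metric of \<open>d\<close> back to
    \<open>c\<close>: one term differentiates the metric, two differentiate the transition
    derivative.\<close>
  have deriv: "blinfun_apply (blinfun_apply (blinfun_apply (Gc x) a) u) w
      = blinfun_apply (blinfun_apply (blinfun_apply (Gd y) (?T a)) (?T u)) (?T w)
        + ?g (?S a u) (?T w) + ?g (?T u) (?S a w)" for a u w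
  proof -
    have "((\<lambda>z. blinfun_apply (blinfun_apply (metric_in c z) u) w) has_derivative
        (\<lambda>a. blinfun_apply (blinfun_apply (blinfun_apply (Gc x) a) u) w)) (at x)"
      by (intro bounded_linear.has_derivative[OF blinfun.bounded_linear_left] Gc)
    then have 1: "((\<lambda>z. blinfun_apply (blinfun_apply (metric_in d (transition c d z)) (blinfun_apply (T z) u)) (blinfun_apply (T z) w))
       has_derivative (\<lambda>a. blinfun_apply (blinfun_apply (blinfun_apply (Gc x) a) u) w)) (at x)"
      by (rule has_derivative_transform_within_open[OF _ open_overlap[OF A] x])
        (simp add: metric_in_transition[OF A] fd)
    have g: "((\<lambda>z. metric_in d (transition c d z)) has_derivative (\<lambda>a. blinfun_apply (Gd y) (?T a))) (at x)"
      using has_derivative_compose[OF T[OF x], of "metric_in d"] Gd by (simp add: y_def)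
    have t: "((\<lambda>z. blinfun_apply (T z) u) has_derivative (\<lambda>a. ?S a u)) (at x)" for u
      by (intro bounded_linear.has_derivative[OF blinfun.bounded_linear_left] T2 x)
    have "((\<lambda>z. blinfun_apply (blinfun_apply (metric_in d (transition c d z)) (blinfun_apply (T z) u)) (blinfun_apply (T z) w))
       has_derivative (\<lambda>a. blinfun_apply (blinfun_apply (metric_in d (transition c d x)) (?T u)) (?S a w)
         + blinfun_apply (blinfun_apply (metric_in d (transition c d x)) (?S a u)
             + blinfun_apply (blinfun_apply (Gd y) (?T a)) (?T u)) (?T w))) (at x)"
      by (rule blinfun.FDERIV[OF blinfun.FDERIV[OF g t] t])
    from fun_cong[OF has_derivative_unique[OF 1 this], of a] show ?thesis
      by (simp add: blinfun.add_left y_def)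
  qed
  show ?thesis
    unfolding y_def[symmetric]
  proof (rule christoffel_unique[OF A(2) yd Gd])
    fix w
    \<comment> \<open>The transition derivative is onto, so every test vector in \<open>d\<close>
      comes from one in \<open>c\<close>.\<close>
    define w' where "w' = frechet_derivative (transition d c) (at y) w"
    have w: "w = ?T w'" unfolding w'_def y_def fd[OF x, symmetric]
      by (simp add: transition_right_inverse[OF A x])
    have "?g (?T (christoffel A g c x v v)) (?T w') = koszul (Gc x) v v w'"
      using christoffel_koszul[OF A(1) xc Gc] metric_in_transition[OF A x] fd[OF x] y_def by metis
    \<comment> \<open>Of the second-derivative terms, those pairing \<open>v\<close> with
      \<open>w'\<close> cancel by symmetry; the one with \<open>v\<close> twice remains.\<close>
    moreover have "koszul (Gc x) v v w' = koszul (Gd y) (?T v) (?T v) (?T w') + ?g (?S v v) (?T w')"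
      unfolding koszul_def deriv using sym[OF x, of v w'] gsym[of "?T v" "?S w' v"] by (simp add: field_simps)
    ultimately show "?g (?T (christoffel A g c x v v) - ?S v v) w = koszul (Gd y) (?T v) (?T v) w"
      by (simp add: w blinfun.diff_left blinfun.diff_right)
  qed
qed

text \<open>Continuity of the metric in relative form: the error is measured by the metric at
  \<open>x0\<close> itself, coercivity there absorbing \<open>norm u\<close>. With 1/2 it gives
  uniform coercivity, with small \<open>\<theta>\<close> nearly sharp comparison of lengths.\<close>

lemma metric_in_locally_coercive:
  assumes c: "c \<in> A" and x0: "x0 \<in> chart_img c" and \<theta>: "0 < \<theta>"
  obtains r where "r > 0" "cball x0 r \<subseteq> chart_img c"
    "\<And>x u. x \<in> cball x0 r \<Longrightarrow> \<bar>blinfun_apply (blinfun_apply (metric_in c x) u) u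
       - blinfun_apply (blinfun_apply (metric_in c x0) u) u\<bar> \<le> \<theta> * blinfun_apply (blinfun_apply (metric_in c x0) u) u"
proof -
  obtain m where m: "m > 0" "\<And>u. m * (norm u)\<^sup>2 \<le> blinfun_apply (blinfun_apply (metric_in c x0) u) u"
    using metric_in_coercive[OF c x0] by blast
  obtain G' where G': "\<And>x. x \<in> chart_img c \<Longrightarrow> (metric_in c has_derivative blinfun_apply (G' x)) (at x)"
    using metric_in_C2[OF c] by metis
  have "isCont (metric_in c) x0" using has_derivative_continuous[OF G'[OF x0]] .
  then obtain r1 where r1: "r1 > 0" "\<And>x. dist x x0 < r1 \<Longrightarrow> dist (metric_in c x) (metric_in c x0) < \<theta> * m"
    unfolding continuous_at_eps_delta using m \<theta> by (metis mult_pos_pos)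
  obtain r2 where r2: "r2 > 0" "cball x0 r2 \<subseteq> chart_img c" using open_img[OF c] x0 open_contains_cball by blast
  show ?thesis
  proof (rule that[of "min (r1 / 2) r2"])
    fix x u assume x: "x \<in> cball x0 (min (r1 / 2) r2)"
    have "norm (metric_in c x - metric_in c x0) \<le> \<theta> * m"
      using r1(2)[of x] x r1(1) by (auto simp: dist_norm norm_minus_commute)
    have "\<bar>blinfun_apply (blinfun_apply (metric_in c x - metric_in c x0) u) u\<bar> \<le> norm (metric_in c x - metric_in c x0) * norm u * norm u"
      using norm_blinfun2_le[of "metric_in c x - metric_in c x0" u u] by simp
    also have "\<dots> \<le> \<theta> * m * norm u * norm u"
      using \<open>norm _ \<le> \<theta> * m\<close> by (intro mult_right_mono) auto
    also have "\<dots> \<le> \<theta> * blinfun_apply (blinfun_apply (metric_in c x0) u) u"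
      using mult_left_mono[OF m(2)[of u], of \<theta>] \<theta> by (simp add: power2_eq_square mult_ac)
    finally show "\<bar>blinfun_apply (blinfun_apply (metric_in c x) u) u
       - blinfun_apply (blinfun_apply (metric_in c x0) u) u\<bar> \<le> \<theta> * blinfun_apply (blinfun_apply (metric_in c x0) u) u"
      by (simp add: blinfun.diff_left)
  qed (use r1 r2 in auto)
qed

text \<open>The metric and its derivative are locally Lipschitz and half of the coercivity constant
  survives near \<open>x0\<close>, so the estimates for Koszul solutions hold with uniform
  constants.\<close>

lemma christoffel_locally_lipschitz:
  assumes c: "c \<in> A" and x0: "x0 \<in> chart_img c"
  obtains R C L where "R > 0" "cball x0 R \<subseteq> chart_img c" "L \<ge> 0"
    "\<And>x v. x \<in> cball x0 R \<Longrightarrow> norm (christoffel A g c x v v) \<le> C * (norm v)\<^sup>2"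
    "\<And>x y u v. x \<in> cball x0 R \<Longrightarrow> y \<in> cball x0 R \<Longrightarrow>
      norm (christoffel A g c x u u - christoffel A g c y v v)
        \<le> L * (norm (u - v) * (norm u + norm v) + norm (x - y) * (norm v)\<^sup>2)"
proof -
  obtain G' G'' where G':
    "\<And>x. x \<in> chart_img c \<Longrightarrow> (metric_in c has_derivative blinfun_apply (G' x)) (at x)"
    "\<And>x. x \<in> chart_img c \<Longrightarrow> (G' has_derivative blinfun_apply (G'' x)) (at x)"
    "\<And>x. x \<in> chart_img c \<Longrightarrow> isCont G'' x" using metric_in_C2[OF c] by metis
  obtain r1 M1 where r1: "r1 > 0" "cball x0 r1 \<subseteq> chart_img c" "M1 \<ge> 0"
    "\<And>x y. x \<in> cball x0 r1 \<Longrightarrow> y \<in> cball x0 r1 \<Longrightarrow> norm (metric_in c x - metric_in c y) \<le> M1 * norm (x - y)"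
    "\<And>x. x \<in> cball x0 r1 \<Longrightarrow> norm (metric_in c x) \<le> M1"
    using C1_locally_bounded_lipschitz[OF open_img[OF c] x0 G'(1) has_derivative_continuous[OF G'(2)[OF x0]]]
    by blast
  obtain r2 M2 where r2: "r2 > 0" "cball x0 r2 \<subseteq> chart_img c" "M2 \<ge> 0"
    "\<And>x y. x \<in> cball x0 r2 \<Longrightarrow> y \<in> cball x0 r2 \<Longrightarrow> norm (G' x - G' y) \<le> M2 * norm (x - y)"
    "\<And>x. x \<in> cball x0 r2 \<Longrightarrow> norm (G' x) \<le> M2"
    using C1_locally_bounded_lipschitz[OF open_img[OF c] x0 G'(2) G'(3)[OF x0]] by blast
  have half: "0 < (1/2 :: real)" by simp
  obtain r3 where r3: "r3 > 0" "cball x0 r3 \<subseteq> chart_img c"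
    "\<And>x u. x \<in> cball x0 r3 \<Longrightarrow> \<bar>blinfun_apply (blinfun_apply (metric_in c x) u) u
       - blinfun_apply (blinfun_apply (metric_in c x0) u) u\<bar> \<le> 1/2 * blinfun_apply (blinfun_apply (metric_in c x0) u) u"
    using metric_in_locally_coercive[OF c x0 half] by blast
  obtain m where m: "m > 0" "\<And>u. m * (norm u)\<^sup>2 \<le> blinfun_apply (blinfun_apply (metric_in c x0) u) u"
    using metric_in_coercive[OF c x0] by blast
  define R where "R = min r1 (min r2 r3)"
  have R: "R > 0" "R \<le> r1" "R \<le> r2" "R \<le> r3" using r1 r2 r3 by (auto simp: R_def)
  define M where "M = max M1 M2"
  have coer: "m / 2 * (norm u)\<^sup>2 \<le> blinfun_apply (blinfun_apply (metric_in c x) u) u" if "x \<in> cball x0 R" for x u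
  proof -
    have "x \<in> cball x0 r3" using that R by simp
    from r3(3)[OF this, of u] m(2)[of u] show ?thesis unfolding abs_le_iff by argo
  qed
  have m2: "m / 2 > 0" using m by simp
  have img: "x \<in> chart_img c" if "x \<in> cball x0 R" for x using that r1 R by auto
  have ko: "blinfun_apply (blinfun_apply (metric_in c x) (christoffel A g c x v v)) w = koszul (G' x) v v w"
    if "x \<in> cball x0 R" for x v w
    by (rule christoffel_koszul[OF c img[OF that] G'(1)[OF img[OF that]]])
  have G'M: "norm (G' x) \<le> M" if "x \<in> cball x0 R" for x using r2(5)[of x] that R by (auto simp: M_def)
  have L1: "norm (metric_in c x - metric_in c y) \<le> M * norm (x - y)" if "x \<in> cball x0 R" "y \<in> cball x0 R" for x y
  proof -
    have "norm (metric_in c x - metric_in c y) \<le> M1 * norm (x - y)" using r1(4) that R by auto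
    also have "\<dots> \<le> M * norm (x - y)" by (intro mult_right_mono) (auto simp: M_def)
    finally show ?thesis .
  qed
  have L2: "norm (G' x - G' y) \<le> M * norm (x - y)" if "x \<in> cball x0 R" "y \<in> cball x0 R" for x y
  proof -
    have "norm (G' x - G' y) \<le> M2 * norm (x - y)" using r2(4) that R by auto
    also have "\<dots> \<le> M * norm (x - y)" by (intro mult_right_mono) (auto simp: M_def)
    finally show ?thesis .
  qed
  have M0: "M \<ge> 0" using r1(3) by (simp add: M_def)
  show ?thesis
  proof (rule that[OF R(1)])
    show "cball x0 R \<subseteq> chart_img c" using img by blast
    show "0 \<le> (2 * M) / (m/2) + (2 * M + 2 * M\<^sup>2 / (m/2)) / (m/2)" using M0 m by simp
    show "norm (christoffel A g c x v v) \<le> 2 * M / (m/2) * (norm v)\<^sup>2" if "x \<in> cball x0 R" for x v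
      by (rule koszul_solution_bound[OF m2 coer[OF that] ko[OF that] G'M[OF that]])
    show "norm (christoffel A g c x u u - christoffel A g c y v v)
        \<le> ((2 * M) / (m/2) + (2 * M + 2 * M\<^sup>2 / (m/2)) / (m/2)) * (norm (u - v) * (norm u + norm v) + norm (x - y) * (norm v)\<^sup>2)"
      if "x \<in> cball x0 R" "y \<in> cball x0 R" for x y u v
      by (rule koszul_solution_lipschitz[OF m2 coer[OF that(1)] coer[OF that(2)] ko[OF that(1)] ko[OF that(2)]
          G'M[OF that(1)] G'M[OF that(2)] L1[OF that] L2[OF that] norm_ge_zero])
  qed
qed

end

section \<open>Geodesics and proximal subgradients in a chart\<close>

lemma continuous_map_real_nhd:
  fixes \<gamma> :: "real \<Rightarrow> 'm"
  assumes \<gamma>: "continuous_map (top_of_set J) X \<gamma>" and t: "t \<in> J" and U: "openin X U" "\<gamma> t \<in> U"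
  obtains e where "e > 0" "\<And>s. s \<in> J \<Longrightarrow> dist s t < e \<Longrightarrow> \<gamma> s \<in> U"
proof -
  have "openin (top_of_set J) {s \<in> topspace (top_of_set J). \<gamma> s \<in> U}"
    by (rule openin_continuous_map_preimage[OF \<gamma> U(1)])
  then obtain e where "e > 0" "ball t e \<inter> J \<subseteq> {s \<in> topspace (top_of_set J). \<gamma> s \<in> U}"
    using t U(2) unfolding openin_contains_ball by auto
  moreover have "s \<in> ball t e \<inter> J" if "s \<in> J" "dist s t < e" for s
    using that by (simp add: dist_commute)
  ultimately show ?thesis by (intro that[of e]) blast+
qed

section \<open>Continuity of curves through charts\<close>

context hilbert_manifold
begin

lemma continuous_map_chart_inv:
  assumes c: "c \<in> A"
  shows "continuous_map (top_of_set (chart_img c)) X (chart_inv c)"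
  unfolding continuous_map_def
proof (intro conjI allI impI)
  show "chart_inv c \<in> topspace (top_of_set (chart_img c)) \<rightarrow> topspace X"
    using chart_dom_subset[OF c] by (auto dest: chart_inv_dom)
  fix U assume "openin X U"
  from open_chart_image[OF c this] have "openin (top_of_set (chart_img c)) {x \<in> chart_img c. chart_inv c x \<in> U}"
    by (intro open_openin_trans) (auto simp: open_img[OF c])
  then show "openin (top_of_set (chart_img c)) {x \<in> topspace (top_of_set (chart_img c)). chart_inv c x \<in> U}" by simp
qed

lemma continuous_map_chart_curve:
  assumes c: "c \<in> A" and x: "continuous_on J x" "\<And>t. t \<in> J \<Longrightarrow> x t \<in> chart_img c"
  shows "continuous_map (top_of_set J) X (\<lambda>t. chart_inv c (x t))"
proof -
  have "continuous_map (top_of_set J) (top_of_set (chart_img c)) x" using x by auto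
  from continuous_map_compose[OF this continuous_map_chart_inv[OF c]] show ?thesis by (simp add: o_def)
qed

text \<open>Equality set of two continuous maps into a Hausdorff space, \<open>t\<close> being a
  limit of earlier times. This is the closed step of the induction over time for geodesics.\<close>

lemma continuous_curves_eq_at_right_end:
  assumes "continuous_map (top_of_set {a..b::real}) X \<gamma>" "continuous_map (top_of_set {a..b}) X \<gamma>'"
    and t: "a < t" "t \<le> b" and eq: "\<And>s. a \<le> s \<Longrightarrow> s < t \<Longrightarrow> \<gamma> s = \<gamma>' s"
  shows "\<gamma> t = \<gamma>' t"
proof (rule forall_in_closure_of_eq[OF _ Hausdorff assms(1,2)])
  have "t \<in> closure {a..<t}" using t by simp
  moreover have "{a..b} \<inter> {a..<t} = {a..<t}" using t by auto
  ultimately show "t \<in> top_of_set {a..b} closure_of {a..<t}"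
    using t by (simp add: closure_of_subtopology)
qed (use eq in auto)

end

section \<open>The geodesic equation and the exponential map in a chart\<close>

context riemannian_manifold
begin

text \<open>In another chart the velocity is the transition derivative applied to \<open>v\<close>;
  differentiating it produces the second derivative on \<open>v\<close> twice, which is exactly the
  correction in \<open>christoffel_transition\<close>.\<close>

lemma geodesic_lift:
  assumes c: "c \<in> A" and img: "\<And>t. t \<in> J \<Longrightarrow> x t \<in> chart_img c"
    and x: "\<And>t. t \<in> J \<Longrightarrow> (x has_vector_derivative v t) (at t within J)"
    and v: "\<And>t. t \<in> J \<Longrightarrow> (v has_vector_derivative - christoffel A g c (x t) (v t) (v t)) (at t within J)"
  shows "geodesic_on X A g J (\<lambda>t. chart_inv c (x t)) (\<lambda>t. tangent_lift A (chart_inv c (x t)) c (v t))"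
  unfolding geodesic_on_def
proof (intro conjI ballI)
  have cont: "continuous_on J x"
    using x by (meson continuous_on_eq_continuous_within has_vector_derivative_continuous)
  show "continuous_map (top_of_set J) X (\<lambda>t. chart_inv c (x t))"
    by (rule continuous_map_chart_curve[OF c cont img])
  fix t assume t: "t \<in> J"
  show "has_velocity A (\<lambda>t. chart_inv c (x t)) J t (tangent_lift A (chart_inv c (x t)) c (v t))"
    by (rule has_velocity_lift[OF c t img x[OF t]])
  fix d assume d: "d \<in> charts_at A (chart_inv c (x t))"
  then have dA: "d \<in> A" and xt: "x t \<in> overlap c d" using img[OF t] by (auto simp: charts_at_iff overlap_def)
  obtain T T2 where T: "\<And>x. x \<in> overlap c d \<Longrightarrow> (transition c d has_derivative blinfun_apply (T x)) (at x)"
    "\<And>x. x \<in> overlap c d \<Longrightarrow> (T has_derivative blinfun_apply (T2 x)) (at x)"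
    "\<And>x. x \<in> overlap c d \<Longrightarrow> frechet_derivative (transition c d) (at x) = blinfun_apply (T x)"
    "\<And>x u v. x \<in> overlap c d \<Longrightarrow> blinfun_apply (blinfun_apply (T2 x) u) v = blinfun_apply (blinfun_apply (T2 x) v) u"
    using transition_C2[OF c dA] by blast
  \<comment> \<open>Near \<open>t\<close> the curve remains in the domain of \<open>d\<close>;
    elsewhere the lift has the default value 0 in \<open>d\<close> and the formula for it
    fails.\<close>
  obtain e where e: "e > 0" "\<And>s. s \<in> J \<Longrightarrow> dist s t < e \<Longrightarrow> x s \<in> overlap c d"
    using continuous_map_real_nhd[of J euclidean x t "overlap c d"] cont t xt open_overlap[OF c dA] by auto
  have Tx: "((\<lambda>s. T (x s)) has_vector_derivative blinfun_apply (T2 (x t)) (v t)) (at t within J)"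
    using has_derivative_compose[OF x[OF t, unfolded has_vector_derivative_def] T(2)[OF xt]]
    by (simp add: has_vector_derivative_def blinfun.scaleR_right)
  have "((\<lambda>s. blinfun_apply (T (x s)) (v s)) has_vector_derivative
      (blinfun_apply (T (x t)) (- christoffel A g c (x t) (v t) (v t)) + blinfun_apply (blinfun_apply (T2 (x t)) (v t)) (v t)))
      (at t within J)"
    by (rule blinfun.has_vector_derivative[OF Tx v[OF t]])
  also have "blinfun_apply (T (x t)) (- christoffel A g c (x t) (v t) (v t)) + blinfun_apply (blinfun_apply (T2 (x t)) (v t)) (v t)
      = - christoffel A g d (transition c d (x t)) (blinfun_apply (T (x t)) (v t)) (blinfun_apply (T (x t)) (v t))"
    using christoffel_transition[OF c dA T xt, of "v t"] by (simp add: blinfun.minus_right)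
  also have "transition c d (x t) = chart_map d (chart_inv c (x t))" by (simp add: transition_def)
  finally have der: "((\<lambda>s. blinfun_apply (T (x s)) (v s)) has_vector_derivative
      - christoffel A g d (chart_map d (chart_inv c (x t))) (blinfun_apply (T (x t)) (v t)) (blinfun_apply (T (x t)) (v t)))
      (at t within J)" .
  have lift: "tangent_lift A (chart_inv c (x s)) c (v s) d = blinfun_apply (T (x s)) (v s)"
    if "s \<in> J" "x s \<in> overlap c d" for s
    using that dA T(3)[OF that(2)] img by (simp add: tangent_lift_def charts_at_iff overlap_def)
  show "((\<lambda>s. tangent_lift A (chart_inv c (x s)) c (v s) d) has_vector_derivative
      - christoffel A g d (chart_map d (chart_inv c (x t)))
        (tangent_lift A (chart_inv c (x t)) c (v t) d) (tangent_lift A (chart_inv c (x t)) c (v t) d)) (at t within J)"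
    unfolding lift[OF t xt]
    by (rule has_vector_derivative_transform_within[OF der e(1) t]) (use lift e(2) in auto)
qed

text \<open>Only the reference solution is known to stay in the ball; \<open>\<gamma>\<close> could
  leave the chart. Real induction prevents this: equality persists in left limits, and from a time
  of agreement both curves stay in the ball briefly, where the equation determines them.\<close>

lemma geodesic_unique_in_chart:
  assumes c: "c \<in> A" and R: "R > 0" "cball x0 R \<subseteq> chart_img c" and L: "L \<ge> 0"
    and lip: "\<And>x y u v. x \<in> cball x0 R \<Longrightarrow> y \<in> cball x0 R \<Longrightarrow>
      norm (christoffel A g c x u u - christoffel A g c y v v)
        \<le> L * (norm (u - v) * (norm u + norm v) + norm (x - y) * (norm v)\<^sup>2)"
    and ball: "\<And>t. t \<in> {0..1} \<Longrightarrow> x t \<in> ball x0 R"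
    and x: "\<And>t. t \<in> {0..1} \<Longrightarrow> (x has_vector_derivative v t) (at t within {0..1})"
    and v: "\<And>t. t \<in> {0..1} \<Longrightarrow> (v has_vector_derivative - christoffel A g c (x t) (v t) (v t)) (at t within {0..1})"
    and geo: "geodesic_on X A g {0..1} \<gamma> V"
    and init: "\<gamma> 0 = chart_inv c (x 0)" "V 0 c = v 0"
    and t: "t \<in> {0..1}"
  shows "\<gamma> t = chart_inv c (x t)"
proof -
  have img: "x t \<in> chart_img c" if "t \<in> {0..1}" for t using ball[OF that] R by auto
  have cont_x: "continuous_on {0..1} x"
    using x by (meson continuous_on_eq_continuous_within has_vector_derivative_continuous)
  have cont_v: "continuous_on {0..1} v"
    using v by (meson continuous_on_eq_continuous_within has_vector_derivative_continuous)
  have cont_cx: "continuous_map (top_of_set {0..1}) X (\<lambda>t. chart_inv c (x t))"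
    by (rule continuous_map_chart_curve[OF c cont_x img])
  have cont_\<gamma>: "continuous_map (top_of_set {0..1}) X \<gamma>" using geo by (simp add: geodesic_on_def)
  have \<gamma>': "((\<lambda>s. chart_map c (\<gamma> s)) has_vector_derivative V t c) (at t within {0..1})"
    and V': "((\<lambda>s. V s c) has_vector_derivative - christoffel A g c (chart_map c (\<gamma> t)) (V t c) (V t c)) (at t within {0..1})"
    if "t \<in> {0..1}" "\<gamma> t \<in> chart_dom c" for t
    using geo that c by (auto simp: geodesic_on_def has_velocity_def charts_at_iff o_def)
  \<comment> \<open>Velocities are carried along because the equation has second order: agreement of
    positions alone would not restart the uniqueness argument.\<close>
  define P where "P t \<longleftrightarrow> \<gamma> t = chart_inv c (x t) \<and> V t c = v t" for t
  have "P t"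
  proof (rule real_interval_induct[where a = 0 and b = 1 and P = P])
    fix t :: real assume t: "0 \<le> t" "t \<le> 1" and before: "\<And>s. 0 \<le> s \<Longrightarrow> s < t \<Longrightarrow> P s"
    show "P t"
    proof (cases "t = 0")
      case True then show ?thesis using init by (simp add: P_def)
    next
      case False
      then have t0: "0 < t" using t by simp
      have eq: "\<gamma> t = chart_inv c (x t)"
        by (rule continuous_curves_eq_at_right_end[OF cont_\<gamma> cont_cx t0 t(2)]) (use before in \<open>auto simp: P_def\<close>)
      have tt: "t \<in> {0..1}" using t by simp
      have "\<gamma> t \<in> chart_dom c" unfolding eq by (rule chart_inv_dom[OF img[OF tt]])
      from has_vector_derivative_continuous[OF V'[OF tt this]]
      have lV: "((\<lambda>s. V s c) \<longlongrightarrow> V t c) (at t within {0..<t})"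
        unfolding continuous_within by (rule tendsto_within_subset) (use t in auto)
      have lv: "(v \<longlongrightarrow> v t) (at t within {0..<t})"
        using has_vector_derivative_continuous[OF v[OF tt]]
        unfolding continuous_within by (rule tendsto_within_subset) (use t in auto)
      have ev: "eventually (\<lambda>s. V s c = v s) (at t within {0..<t})"
        unfolding eventually_at_filter using before by (auto simp: P_def)
      have nb: "at t within {0..<t} \<noteq> bot"
        using t0 by (simp add: at_within_eq_bot_iff)
      have "V t c = v t"
        by (rule tendsto_unique[OF nb lV iffD2[OF tendsto_cong[OF ev] lv]])
      with eq show ?thesis by (simp add: P_def)
    qed
  next
    fix t :: real assume t: "0 \<le> t" "t < 1" and upto: "\<And>s. 0 \<le> s \<Longrightarrow> s \<le> t \<Longrightarrow> P s"
    have tt: "t \<in> {0..1}" using t by simp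
    have Pt: "\<gamma> t = chart_inv c (x t)" "V t c = v t" using upto[of t] t by (auto simp: P_def)
    have \<gamma>t: "\<gamma> t \<in> chart_dom c" unfolding Pt by (rule chart_inv_dom[OF img[OF tt]])
    obtain e1 where e1: "e1 > 0" "\<And>s. s \<in> {0..1} \<Longrightarrow> dist s t < e1 \<Longrightarrow> \<gamma> s \<in> {p \<in> chart_dom c. chart_map c p \<in> ball x0 R}"
      using continuous_map_real_nhd[OF cont_\<gamma> tt openin_chart_preimage[OF c open_ball[of x0 R]]] \<gamma>t ball[OF tt] img[OF tt]
      by (auto simp: Pt)
    \<comment> \<open>Christoffel maps are quadratic in the velocity, so a Lipschitz constant
      requires a bound on both velocities near \<open>t\<close>.\<close>
    define N where "N = norm (v t) + 1"
    have "continuous (at t within {0..1}) (\<lambda>s. V s c)" by (rule has_vector_derivative_continuous[OF V'[OF tt \<gamma>t]])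
    then obtain e2 where e2: "e2 > 0" "\<And>s. s \<in> {0..1} \<Longrightarrow> dist s t < e2 \<Longrightarrow> dist (V s c) (V t c) < 1"
      unfolding continuous_within_eps_delta by (meson zero_less_one)
    have "continuous (at t within {0..1}) v" by (rule has_vector_derivative_continuous[OF v[OF tt]])
    then obtain e3 where e3: "e3 > 0" "\<And>s. s \<in> {0..1} \<Longrightarrow> dist s t < e3 \<Longrightarrow> dist (v s) (v t) < 1"
      unfolding continuous_within_eps_delta by (meson zero_less_one)
    define u where "u = t + min e1 (min e2 e3)"
    have "P s" if s: "t < s" "s < u" "s \<le> 1" for s
    proof -
      have near: "r \<in> {0..1}" "dist r t < e1" "dist r t < e2" "dist r t < e3" if "r \<in> {t..s}" for r
        using that s t by (auto simp: u_def dist_real_def)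
      have NV: "norm (V r c) \<le> N" and Nv: "norm (v r) \<le> N" if "r \<in> {t..s}" for r
        using e2(2)[of r] e3(2)[of r] near[OF that] norm_triangle_sub[of "V r c" "v t"] norm_triangle_sub[of "v r" "v t"]
        by (auto simp: N_def dist_norm Pt)
      have dom: "\<gamma> r \<in> chart_dom c" "chart_map c (\<gamma> r) \<in> cball x0 R" if "r \<in> {t..s}" for r
        using e1(2)[OF near(1,2)[OF that]] by auto
      have sub: "{t..s} \<subseteq> {0..1}" using near(1) by blast
      define K where "K = L * (2 * N + N\<^sup>2)"
      have N0: "N \<ge> 0" by (simp add: N_def)
      have K: "K \<ge> 0" using L N0 by (simp add: K_def)
      have "(chart_map c (\<gamma> s), V s c) = (x s, v s)"
      proof (rule ode_unique[where a = t and b = s and L = "1 + K"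
            and y = "\<lambda>s. (chart_map c (\<gamma> s), V s c)" and z = "\<lambda>s. (x s, v s)"])
        show "t \<le> s" using s by simp
        fix r assume r: "r \<in> {t..s}"
        show "((\<lambda>s. (chart_map c (\<gamma> s), V s c)) has_vector_derivative
            (V r c, - christoffel A g c (chart_map c (\<gamma> r)) (V r c) (V r c))) (at r within {t..s})"
          using near(1)[OF r] dom(1)[OF r]
          by (intro has_vector_derivative_Pair has_vector_derivative_within_subset[OF \<gamma>' sub] has_vector_derivative_within_subset[OF V' sub])
        show "((\<lambda>s. (x s, v s)) has_vector_derivative (v r, - christoffel A g c (x r) (v r) (v r))) (at r within {t..s})"
          using near(1)[OF r]
          by (intro has_vector_derivative_Pair has_vector_derivative_within_subset[OF x sub] has_vector_derivative_within_subset[OF v sub])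
        define D where "D = norm ((chart_map c (\<gamma> r), V r c) - (x r, v r))"
        have D0: "D \<ge> 0" by (simp add: D_def)
        have D: "norm (chart_map c (\<gamma> r) - x r) \<le> D" "norm (V r c - v r) \<le> D"
          unfolding D_def using norm_fst_le[of "chart_map c (\<gamma> r) - x r" "V r c - v r"]
            norm_snd_le[of "V r c - v r" "chart_map c (\<gamma> r) - x r"] by auto
        have "norm (christoffel A g c (chart_map c (\<gamma> r)) (V r c) (V r c) - christoffel A g c (x r) (v r) (v r))
           \<le> L * (norm (V r c - v r) * (norm (V r c) + norm (v r)) + norm (chart_map c (\<gamma> r) - x r) * (norm (v r))\<^sup>2)"
          by (rule lip[OF dom(2)[OF r]]) (use ball[OF near(1)[OF r]] in auto)
        also have "\<dots> \<le> L * (D * (N + N) + D * N\<^sup>2)"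
          using D NV[OF r] Nv[OF r] L
          by (intro mult_left_mono add_mono mult_mono power_mono) (auto intro: D0)
        also have "\<dots> = K * D" by (simp add: K_def algebra_simps)
        finally have k: "norm (christoffel A g c (chart_map c (\<gamma> r)) (V r c) (V r c) - christoffel A g c (x r) (v r) (v r)) \<le> K * D" .
        have "norm ((V r c, - christoffel A g c (chart_map c (\<gamma> r)) (V r c) (V r c)) - (v r, - christoffel A g c (x r) (v r) (v r)))
          = norm (V r c - v r, christoffel A g c (x r) (v r) (v r) - christoffel A g c (chart_map c (\<gamma> r)) (V r c) (V r c))"
          by simp
        also have "\<dots> \<le> norm (V r c - v r) + norm (christoffel A g c (x r) (v r) (v r) - christoffel A g c (chart_map c (\<gamma> r)) (V r c) (V r c))"
          by (rule norm_Pair_le)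
        also have "\<dots> \<le> (1 + K) * D" using D(2) k by (simp add: norm_minus_commute distrib_right)
        finally show "norm ((V r c, - christoffel A g c (chart_map c (\<gamma> r)) (V r c) (V r c)) - (v r, - christoffel A g c (x r) (v r) (v r)))
          \<le> (1 + K) * norm ((chart_map c (\<gamma> r), V r c) - (x r, v r))" unfolding D_def .
      next
        show "(chart_map c (\<gamma> t), V t c) = (x t, v t)" using Pt img[OF tt] by simp
      qed
      moreover have "\<gamma> s = chart_inv c (chart_map c (\<gamma> s))" using dom(1)[of s] s c by simp
      ultimately show "P s" by (simp add: P_def)
    qed
    moreover have "u > t" using e1 e2 e3 by (simp add: u_def)
    ultimately show "\<exists>u>t. \<forall>s. t < s \<longrightarrow> s < u \<longrightarrow> s \<le> 1 \<longrightarrow> P s" by blast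
  qed (use t in auto)
  then show ?thesis by (simp add: P_def)
qed

text \<open>Resolves the definite description of the exponential map for small vectors, existence by
  solving in the chart and uniqueness among all geodesics of the manifold. The quadratic estimate
  says that exponential map and chart agree up to second order.\<close>

lemma riemannian_exp_in_chart:
  assumes c: "c \<in> charts_at A p"
  obtains \<eta> K where "\<eta> > 0" "K \<ge> 0" "\<And>\<xi>. \<xi> \<in> tangent_space A p \<Longrightarrow> norm (\<xi> c) < \<eta> \<Longrightarrow>
    \<exists>y\<in>chart_img c. riemannian_exp X A g p \<xi> = chart_inv c y \<and> norm (y - chart_map c p - \<xi> c) \<le> K * (norm (\<xi> c))\<^sup>2"
proof -
  have cA: "c \<in> A" and pc: "p \<in> chart_dom c" using c by (auto simp: charts_at_iff)
  define x0 where "x0 = chart_map c p"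
  have x0: "x0 \<in> chart_img c" unfolding x0_def by (rule chart_map_img[OF pc])
  have px0: "chart_inv c x0 = p" using cA pc by (simp add: x0_def)
  obtain R C L where R: "R > 0" "cball x0 R \<subseteq> chart_img c" "L \<ge> 0"
    "\<And>x v. x \<in> cball x0 R \<Longrightarrow> norm (christoffel A g c x v v) \<le> C * (norm v)\<^sup>2"
    and lip: "\<And>x y u v. x \<in> cball x0 R \<Longrightarrow> y \<in> cball x0 R \<Longrightarrow>
      norm (christoffel A g c x u u - christoffel A g c y v v)
        \<le> L * (norm (u - v) * (norm u + norm v) + norm (x - y) * (norm v)\<^sup>2)"
  proof (rule christoffel_locally_lipschitz[OF cA x0])
    fix R C L
    assume "R > 0" "cball x0 R \<subseteq> chart_img c" "L \<ge> 0"
    "\<And>x v. x \<in> cball x0 R \<Longrightarrow> norm (christoffel A g c x v v) \<le> C * (norm v)\<^sup>2"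
    "\<And>x y u v. x \<in> cball x0 R \<Longrightarrow> y \<in> cball x0 R \<Longrightarrow>
      norm (christoffel A g c x u u - christoffel A g c y v v)
        \<le> L * (norm (u - v) * (norm u + norm v) + norm (x - y) * (norm v)\<^sup>2)"
    then show thesis by (rule that)
  qed
  \<comment> \<open>Solutions are sought in the ball of half radius, so that they lie in the open
    ball required for uniqueness.\<close>
  have sub: "cball x0 (R/2) \<subseteq> cball x0 R" "cball x0 (R/2) \<subseteq> ball x0 R" using R(1) by auto
  obtain \<eta> K where \<eta>: "\<eta> > 0" and sol: "\<And>\<xi>. norm \<xi> < \<eta> \<Longrightarrow> \<exists>x v. x 0 = x0 \<and> v 0 = \<xi> \<and>
     (\<forall>t\<in>{0..1}. x t \<in> cball x0 (R/2) \<and> (x has_vector_derivative v t) (at t within {0..1}) \<and>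
        (v has_vector_derivative - christoffel A g c (x t) (v t) (v t)) (at t within {0..1})) \<and>
     norm (x 1 - x0 - \<xi>) \<le> K * (norm \<xi>)\<^sup>2"
  proof (rule second_order_ode_small_velocity[of "R/2" x0 "\<lambda>x v. - christoffel A g c x v v" C "4 * L"])
    show "- christoffel A g c x (s *\<^sub>R v) (s *\<^sub>R v) = s\<^sup>2 *\<^sub>R - christoffel A g c x v v" if "x \<in> cball x0 (R/2)" for x v s
    proof -
      have "x \<in> chart_img c" using that sub(1) R(2) by blast
      from christoffel_scaleR[OF cA this, of s v] show ?thesis by simp
    qed
    show "norm (- christoffel A g c x v v) \<le> C * (norm v)\<^sup>2" if "x \<in> cball x0 (R/2)" for x v
      using R(4)[of x v] that sub(1) by auto
    fix x y u v :: 'e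
    assume xy: "x \<in> cball x0 (R/2)" "y \<in> cball x0 (R/2)" and uv: "norm u \<le> 2" "norm v \<le> 2"
    have "norm (christoffel A g c x u u - christoffel A g c y v v)
        \<le> L * (norm (u - v) * (norm u + norm v) + norm (x - y) * (norm v)\<^sup>2)"
      using xy sub(1) by (intro lip) auto
    also have "\<dots> \<le> L * (norm (u - v) * (2 + 2) + norm (x - y) * 2\<^sup>2)"
      using R(3) uv by (intro mult_left_mono add_mono power_mono) auto
    finally show "norm (- christoffel A g c x u u - - christoffel A g c y v v) \<le> 4 * L * (norm (x - y) + norm (u - v))"
      by (simp add: norm_minus_commute algebra_simps)
  qed (use R in auto)
  show ?thesis
  proof (rule that[OF \<eta> abs_ge_zero[of K]])
    fix \<xi> assume \<xi>: "\<xi> \<in> tangent_space A p" "norm (\<xi> c) < \<eta>"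
    obtain x v where xv: "x 0 = x0" "v 0 = \<xi> c" "\<And>t. t \<in> {0..1} \<Longrightarrow> x t \<in> cball x0 (R/2)"
      "\<And>t. t \<in> {0..1} \<Longrightarrow> (x has_vector_derivative v t) (at t within {0..1})"
      "\<And>t. t \<in> {0..1} \<Longrightarrow> (v has_vector_derivative - christoffel A g c (x t) (v t) (v t)) (at t within {0..1})"
      and est: "norm (x 1 - x0 - \<xi> c) \<le> K * (norm (\<xi> c))\<^sup>2"
      using sol[OF \<xi>(2)] by blast
    have img: "x t \<in> chart_img c" if "t \<in> {0..1}" for t using xv(3)[OF that] sub(1) R(2) by blast
    have geo: "geodesic_on X A g {0..1} (\<lambda>t. chart_inv c (x t)) (\<lambda>t. tangent_lift A (chart_inv c (x t)) c (v t))"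
      by (rule geodesic_lift[OF cA img xv(4,5)])
    have "riemannian_exp X A g p \<xi> = chart_inv c (x 1)"
      unfolding riemannian_exp_def
    proof (rule the_equality)
      show "\<exists>\<gamma> V. geodesic_on X A g {0..1} \<gamma> V \<and> \<gamma> 0 = p \<and> V 0 = \<xi> \<and> \<gamma> 1 = chart_inv c (x 1)"
        using geo by (intro exI[of _ "\<lambda>t. chart_inv c (x t)"]
            exI[of _ "\<lambda>t. tangent_lift A (chart_inv c (x t)) c (v t)"] conjI)
          (auto simp: xv px0 tangent_lift_eq[OF c \<xi>(1)])
      fix q assume "\<exists>\<gamma> V. geodesic_on X A g {0..1} \<gamma> V \<and> \<gamma> 0 = p \<and> V 0 = \<xi> \<and> \<gamma> 1 = q"
      then obtain \<gamma> V where \<gamma>: "geodesic_on X A g {0..1} \<gamma> V" "\<gamma> 0 = p" "V 0 = \<xi>" "\<gamma> 1 = q" by blast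
      have "\<gamma> 1 = chart_inv c (x 1)"
      proof (rule geodesic_unique_in_chart[OF cA R(1-3) lip _ xv(4,5) \<gamma>(1)])
        show "x t \<in> ball x0 R" if "t \<in> {0..1}" for t using xv(3)[OF that] sub(2) by blast
      qed (auto simp: \<gamma> xv px0)
      then show "q = chart_inv c (x 1)" using \<gamma> by simp
    qed
    moreover have "norm (x 1 - x0 - \<xi> c) \<le> \<bar>K\<bar> * (norm (\<xi> c))\<^sup>2"
      using est by (smt (verit) abs_ge_self mult_right_mono zero_le_power2)
    ultimately show "\<exists>y\<in>chart_img c. riemannian_exp X A g p \<xi> = chart_inv c y \<and>
        norm (y - chart_map c p - \<xi> c) \<le> \<bar>K\<bar> * (norm (\<xi> c))\<^sup>2"
      using img[of 1] unfolding x0_def by (intro bexI[of _ "x 1"]) auto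
  qed
qed

text \<open>Replacing the chart by the exponential map moves the argument by a quadratic amount,
  which only enlarges the quadratic coefficient. The covector \<open>l\<close> becomes a tangent
  vector by Riesz representation in the metric at \<open>p\<close>.\<close>

lemma proximal_subgradient_from_chart:
  assumes c: "c \<in> charts_at A p" and fp: "f p = ereal r" and l: "bounded_linear l"
    and \<sigma>: "\<sigma> \<ge> 0" and \<eta>: "\<eta> > 0"
    and below: "\<And>w. norm w < \<eta> \<Longrightarrow> chart_map c p + w \<in> chart_img c \<Longrightarrow>
      ereal (r + l w - \<sigma> * (norm w)\<^sup>2) \<le> f (chart_inv c (chart_map c p + w))"
  obtains \<zeta> where "\<zeta> \<in> manifold_proximal_subdifferential X A g f p"
    "\<And>\<xi>. \<xi> \<in> tangent_space A p \<Longrightarrow> g p \<zeta> \<xi> = l (\<xi> c)"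
proof -
  have cA: "c \<in> A" and pc: "p \<in> chart_dom c" using c by (auto simp: charts_at_iff)
  have x0: "chart_map c p \<in> chart_img c" by (rule chart_map_img[OF pc])
  obtain m where m: "m > 0" "\<And>u. m * (norm u)\<^sup>2 \<le> blinfun_apply (blinfun_apply (metric_in c (chart_map c p)) u) u"
    using metric_in_coercive[OF cA x0] by blast
  obtain z where z: "\<And>w. blinfun_apply (blinfun_apply (metric_in c (chart_map c p)) z) w = l w"
    using coercive_form_representation[OF bounded_bilinear_blinfun_form metric_in_sym[OF cA x0] m l] by blast
  define \<zeta> where "\<zeta> = tangent_lift A p c z"
  have \<zeta>: "\<zeta> \<in> tangent_space A p" unfolding \<zeta>_def by (rule tangent_lift_in[OF c])
  have g\<zeta>: "g p \<zeta> \<xi> = l (\<xi> c)" if "\<xi> \<in> tangent_space A p" for \<xi>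
    unfolding local_metric_eq[OF c \<zeta> that] by (simp add: \<zeta>_def tangent_lift_chart[OF c] z)
  obtain \<eta>1 K where K: "\<eta>1 > 0" "K \<ge> 0" "\<And>\<xi>. \<xi> \<in> tangent_space A p \<Longrightarrow> norm (\<xi> c) < \<eta>1 \<Longrightarrow>
    \<exists>y\<in>chart_img c. riemannian_exp X A g p \<xi> = chart_inv c y \<and> norm (y - chart_map c p - \<xi> c) \<le> K * (norm (\<xi> c))\<^sup>2"
    using riemannian_exp_in_chart[OF c] by blast
  obtain Cl where Cl: "\<And>w. norm (l w) \<le> norm w * Cl" "Cl \<ge> 0" using bounded_linear.nonneg_bounded[OF l] by blast
  interpret l: bounded_linear l by fact
  have p: "p \<in> topspace X" by (rule charts_at_topspace[OF c])
  have exp0: "riemannian_exp X A g p 0 = p"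
  proof -
    obtain y where "riemannian_exp X A g p 0 = chart_inv c y" "norm (y - chart_map c p) \<le> 0"
      using K(3)[OF zero_tangent[OF p]] K(1) by (auto simp: zero_fun_def)
    then show ?thesis using cA pc by simp
  qed
  \<comment> \<open>The three bounds give, in turn, the estimate for the exponential map,
    \<open>K * norm u \<le> 1\<close> and thus \<open>norm w \<le> 2 * norm u\<close>, and
    \<open>norm w < \<eta>\<close>.\<close>
  define \<eta>2 where "\<eta>2 = min \<eta>1 (min (1 / (K + 1)) (\<eta> / 2))"
  have \<eta>2: "\<eta>2 > 0" "\<eta>2 \<le> \<eta>1" "\<eta>2 \<le> 1 / (K + 1)" "2 * \<eta>2 \<le> \<eta>"
    using K \<eta> by (auto simp: \<eta>2_def)
  \<comment> \<open>\<open>Cl * K\<close> pays for replacing \<open>l w\<close> by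
    \<open>l u\<close>, \<open>4 * \<sigma>\<close> for \<open>norm w \<le> 2 * norm u\<close>, and
    the 1 for strict positivity.\<close>
  define \<sigma>' where "\<sigma>' = Cl * K + 4 * \<sigma> + 1"
  have \<sigma>': "\<sigma>' > 0" using K Cl \<sigma> by (simp add: \<sigma>'_def add_nonneg_pos)
  have main: "(f \<circ> riemannian_exp X A g p) 0 + ereal (g p \<zeta> (\<xi> - 0) - \<sigma>' / m * (sqrt (g p (\<xi> - 0) (\<xi> - 0)))\<^sup>2)
        \<le> (f \<circ> riemannian_exp X A g p) \<xi>"
    if \<xi>: "\<xi> \<in> tangent_space A p" and small: "sqrt (g p (\<xi> - 0) (\<xi> - 0)) < \<eta>2 * sqrt m" for \<xi>
  proof -
    define u where "u = \<xi> c"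
    define w2 where "w2 = g p \<xi> \<xi>"
    have mu: "m * (norm u)\<^sup>2 \<le> w2"
      unfolding w2_def local_metric_eq[OF c \<xi> \<xi>] u_def by (rule m(2))
    have "sqrt m * norm u \<le> sqrt w2" using real_sqrt_le_mono[OF mu] by (simp add: real_sqrt_mult)
    also have "\<dots> < \<eta>2 * sqrt m" using small by (simp add: w2_def)
    finally have u: "norm u < \<eta>2" using m(1) by (simp add: mult.commute)
    obtain y where y: "y \<in> chart_img c" "riemannian_exp X A g p \<xi> = chart_inv c y"
      "norm (y - chart_map c p - u) \<le> K * (norm u)\<^sup>2"
      using K(3)[OF \<xi>] u \<eta>2 by (auto simp: u_def)
    define w where "w = y - chart_map c p"
    have yw: "y = chart_map c p + w" by (simp add: w_def)
    have wu: "norm (w - u) \<le> K * (norm u)\<^sup>2" using y(3) by (simp add: w_def)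
    have "K * norm u \<le> 1"
    proof -
      have "(K + 1) * norm u \<le> (K + 1) * (1 / (K + 1))" using u \<eta>2 K by (intro mult_left_mono) auto
      moreover have "(K + 1) * (1 / (K + 1)) = 1" using K(2) by simp
      ultimately show ?thesis using norm_ge_zero[of u] unfolding distrib_right by linarith
    qed
    from mult_right_mono[OF this norm_ge_zero[of u]]
    have "K * (norm u)\<^sup>2 \<le> norm u" by (simp add: power2_eq_square mult.assoc)
    then have w2u: "norm w \<le> 2 * norm u" using wu norm_triangle_sub[of w u] by linarith
    then have w\<eta>: "norm w < \<eta>" using u \<eta>2 by linarith
    have "ereal (r + l w - \<sigma> * (norm w)\<^sup>2) \<le> f (chart_inv c y)" using below[OF w\<eta>] y(1) by (simp add: yw)
    moreover have "l u - \<sigma>' / m * w2 \<le> l w - \<sigma> * (norm w)\<^sup>2"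
    proof -
      have "l u - l w \<le> norm (w - u) * Cl" using Cl(1)[of "u - w"] by (simp add: l.diff norm_minus_commute)
      also have "\<dots> \<le> (K * (norm u)\<^sup>2) * Cl" using wu Cl by (intro mult_right_mono) auto
      finally have 1: "l u - l w \<le> Cl * K * (norm u)\<^sup>2" by (simp add: mult_ac)
      have "\<sigma> * (norm w)\<^sup>2 \<le> \<sigma> * (2 * norm u)\<^sup>2" using w2u \<sigma> by (intro mult_left_mono power_mono) auto
      then have 2: "\<sigma> * (norm w)\<^sup>2 \<le> 4 * \<sigma> * (norm u)\<^sup>2" by (simp add: power_mult_distrib)
      have "\<sigma>' * (norm u)\<^sup>2 \<le> \<sigma>' / m * w2"
        using mult_left_mono[OF mu, of "\<sigma>' / m"] \<sigma>' m(1) by simp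
      moreover have "Cl * K * (norm u)\<^sup>2 + 4 * \<sigma> * (norm u)\<^sup>2 \<le> \<sigma>' * (norm u)\<^sup>2"
        unfolding \<sigma>'_def by (simp add: distrib_right)
      ultimately show ?thesis using 1 2 by linarith
    qed
    moreover have "w2 \<ge> 0" using mu m(1) by (smt (verit) mult_nonneg_nonneg zero_le_power2)
    ultimately show ?thesis
      using order_trans[of "ereal (r + (l u - \<sigma>' / m * w2))" "ereal (r + l w - \<sigma> * (norm w)\<^sup>2)" "f (chart_inv c y)"]
      by (simp add: exp0 fp y(2) g\<zeta>[OF \<xi>] u_def[symmetric] w2_def[symmetric])
  qed
  have "\<zeta> \<in> manifold_proximal_subdifferential X A g f p"
    unfolding manifold_proximal_subdifferential_def proximal_subdifferential_def
  proof (intro CollectI conjI \<zeta>)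
    show "(f \<circ> riemannian_exp X A g p) 0 < \<infinity>" by (simp add: exp0 fp)
    have "0 < \<sigma>' / m" "0 < \<eta>2 * sqrt m" using \<sigma>' m \<eta>2 by auto
    with main show "\<exists>\<sigma>>0. \<exists>\<eta>>0. \<forall>\<xi>\<in>tangent_space A p. sqrt (g p (\<xi> - 0) (\<xi> - 0)) < \<eta> \<longrightarrow>
        (f \<circ> riemannian_exp X A g p) 0 + ereal (g p \<zeta> (\<xi> - 0) - \<sigma> * (sqrt (g p (\<xi> - 0) (\<xi> - 0)))\<^sup>2)
        \<le> (f \<circ> riemannian_exp X A g p) \<xi>" by blast
  qed
  with g\<zeta> show ?thesis using that by blast
qed

end

section \<open>Curves and their length\<close>

text \<open>Subdivision lists recast as closure under concatenation on arbitrary intervals, so that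
  facts about lengths are proved by induction; \<open>piecewise_C1_curve_iff\<close> translates
  back.\<close>

inductive piecewise_C1_on ::
    "('m, 'e::real_normed_vector) chart set \<Rightarrow> (real \<Rightarrow> 'm) \<Rightarrow> real \<Rightarrow> real \<Rightarrow> bool" for A \<gamma> where
  refl: "piecewise_C1_on A \<gamma> a a"
| piece: "a < b \<Longrightarrow> C1_curve_on A {a..b} \<gamma> \<Longrightarrow> piecewise_C1_on A \<gamma> a b"
| join: "piecewise_C1_on A \<gamma> a b \<Longrightarrow> piecewise_C1_on A \<gamma> b c \<Longrightarrow> piecewise_C1_on A \<gamma> a c"

lemma piecewise_C1_on_le: "piecewise_C1_on A \<gamma> a b \<Longrightarrow> a \<le> b"
  by (induction rule: piecewise_C1_on.induct) auto

lemma subdivision_iff_successively: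
  fixes ts :: "real list"
  shows "sorted_wrt (<) ts \<and> (\<forall>i. Suc i < length ts \<longrightarrow> Q (ts ! i) (ts ! Suc i))
    \<longleftrightarrow> successively (\<lambda>x y. x < y \<and> Q x y) ts"
proof -
  have "sorted_wrt (<) ts \<longleftrightarrow> successively (<) ts"
    by (rule successively_iff_sorted_wrt_strong[symmetric]) simp
  then show ?thesis unfolding successively_conv_nth by blast
qed

lemma piecewise_C1_on_subdivision:
  "piecewise_C1_on A \<gamma> a b \<longleftrightarrow> (\<exists>ts. ts \<noteq> [] \<and> sorted_wrt (<) ts \<and> hd ts = a \<and> last ts = b \<and>
     (\<forall>i. Suc i < length ts \<longrightarrow> C1_curve_on A {ts ! i .. ts ! Suc i} \<gamma>))"
proof -
  define Q where "Q x y \<longleftrightarrow> x < y \<and> C1_curve_on A {x..y} \<gamma>" for x y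
  have to_list: "\<exists>ts. ts \<noteq> [] \<and> hd ts = a \<and> last ts = b \<and> successively Q ts" if "piecewise_C1_on A \<gamma> a b"
    using that
  proof induction
    case (refl a)
    then show ?case by (intro exI[of _ "[a]"]) auto
  next
    case (piece a b)
    then show ?case by (intro exI[of _ "[a, b]"]) (auto simp: Q_def)
  next
    case (join a b c)
    then obtain us vs where us: "us \<noteq> []" "hd us = a" "last us = b" "successively Q us"
      and vs: "vs \<noteq> []" "hd vs = b" "last vs = c" "successively Q vs" by blast
    \<comment> \<open>The junction point ends one list and begins the other, so it is dropped
      once.\<close>
    obtain ws where ws: "vs = b # ws" using vs by (cases vs) auto
    show ?case
    proof (cases "ws = []")
      case True
      then show ?thesis using us vs ws by auto
    next
      case False
      then have "successively Q ws" "Q b (hd ws)" using vs(4) unfolding ws by (cases ws; simp)+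
      then show ?thesis using us vs(3) False ws
        by (intro exI[of _ "us @ ws"]) (auto simp: successively_append_iff)
    qed
  qed
  have of_list: "piecewise_C1_on A \<gamma> (hd ts) (last ts)" if "ts \<noteq> []" "successively Q ts" for ts
    using that
  proof (induction ts rule: induct_list012)
    case (3 x y zs)
    then have "Q x y" "piecewise_C1_on A \<gamma> y (last (y # zs))" by auto
    then show ?case using piecewise_C1_on.join[OF piecewise_C1_on.piece] by (auto simp: Q_def)
  qed (auto intro: piecewise_C1_on.refl)
  have "piecewise_C1_on A \<gamma> a b \<longleftrightarrow> (\<exists>ts. ts \<noteq> [] \<and> hd ts = a \<and> last ts = b \<and> successively Q ts)"
    using to_list of_list by (intro iffI) (erule to_list, elim exE conjE, hypsubst, rule of_list)
  then show ?thesis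
    unfolding Q_def subdivision_iff_successively[where Q = "\<lambda>x y. C1_curve_on A {x..y} \<gamma>", symmetric] by blast
qed

lemma piecewise_C1_curve_iff:
  "piecewise_C1_curve X A \<gamma> \<longleftrightarrow> continuous_map (top_of_set {0..1}) X \<gamma> \<and> piecewise_C1_on A \<gamma> 0 1"
  unfolding piecewise_C1_curve_def piecewise_C1_on_subdivision by blast

lemma has_velocity_subset: "has_velocity A \<gamma> J t \<xi> \<Longrightarrow> J' \<subseteq> J \<Longrightarrow> has_velocity A \<gamma> J' t \<xi>"
  unfolding has_velocity_def by (blast intro: has_vector_derivative_within_subset)

lemma has_velocity_interior: "t \<in> interior J \<Longrightarrow> has_velocity A \<gamma> J t = has_velocity A \<gamma> UNIV t"
  by (intro ext) (simp only: has_velocity_def at_within_interior[of t J])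

lemma has_velocity_cong:
  assumes "\<And>s. s \<in> J \<Longrightarrow> \<gamma> s = \<gamma>' s" "t \<in> J"
  shows "has_velocity A \<gamma> J t \<xi> \<longleftrightarrow> has_velocity A \<gamma>' J t \<xi>"
proof -
  have "((chart_map c \<circ> \<gamma>) has_vector_derivative v) (at t within J) \<longleftrightarrow>
      ((chart_map c \<circ> \<gamma>') has_vector_derivative v) (at t within J)" for c :: "('a, 'b) chart" and v
    using has_vector_derivative_transform[OF assms(2), of "chart_map c \<circ> \<gamma>'" "chart_map c \<circ> \<gamma>" v]
      has_vector_derivative_transform[OF assms(2), of "chart_map c \<circ> \<gamma>" "chart_map c \<circ> \<gamma>'" v] assms(1)
    by fastforce
  then show ?thesis unfolding has_velocity_def assms(1)[OF assms(2)] by simp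
qed

lemma C1_curve_on_cong:
  assumes "\<And>s. s \<in> J \<Longrightarrow> \<gamma> s = \<gamma>' s"
  shows "C1_curve_on A J \<gamma> \<longleftrightarrow> C1_curve_on A J \<gamma>'"
  unfolding C1_curve_on_def
  by (intro ex_cong1 ball_cong refl arg_cong2[of _ _ _ _ "(\<and>)"] has_velocity_cong[OF assms])
    (simp_all add: assms)

lemma piecewise_C1_on_cong:
  assumes "piecewise_C1_on A \<gamma> a b" "\<And>s. a \<le> s \<Longrightarrow> s \<le> b \<Longrightarrow> \<gamma> s = \<gamma>' s"
  shows "piecewise_C1_on A \<gamma>' a b"
  using assms
proof induction
  case (piece a b)
  then show ?case using C1_curve_on_cong[of "{a..b}" \<gamma> \<gamma>' A] by (auto intro: piecewise_C1_on.piece)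
next
  case (join a b c)
  then show ?case using piecewise_C1_on_le[OF join(1)] piecewise_C1_on_le[OF join(2)]
    by (intro piecewise_C1_on.join[of _ _ a b c]) auto
qed (rule piecewise_C1_on.refl)

lemma C1_curve_on_subset:
  assumes "C1_curve_on A J \<gamma>" "J' \<subseteq> J"
  shows "C1_curve_on A J' \<gamma>"
proof -
  obtain V where V: "\<And>t. t \<in> J \<Longrightarrow> has_velocity A \<gamma> J t (V t)"
    "\<And>t c. t \<in> J \<Longrightarrow> c \<in> charts_at A (\<gamma> t) \<Longrightarrow> continuous (at t within J) (\<lambda>s. V s c)"
    using assms(1) unfolding C1_curve_on_def by blast
  show ?thesis
    unfolding C1_curve_on_def
    by (intro exI[of _ V] ballI conjI has_velocity_subset[OF V(1) assms(2)] continuous_within_subset[OF V(2) assms(2)])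
      (use assms(2) in auto)
qed

lemma piecewise_C1_on_sub:
  assumes "piecewise_C1_on A \<gamma> a b" "a \<le> s" "s \<le> t" "t \<le> b"
  shows "piecewise_C1_on A \<gamma> s t"
  using assms
proof (induction arbitrary: s t)
  case (refl a)
  then have "s = t" by simp
  then show ?case by (simp add: piecewise_C1_on.refl)
next
  case (piece a b)
  show ?case
  proof (cases "s = t")
    case False
    then show ?thesis using piece by (intro piecewise_C1_on.piece C1_curve_on_subset[OF piece(2)]) auto
  qed (auto intro: piecewise_C1_on.refl)
next
  case (join a b c)
  consider "t \<le> b" | "b \<le> s" | "s \<le> b" "b \<le> t" by linarith
  then show ?case
  proof cases
    case 3
    show ?thesis
      by (rule piecewise_C1_on.join[of _ _ s b t]) (use join 3 piecewise_C1_on_le in auto)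
  qed (use join in auto)
qed

section \<open>Reparametrisation and velocities of piecewise C1 curves\<close>

context hilbert_manifold
begin

lemma has_velocity_affine:
  assumes "has_velocity A \<gamma> J (m * t + k) \<xi>" and sub: "(\<lambda>t. m * t + k) ` J' \<subseteq> J"
  shows "has_velocity A (\<lambda>t. \<gamma> (m * t + k)) J' t (\<lambda>c. m *\<^sub>R \<xi> c)"
  unfolding has_velocity_def
proof (intro conjI ballI)
  show "(\<lambda>c. m *\<^sub>R \<xi> c) \<in> tangent_space A (\<gamma> (m * t + k))"
    using assms(1) by (intro tangent_space_scaleR) (simp add: has_velocity_def)
  fix c assume c: "c \<in> charts_at A (\<gamma> (m * t + k))"
  then have "((chart_map c \<circ> \<gamma>) has_vector_derivative \<xi> c) (at (m * t + k) within J)"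
    using assms(1) by (simp add: has_velocity_def)
  then have "((chart_map c \<circ> \<gamma>) has_vector_derivative \<xi> c) (at (m * t + k) within (\<lambda>t. m * t + k) ` J')"
    by (rule has_vector_derivative_within_subset[OF _ sub])
  moreover have "((\<lambda>t. m * t + k) has_vector_derivative m) (at t within J')"
    by (auto intro!: derivative_eq_intros)
  ultimately have "((chart_map c \<circ> \<gamma> \<circ> (\<lambda>t. m * t + k)) has_vector_derivative m *\<^sub>R \<xi> c) (at t within J')"
    using vector_diff_chain_within[of "\<lambda>t. m * t + k" m t J' "chart_map c \<circ> \<gamma>" "\<xi> c"] by simp
  then show "((chart_map c \<circ> (\<lambda>t. \<gamma> (m * t + k))) has_vector_derivative m *\<^sub>R \<xi> c) (at t within J')"
    by (simp add: o_def)
qed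

lemma C1_curve_on_affine:
  assumes "C1_curve_on A J \<gamma>" and sub: "(\<lambda>t. m * t + k) ` J' \<subseteq> J"
  shows "C1_curve_on A J' (\<lambda>t. \<gamma> (m * t + k))"
proof -
  obtain V where V: "\<And>t. t \<in> J \<Longrightarrow> has_velocity A \<gamma> J t (V t)"
    "\<And>t c. t \<in> J \<Longrightarrow> c \<in> charts_at A (\<gamma> t) \<Longrightarrow> continuous (at t within J) (\<lambda>s. V s c)"
    using assms(1) unfolding C1_curve_on_def by blast
  have "continuous (at t within J') (\<lambda>s. m *\<^sub>R V (m * s + k) c)"
    if "t \<in> J'" "c \<in> charts_at A (\<gamma> (m * t + k))" for t c
  proof -
    have "continuous (at (m * t + k) within J) (\<lambda>s. V s c)"
      using sub that(1) by (intro V(2)[OF _ that(2)]) auto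
    then have "continuous (at (m * t + k) within (\<lambda>t. m * t + k) ` J') (\<lambda>s. V s c)"
      by (rule continuous_within_subset[OF _ sub])
    moreover have "continuous (at t within J') (\<lambda>t. m * t + k)" by (intro continuous_intros)
    ultimately have "continuous (at t within J') ((\<lambda>s. V s c) \<circ> (\<lambda>t. m * t + k))"
      by (intro continuous_within_compose)
    then show ?thesis by (intro continuous_intros) (simp add: o_def)
  qed
  moreover have "has_velocity A (\<lambda>t. \<gamma> (m * t + k)) J' t (\<lambda>c. m *\<^sub>R V (m * t + k) c)" if "t \<in> J'" for t
    using that sub by (intro has_velocity_affine[OF V(1) sub]) auto
  ultimately show ?thesis
    unfolding C1_curve_on_def by (intro exI[of _ "\<lambda>t c. m *\<^sub>R V (m * t + k) c"]) blast
qed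

lemma piecewise_C1_on_affine:
  assumes "piecewise_C1_on A \<gamma> a b" and m: "m > 0"
  shows "piecewise_C1_on A (\<lambda>t. \<gamma> (m * t + k)) ((a - k) / m) ((b - k) / m)"
  using assms(1)
proof induction
  case (piece a b)
  have "(\<lambda>t. m * t + k) ` {(a - k) / m..(b - k) / m} \<subseteq> {a..b}" using m by (auto simp: field_simps)
  then show ?case using m piece
    by (intro piecewise_C1_on.piece C1_curve_on_affine[OF piece(2)]) (auto simp: divide_strict_right_mono)
qed (auto intro: piecewise_C1_on.intros)

lemma piecewise_C1_on_reverse:
  assumes "piecewise_C1_on A \<gamma> a b"
  shows "piecewise_C1_on A (\<lambda>t. \<gamma> (-1 * t + k)) (k - b) (k - a)"
  using assms
proof induction
  case (piece a b)
  have "(\<lambda>t. -1 * t + k) ` {k - b..k - a} \<subseteq> {a..b}" by auto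
  then show ?case using piece by (intro piecewise_C1_on.piece C1_curve_on_affine[OF piece(2)]) auto
qed (auto intro: piecewise_C1_on.intros)

lemma velocity_unique:
  assumes "has_velocity A \<gamma> UNIV t \<xi>" "has_velocity A \<gamma> UNIV t \<zeta>"
  shows "\<xi> = \<zeta>"
proof
  fix c show "\<xi> c = \<zeta> c"
  proof (cases "c \<in> charts_at A (\<gamma> t)")
    case True
    then show ?thesis using assms vector_derivative_unique_at unfolding has_velocity_def by blast
  next
    case False
    then show ?thesis using assms tangent_outside unfolding has_velocity_def by metis
  qed
qed

text \<open>Two-sided velocities can fail only at breakpoints and ends; finitely many times do not
  affect a length.\<close>

lemma piecewise_C1_on_velocity:
  assumes "piecewise_C1_on A \<gamma> a b"
  obtains F where "finite F" "\<And>t. t \<in> {a..b} - F \<Longrightarrow> \<exists>\<xi>. has_velocity A \<gamma> UNIV t \<xi>"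
proof -
  have "\<exists>F. finite F \<and> (\<forall>t\<in>{a..b} - F. \<exists>\<xi>. has_velocity A \<gamma> UNIV t \<xi>)"
    using assms
  proof induction
    case (refl a)
    then show ?case by (intro exI[of _ "{a}"]) auto
  next
    case (piece a b)
    have "\<exists>\<xi>. has_velocity A \<gamma> UNIV t \<xi>" if "t \<in> {a..b} - {a, b}" for t
    proof -
      have "t \<in> interior {a..b}" using that by auto
      from has_velocity_interior[OF this, of A \<gamma>] show ?thesis
        using piece(2) that unfolding C1_curve_on_def by (metis DiffD1)
    qed
    then show ?case by (intro exI[of _ "{a, b}"]) auto
  next
    case (join a b c)
    then obtain F F' where F: "finite F" "finite F'"
      "\<forall>t\<in>{a..b} - F. \<exists>\<xi>. has_velocity A \<gamma> UNIV t \<xi>" "\<forall>t\<in>{b..c} - F'. \<exists>\<xi>. has_velocity A \<gamma> UNIV t \<xi>" by blast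
    have "\<forall>t\<in>{a..c} - (F \<union> F'). \<exists>\<xi>. has_velocity A \<gamma> UNIV t \<xi>"
    proof
      fix t assume "t \<in> {a..c} - (F \<union> F')"
      then show "\<exists>\<xi>. has_velocity A \<gamma> UNIV t \<xi>" using F(3,4) by (cases "t \<le> b") auto
    qed
    with F(1,2) show ?case by blast
  qed
  then show ?thesis using that by blast
qed

lemma C1_curve_lift:
  assumes c: "c \<in> A" and img: "\<And>t. t \<in> J \<Longrightarrow> x t \<in> chart_img c"
    and x: "\<And>t. t \<in> J \<Longrightarrow> (x has_vector_derivative x' t) (at t within J)"
    and x': "continuous_on J x'"
  shows "C1_curve_on A J (\<lambda>t. chart_inv c (x t))"
  unfolding C1_curve_on_def
proof (intro exI[of _ "\<lambda>t. tangent_lift A (chart_inv c (x t)) c (x' t)"] ballI conjI)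
  fix t assume t: "t \<in> J"
  show "has_velocity A (\<lambda>t. chart_inv c (x t)) J t (tangent_lift A (chart_inv c (x t)) c (x' t))"
    by (rule has_velocity_lift[OF c t img x[OF t]])
  fix d assume d: "d \<in> charts_at A (chart_inv c (x t))"
  then have dA: "d \<in> A" and xt: "x t \<in> overlap c d" using img[OF t] by (auto simp: charts_at_iff overlap_def)
  obtain T T2 where T: "\<And>x. x \<in> overlap c d \<Longrightarrow> (transition c d has_derivative blinfun_apply (T x)) (at x)"
    "\<And>x. x \<in> overlap c d \<Longrightarrow> (T has_derivative blinfun_apply (T2 x)) (at x)"
    "\<And>x. x \<in> overlap c d \<Longrightarrow> frechet_derivative (transition c d) (at x) = blinfun_apply (T x)"
    "\<And>x u v. x \<in> overlap c d \<Longrightarrow> blinfun_apply (blinfun_apply (T2 x) u) v = blinfun_apply (blinfun_apply (T2 x) v) u"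
    using transition_C2[OF c dA] by blast
  have cont: "continuous_on J x"
    using x by (meson continuous_on_eq_continuous_within has_vector_derivative_continuous)
  obtain e where e: "e > 0" "\<And>s. s \<in> J \<Longrightarrow> dist s t < e \<Longrightarrow> x s \<in> overlap c d"
    using continuous_map_real_nhd[of J euclidean x t "overlap c d"] cont t xt open_overlap[OF c dA] by auto
  have "isCont T (x t)" by (rule has_derivative_continuous[OF T(2)[OF xt]])
  then have "((\<lambda>s. T (x s)) \<longlongrightarrow> T (x t)) (at t within J)"
    by (rule isCont_tendsto_compose) (use has_vector_derivative_continuous[OF x[OF t]] in \<open>simp add: continuous_within\<close>)
  then have lim: "((\<lambda>s. blinfun_apply (T (x s)) (x' s)) \<longlongrightarrow> blinfun_apply (T (x t)) (x' t)) (at t within J)"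
    using x' t by (intro blinfun.tendsto) (auto simp: continuous_on_def)
  have lift: "tangent_lift A (chart_inv c (x s)) c (x' s) d = blinfun_apply (T (x s)) (x' s)"
    if "s \<in> J" "x s \<in> overlap c d" for s
    using that dA T(3)[OF that(2)] img by (simp add: tangent_lift_def charts_at_iff overlap_def)
  show "continuous (at t within J) (\<lambda>s. tangent_lift A (chart_inv c (x s)) c (x' s) d)"
    unfolding continuous_within lift[OF t xt]
    by (rule Lim_transform_within[OF lim e(1)]) (use lift e(2) in auto)
qed

end

section \<open>Speed, length and displacement\<close>

context riemannian_manifold
begin

lemma metric_nonneg:
  assumes "p \<in> topspace X" "\<xi> \<in> tangent_space A p"
  shows "0 \<le> g p \<xi> \<xi>"
proof -
  obtain c where c: "c \<in> charts_at A p" using charts_at_nonempty[OF assms(1)] by blast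
  obtain m where "m > 0" "\<forall>\<xi>\<in>tangent_space A p. m * (norm (\<xi> c))\<^sup>2 \<le> g p \<xi> \<xi>"
    using coercive[OF c] by auto
  then show ?thesis using assms(2) by (smt (verit) mult_nonneg_nonneg zero_le_power2)
qed

text \<open>Uses the two-sided velocity, so it does not refer to an interval and restricts and
  concatenates freely. At breakpoints the description may be arbitrary; the integral ignores these
  finitely many values.\<close>

definition speed :: "(real \<Rightarrow> 'm) \<Rightarrow> real \<Rightarrow> real" where
  "speed \<gamma> t = tangent_norm g (\<gamma> t) (THE \<xi>. has_velocity A \<gamma> UNIV t \<xi>)"

lemma speed_eq: "has_velocity A \<gamma> UNIV t \<xi> \<Longrightarrow> speed \<gamma> t = tangent_norm g (\<gamma> t) \<xi>"
  unfolding speed_def using velocity_unique[of \<gamma> t] by (metis the_equality)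

lemma speed_cong:
  assumes "open S" "t \<in> S" "\<And>s. s \<in> S \<Longrightarrow> \<gamma> s = \<gamma>' s"
  shows "speed \<gamma> t = speed \<gamma>' t"
proof -
  have "has_velocity A \<gamma> S t \<xi> \<longleftrightarrow> has_velocity A \<gamma>' S t \<xi>" for \<xi>
    by (rule has_velocity_cong) (use assms in auto)
  then have "has_velocity A \<gamma> UNIV t = has_velocity A \<gamma>' UNIV t"
    using has_velocity_interior[of t S A] assms by (simp add: interior_open fun_eq_iff)
  then show ?thesis using assms by (simp add: speed_def)
qed

lemma curve_length_eq: "curve_length A g \<gamma> = integral {0..1} (speed \<gamma>)"
  unfolding curve_length_def
proof (rule integral_spike[of "{0, 1}"])
  fix t :: real assume "t \<in> {0..1} - {0, 1}"
  then have "t \<in> interior {0..1}" by auto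
  then show "speed \<gamma> t = tangent_norm g (\<gamma> t) (THE \<xi>. has_velocity A \<gamma> {0..1} t \<xi>)"
    by (simp only: speed_def has_velocity_interior[OF \<open>t \<in> interior {0..1}\<close>])
qed simp

text \<open>The one-sided velocities at the ends complete the speed to a continuous function on the
  closed piece. Continuity is checked in a chart around each time, since no single chart need
  contain the piece.\<close>

lemma C1_curve_speed:
  assumes \<gamma>: "C1_curve_on A {a..b} \<gamma>" and cont: "continuous_map (top_of_set {a..b}) X \<gamma>"
  obtains V where "\<And>t. t \<in> {a..b} \<Longrightarrow> has_velocity A \<gamma> {a..b} t (V t)"
    "continuous_on {a..b} (\<lambda>t. tangent_norm g (\<gamma> t) (V t))"
    "\<And>t. t \<in> {a..b} \<Longrightarrow> 0 \<le> tangent_norm g (\<gamma> t) (V t)"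
    "\<And>t. t \<in> {a..b} - {a, b} \<Longrightarrow> speed \<gamma> t = tangent_norm g (\<gamma> t) (V t)"
proof -
  obtain V where V: "\<And>t. t \<in> {a..b} \<Longrightarrow> has_velocity A \<gamma> {a..b} t (V t)"
    "\<And>t c. t \<in> {a..b} \<Longrightarrow> c \<in> charts_at A (\<gamma> t) \<Longrightarrow> continuous (at t within {a..b}) (\<lambda>s. V s c)"
    using \<gamma> unfolding C1_curve_on_def by blast
  have top: "\<gamma> t \<in> topspace X" if "t \<in> {a..b}" for t
    using continuous_map_image_subset_topspace[OF cont] that by auto
  have VT: "V t \<in> tangent_space A (\<gamma> t)" if "t \<in> {a..b}" for t using V(1)[OF that] by (simp add: has_velocity_def)
  have "continuous (at t within {a..b}) (\<lambda>t. tangent_norm g (\<gamma> t) (V t))" if t: "t \<in> {a..b}" for t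
  proof -
    obtain c where c: "c \<in> charts_at A (\<gamma> t)" using charts_at_nonempty[OF top[OF t]] by blast
    then have cA: "c \<in> A" and ct: "\<gamma> t \<in> chart_dom c" by (auto simp: charts_at_iff)
    obtain e where e: "e > 0" "\<And>s. s \<in> {a..b} \<Longrightarrow> dist s t < e \<Longrightarrow> \<gamma> s \<in> chart_dom c"
      using continuous_map_real_nhd[OF cont t open_dom[OF cA] ct] by blast
    obtain G' where "(metric_in c has_derivative blinfun_apply (G' (chart_map c (\<gamma> t)))) (at (chart_map c (\<gamma> t)))"
      using metric_in_C2[OF cA] chart_map_img[OF ct] by metis
    then have "isCont (metric_in c) (chart_map c (\<gamma> t))" by (rule has_derivative_continuous)
    moreover have "((\<lambda>s. chart_map c (\<gamma> s)) \<longlongrightarrow> chart_map c (\<gamma> t)) (at t within {a..b})"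
    proof -
      have "((chart_map c \<circ> \<gamma>) has_vector_derivative V t c) (at t within {a..b})"
        using V(1)[OF t] c by (simp add: has_velocity_def)
      from has_vector_derivative_continuous[OF this] show ?thesis by (simp add: continuous_within o_def)
    qed
    ultimately have G: "((\<lambda>s. metric_in c (chart_map c (\<gamma> s))) \<longlongrightarrow> metric_in c (chart_map c (\<gamma> t))) (at t within {a..b})"
      by (rule isCont_tendsto_compose)
    have Vc: "((\<lambda>s. V s c) \<longlongrightarrow> V t c) (at t within {a..b})" using V(2)[OF t c] by (simp add: continuous_within)
    have lim: "((\<lambda>s. sqrt (blinfun_apply (blinfun_apply (metric_in c (chart_map c (\<gamma> s))) (V s c)) (V s c)))
       \<longlongrightarrow> sqrt (blinfun_apply (blinfun_apply (metric_in c (chart_map c (\<gamma> t))) (V t c)) (V t c))) (at t within {a..b})"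
      by (intro tendsto_real_sqrt blinfun.tendsto G Vc)
    have eq: "tangent_norm g (\<gamma> s) (V s) = sqrt (blinfun_apply (blinfun_apply (metric_in c (chart_map c (\<gamma> s))) (V s c)) (V s c))"
      if "s \<in> {a..b}" "\<gamma> s \<in> chart_dom c" for s
      using local_metric_eq[of c "\<gamma> s", OF _ VT VT] that cA by (simp add: tangent_norm_def charts_at_iff)
    show ?thesis
      unfolding continuous_within eq[OF t ct]
      by (rule Lim_transform_within[OF lim e(1)]) (use eq e(2) in auto)
  qed
  then have "continuous_on {a..b} (\<lambda>t. tangent_norm g (\<gamma> t) (V t))" by (simp add: continuous_on_eq_continuous_within)
  moreover have "0 \<le> tangent_norm g (\<gamma> t) (V t)" if "t \<in> {a..b}" for t
    using metric_nonneg[OF top[OF that] VT[OF that]] by (simp add: tangent_norm_def)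
  moreover have "speed \<gamma> t = tangent_norm g (\<gamma> t) (V t)" if "t \<in> {a..b} - {a, b}" for t
  proof (rule speed_eq)
    have "t \<in> interior {a..b}" using that by auto
    from has_velocity_interior[OF this, of A \<gamma>] show "has_velocity A \<gamma> UNIV t (V t)" using V(1)[of t] that by simp
  qed
  ultimately show ?thesis using V(1) that by blast
qed

definition admissible_curve :: "(real \<Rightarrow> 'm) \<Rightarrow> real \<Rightarrow> real \<Rightarrow> bool" where
  "admissible_curve \<gamma> a b \<longleftrightarrow> continuous_map (top_of_set {a..b}) X \<gamma> \<and> piecewise_C1_on A \<gamma> a b"

lemma continuous_map_Icc_subset:
  "continuous_map (top_of_set {a..b::real}) X \<gamma> \<Longrightarrow> a \<le> s \<Longrightarrow> t \<le> b \<Longrightarrow> continuous_map (top_of_set {s..t}) X \<gamma>"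
  using continuous_map_from_subtopology_mono[of euclidean "{a..b}" X \<gamma> "{s..t}"] by auto

lemma admissible_curve_sub: "admissible_curve \<gamma> a b \<Longrightarrow> a \<le> s \<Longrightarrow> s \<le> t \<Longrightarrow> t \<le> b \<Longrightarrow> admissible_curve \<gamma> s t"
  unfolding admissible_curve_def using continuous_map_Icc_subset piecewise_C1_on_sub by blast

lemma admissible_curve_speed_integrable:
  assumes "admissible_curve \<gamma> a b"
  shows "speed \<gamma> integrable_on {a..b}" "0 \<le> integral {a..b} (speed \<gamma>)"
proof -
  have "speed \<gamma> integrable_on {a..b} \<and> 0 \<le> integral {a..b} (speed \<gamma>)"
    if "piecewise_C1_on A \<gamma> a b" "continuous_map (top_of_set {a..b}) X \<gamma>"
    using that
  proof induction
    case (piece a b)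
    obtain V where V: "continuous_on {a..b} (\<lambda>t. tangent_norm g (\<gamma> t) (V t))"
      "\<And>t. t \<in> {a..b} \<Longrightarrow> 0 \<le> tangent_norm g (\<gamma> t) (V t)"
      "\<And>t. t \<in> {a..b} - {a, b} \<Longrightarrow> speed \<gamma> t = tangent_norm g (\<gamma> t) (V t)"
      using C1_curve_speed[OF piece(2,3)] by metis
    have "(\<lambda>t. tangent_norm g (\<gamma> t) (V t)) integrable_on {a..b}" by (rule integrable_continuous_real[OF V(1)])
    then have "speed \<gamma> integrable_on {a..b}" by (rule integrable_spike_finite[of "{a, b}", rotated 2]) (use V(3) in auto)
    moreover have "integral {a..b} (speed \<gamma>) = integral {a..b} (\<lambda>t. tangent_norm g (\<gamma> t) (V t))"
      by (rule integral_spike[of "{a, b}"]) (use V(3) in auto)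
    moreover have "0 \<le> integral {a..b} (\<lambda>t. tangent_norm g (\<gamma> t) (V t))"
      by (rule integral_nonneg[OF integrable_continuous_real[OF V(1)] V(2)])
    ultimately show ?case by simp
  next
    case (join a b c)
    note le = piecewise_C1_on_le[OF join(1)] piecewise_C1_on_le[OF join(2)]
    have 1: "speed \<gamma> integrable_on {a..b} \<and> 0 \<le> integral {a..b} (speed \<gamma>)"
      and 2: "speed \<gamma> integrable_on {b..c} \<and> 0 \<le> integral {b..c} (speed \<gamma>)"
      using join continuous_map_Icc_subset[OF join(5)] le by auto
    then have "speed \<gamma> integrable_on {a..c}" using Henstock_Kurzweil_Integration.integrable_combine le by blast
    then show ?case using 1 2 Henstock_Kurzweil_Integration.integral_combine[OF le] by fastforce
  next
    case (refl a)
    show ?case using integrable_on_refl[of "speed \<gamma>" a] by (simp add: cbox_interval)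
  qed
  then show "speed \<gamma> integrable_on {a..b}" "0 \<le> integral {a..b} (speed \<gamma>)" using assms by (auto simp: admissible_curve_def)
qed

lemma admissible_curve_length_combine:
  assumes "admissible_curve \<gamma> a c" "a \<le> b" "b \<le> c"
  shows "integral {a..b} (speed \<gamma>) + integral {b..c} (speed \<gamma>) = integral {a..c} (speed \<gamma>)"
  by (rule Henstock_Kurzweil_Integration.integral_combine[OF assms(2,3) admissible_curve_speed_integrable(1)[OF assms(1)]])

lemma admissible_curve_length_mono:
  assumes "admissible_curve \<gamma> a b" "a \<le> s" "s \<le> t" "t \<le> b"
  shows "integral {s..t} (speed \<gamma>) \<le> integral {a..b} (speed \<gamma>)"
proof -
  have "integral {a..s} (speed \<gamma>) + integral {s..b} (speed \<gamma>) = integral {a..b} (speed \<gamma>)"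
    "integral {s..t} (speed \<gamma>) + integral {t..b} (speed \<gamma>) = integral {s..b} (speed \<gamma>)"
    using assms by (auto intro!: admissible_curve_length_combine admissible_curve_sub[OF assms(1)])
  moreover have "0 \<le> integral {a..s} (speed \<gamma>)" "0 \<le> integral {t..b} (speed \<gamma>)"
    using assms by (auto intro!: admissible_curve_speed_integrable admissible_curve_sub[OF assms(1)])
  ultimately show ?thesis by linarith
qed

text \<open>On one piece the displacement \<open>u\<close> is paired with itself:
  \<open>u \<bullet> u\<close> is the integral of velocity times \<open>u\<close>, at most
  \<open>C * norm u\<close> times the length. Only real functions are integrated this way.\<close>

lemma chart_displacement:
  assumes arc: "admissible_curve \<gamma> a b" and c: "c \<in> A" and C: "C \<ge> 0"
    and bound: "\<And>z u. z \<in> S \<Longrightarrow> norm u \<le> C * sqrt (blinfun_apply (blinfun_apply (metric_in c z) u) u)"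
    and S: "\<And>t. t \<in> {a..b} \<Longrightarrow> \<gamma> t \<in> chart_dom c \<and> chart_map c (\<gamma> t) \<in> S"
  shows "norm (chart_map c (\<gamma> b) - chart_map c (\<gamma> a)) \<le> C * integral {a..b} (speed \<gamma>)"
proof -
  have "norm (chart_map c (\<gamma> b) - chart_map c (\<gamma> a)) \<le> C * integral {a..b} (speed \<gamma>)"
    if "piecewise_C1_on A \<gamma> a b" "continuous_map (top_of_set {a..b}) X \<gamma>"
      "\<And>t. t \<in> {a..b} \<Longrightarrow> \<gamma> t \<in> chart_dom c \<and> chart_map c (\<gamma> t) \<in> S"
    using that
  proof induction
    case (piece a b)
    obtain V where V: "\<And>t. t \<in> {a..b} \<Longrightarrow> has_velocity A \<gamma> {a..b} t (V t)"
      "continuous_on {a..b} (\<lambda>t. tangent_norm g (\<gamma> t) (V t))"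
      "\<And>t. t \<in> {a..b} - {a, b} \<Longrightarrow> speed \<gamma> t = tangent_norm g (\<gamma> t) (V t)"
      using C1_curve_speed[OF piece(2,3)] by metis
    define sp where "sp t = tangent_norm g (\<gamma> t) (V t)" for t
    have int_sp: "sp integrable_on {a..b}" unfolding sp_def by (rule integrable_continuous_real[OF V(2)])
    have len: "integral {a..b} (speed \<gamma>) = integral {a..b} sp"
      by (rule integral_spike[of "{a, b}"]) (use V(3) in \<open>auto simp: sp_def\<close>)
    define u where "u = chart_map c (\<gamma> b) - chart_map c (\<gamma> a)"
    have ca: "c \<in> charts_at A (\<gamma> t)" if "t \<in> {a..b}" for t using piece(4)[OF that] c by (simp add: charts_at_iff)
    have Vn: "norm (V t c) \<le> C * sp t" if t: "t \<in> {a..b}" for t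
    proof -
      have "V t \<in> tangent_space A (\<gamma> t)" using V(1)[OF t] by (simp add: has_velocity_def)
      from local_metric_eq[OF ca[OF t] this this] show ?thesis
        using bound[of "chart_map c (\<gamma> t)" "V t c"] piece(4)[OF t] by (simp add: sp_def tangent_norm_def)
    qed
    have d: "((\<lambda>t. chart_map c (\<gamma> t) \<bullet> u) has_vector_derivative (V t c \<bullet> u)) (at t within {a..b})" if t: "t \<in> {a..b}" for t
    proof -
      have "((\<lambda>t. chart_map c (\<gamma> t)) has_vector_derivative V t c) (at t within {a..b})"
        using V(1)[OF t] ca[OF t] by (simp add: has_velocity_def o_def)
      then show ?thesis by (rule bounded_linear.has_vector_derivative[OF bounded_linear_inner_left])
    qed
    have int: "((\<lambda>t. V t c \<bullet> u) has_integral (chart_map c (\<gamma> b) \<bullet> u - chart_map c (\<gamma> a) \<bullet> u)) {a..b}"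
      by (rule fundamental_theorem_of_calculus[OF less_imp_le[OF piece(1)] d])
    have "chart_map c (\<gamma> b) \<bullet> u - chart_map c (\<gamma> a) \<bullet> u \<le> integral {a..b} (\<lambda>t. (C * norm u) * sp t)"
    proof (rule has_integral_le[OF int integrable_integral])
      show "(\<lambda>t. (C * norm u) * sp t) integrable_on {a..b}" using int_sp by (rule integrable_on_mult_right)
      fix t assume t: "t \<in> {a..b}"
      have "V t c \<bullet> u \<le> norm (V t c) * norm u" by (rule norm_cauchy_schwarz)
      also have "\<dots> \<le> (C * sp t) * norm u" by (intro mult_right_mono Vn t) auto
      finally show "V t c \<bullet> u \<le> (C * norm u) * sp t" by (simp add: mult_ac)
    qed
    then have "norm u * norm u \<le> (C * integral {a..b} sp) * norm u"
      by (simp add: inner_diff_left[symmetric] u_def[symmetric] dot_square_norm power2_eq_square mult_ac)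
    then have "norm u \<le> C * integral {a..b} sp \<or> norm u = 0" by (auto simp: mult_le_cancel_right)
    moreover have "0 \<le> integral {a..b} (speed \<gamma>)"
      using piece by (intro admissible_curve_speed_integrable(2)) (auto simp: admissible_curve_def intro: piecewise_C1_on.piece)
    ultimately show ?case unfolding len u_def[symmetric] using C by auto
  next
    case (join a b c')
    note le = piecewise_C1_on_le[OF join(1)] piecewise_C1_on_le[OF join(2)]
    have "norm (chart_map c (\<gamma> b) - chart_map c (\<gamma> a)) \<le> C * integral {a..b} (speed \<gamma>)"
      "norm (chart_map c (\<gamma> c') - chart_map c (\<gamma> b)) \<le> C * integral {b..c'} (speed \<gamma>)"
      using join continuous_map_Icc_subset[OF join(5)] le by auto
    moreover have "integral {a..b} (speed \<gamma>) + integral {b..c'} (speed \<gamma>) = integral {a..c'} (speed \<gamma>)"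
      using join le by (intro admissible_curve_length_combine) (auto simp: admissible_curve_def intro: piecewise_C1_on.join)
    ultimately show ?case
      using norm_triangle_ineq[of "chart_map c (\<gamma> c') - chart_map c (\<gamma> b)" "chart_map c (\<gamma> b) - chart_map c (\<gamma> a)"]
      by (simp flip: distrib_left) (smt (verit) distrib_left)
  qed auto
  then show ?thesis using arc S by (auto simp: admissible_curve_def)
qed

end

section \<open>The Riemannian distance\<close>

lemma continuous_map_paste_Icc:
  fixes \<gamma> :: "real \<Rightarrow> 'm"
  assumes "continuous_map (top_of_set {a..b}) X \<gamma>" "continuous_map (top_of_set {b..c}) X \<gamma>" "a \<le> b" "b \<le> c"
  shows "continuous_map (top_of_set {a..c}) X \<gamma>"
  unfolding continuous_map_closedin
proof (intro conjI allI impI)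
  show "\<gamma> \<in> topspace (top_of_set {a..c}) \<rightarrow> topspace X"
  proof
    fix t assume "t \<in> topspace (top_of_set {a..c})"
    then show "\<gamma> t \<in> topspace X"
      using continuous_map_image_subset_topspace[OF assms(1)] continuous_map_image_subset_topspace[OF assms(2)]
      by (cases "t \<le> b") auto
  qed
  fix C assume C: "closedin X C"
  have "closedin (top_of_set {a..b}) {t \<in> topspace (top_of_set {a..b}). \<gamma> t \<in> C}"
    "closedin (top_of_set {b..c}) {t \<in> topspace (top_of_set {b..c}). \<gamma> t \<in> C}"
    using assms(1,2) C unfolding continuous_map_closedin by blast+
  then have "closed {t \<in> {a..b}. \<gamma> t \<in> C}" "closed {t \<in> {b..c}. \<gamma> t \<in> C}"
    using closedin_closed_trans by fastforce+
  then have "closed ({t \<in> {a..b}. \<gamma> t \<in> C} \<union> {t \<in> {b..c}. \<gamma> t \<in> C})" by (rule closed_Un)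
  also have "{t \<in> {a..b}. \<gamma> t \<in> C} \<union> {t \<in> {b..c}. \<gamma> t \<in> C} = {t \<in> {a..c}. \<gamma> t \<in> C}" using assms(3,4) by auto
  finally show "closedin (top_of_set {a..c}) {t \<in> topspace (top_of_set {a..c}). \<gamma> t \<in> C}"
    by (intro closed_subset) auto
qed

section \<open>Pseudometric laws and comparison with the topology\<close>

context riemannian_manifold
begin

abbreviation rdist :: "'m \<Rightarrow> 'm \<Rightarrow> ereal" where
  "rdist \<equiv> riemannian_dist X A g"

lemma tangent_norm_scaleR:
  assumes "p \<in> topspace X" "\<xi> \<in> tangent_space A p"
  shows "tangent_norm g p (\<lambda>c. m *\<^sub>R \<xi> c) = \<bar>m\<bar> * tangent_norm g p \<xi>"
proof -
  obtain c where c: "c \<in> charts_at A p" using charts_at_nonempty[OF assms(1)] by blast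
  have "g p (\<lambda>c. m *\<^sub>R \<xi> c) (\<lambda>c. m *\<^sub>R \<xi> c) = m\<^sup>2 * g p \<xi> \<xi>"
    unfolding local_metric_eq[OF c assms(2) assms(2)]
      local_metric_eq[OF c tangent_space_scaleR[OF assms(2)] tangent_space_scaleR[OF assms(2)]]
    by (simp add: blinfun.scaleR_left blinfun.scaleR_right power2_eq_square)
  then show ?thesis by (simp add: tangent_norm_def real_sqrt_mult)
qed

lemma speed_affine:
  assumes "\<gamma> (m * t + k) \<in> topspace X" "has_velocity A \<gamma> UNIV (m * t + k) \<xi>"
  shows "speed (\<lambda>t. \<gamma> (m * t + k)) t = \<bar>m\<bar> * speed \<gamma> (m * t + k)"
proof -
  have "has_velocity A (\<lambda>t. \<gamma> (m * t + k)) UNIV t (\<lambda>c. m *\<^sub>R \<xi> c)"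
    by (rule has_velocity_affine[OF assms(2)]) simp
  from speed_eq[OF this] speed_eq[OF assms(2)] show ?thesis
    using assms by (simp add: tangent_norm_scaleR has_velocity_def)
qed

lemma admissible_curve_in_topspace: "admissible_curve \<gamma> a b \<Longrightarrow> a \<le> t \<Longrightarrow> t \<le> b \<Longrightarrow> \<gamma> t \<in> topspace X"
  unfolding admissible_curve_def using continuous_map_image_subset_topspace[of "top_of_set {a..b}" X \<gamma>] by auto

lemma admissible_curve_affine:
  assumes arc: "admissible_curve \<gamma> a b" and m: "m > 0"
  shows "admissible_curve (\<lambda>t. \<gamma> (m * t + k)) ((a - k) / m) ((b - k) / m)"
    and "integral {(a - k) / m..(b - k) / m} (speed (\<lambda>t. \<gamma> (m * t + k))) = integral {a..b} (speed \<gamma>)"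
proof -
  have sub: "m * t + k \<in> {a..b}" if "t \<in> {(a - k) / m..(b - k) / m}" for t
    using that m by (auto simp: field_simps)
  have "continuous_map (top_of_set {(a - k) / m..(b - k) / m}) (top_of_set {a..b}) (\<lambda>t. m * t + k)"
    using sub by (auto intro!: continuous_intros)
  from continuous_map_compose[OF this, of X \<gamma>] piecewise_C1_on_affine[of \<gamma> a b m k] arc m
  show "admissible_curve (\<lambda>t. \<gamma> (m * t + k)) ((a - k) / m) ((b - k) / m)" by (simp add: admissible_curve_def o_def)
  obtain F where F: "finite F" "\<And>t. t \<in> {a..b} - F \<Longrightarrow> \<exists>\<xi>. has_velocity A \<gamma> UNIV t \<xi>"
    using piecewise_C1_on_velocity arc unfolding admissible_curve_def by metis
  have "(speed \<gamma> has_integral integral {a..b} (speed \<gamma>)) (cbox a b)"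
    using integrable_integral[OF admissible_curve_speed_integrable(1)[OF arc]] by simp
  from has_integral_affinity'[OF this m, of k]
  have "((\<lambda>t. speed \<gamma> (m * t + k)) has_integral integral {a..b} (speed \<gamma>) / m) {(a - k) / m..(b - k) / m}"
    by (simp add: divide_inverse mult.commute)
  from has_integral_mult_right[OF this, of m]
  have "((\<lambda>t. m * speed \<gamma> (m * t + k)) has_integral integral {a..b} (speed \<gamma>)) {(a - k) / m..(b - k) / m}"
    using m by simp
  \<comment> \<open>The rescaled speed is the speed of the rescaled curve except at the preimages of
    the finitely many breakpoints.\<close>
  then have "(speed (\<lambda>t. \<gamma> (m * t + k)) has_integral integral {a..b} (speed \<gamma>)) {(a - k) / m..(b - k) / m}"
  proof (rule has_integral_spike_finite[rotated 2])
    show "finite ((\<lambda>u. (u - k) / m) ` F)" using F(1) by simp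
    fix t assume t: "t \<in> {(a - k) / m..(b - k) / m} - (\<lambda>u. (u - k) / m) ` F"
    have "m * t + k \<notin> F"
    proof
      assume "m * t + k \<in> F"
      then have "(m * t + k - k) / m \<in> (\<lambda>u. (u - k) / m) ` F" by (rule imageI)
      then show False using t m by simp
    qed
    moreover have mt: "m * t + k \<in> {a..b}" using sub t by blast
    ultimately obtain \<xi> where \<xi>: "has_velocity A \<gamma> UNIV (m * t + k) \<xi>" using F(2) by blast
    have "\<gamma> (m * t + k) \<in> topspace X" using admissible_curve_in_topspace[OF arc] mt by simp
    from speed_affine[OF this \<xi>] m show "speed (\<lambda>t. \<gamma> (m * t + k)) t = m * speed \<gamma> (m * t + k)" by simp
  qed
  then show "integral {(a - k) / m..(b - k) / m} (speed (\<lambda>t. \<gamma> (m * t + k))) = integral {a..b} (speed \<gamma>)"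
    by (rule integral_unique)
qed

lemma admissible_curve_reverse:
  assumes arc: "admissible_curve \<gamma> a b"
  shows "admissible_curve (\<lambda>t. \<gamma> (-1 * t + k)) (k - b) (k - a)"
    and "integral {k - b..k - a} (speed (\<lambda>t. \<gamma> (-1 * t + k))) = integral {a..b} (speed \<gamma>)"
proof -
  have sub: "-1 * t + k \<in> {a..b}" if "t \<in> {k - b..k - a}" for t
    using that by auto
  have "continuous_map (top_of_set {k - b..k - a}) (top_of_set {a..b}) (\<lambda>t. -1 * t + k)"
    using sub by (auto intro!: continuous_intros)
  from continuous_map_compose[OF this, of X \<gamma>] piecewise_C1_on_reverse[of \<gamma> a b k] arc
  show "admissible_curve (\<lambda>t. \<gamma> (-1 * t + k)) (k - b) (k - a)" by (simp add: admissible_curve_def o_def)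
  obtain F where F: "finite F" "\<And>t. t \<in> {a..b} - F \<Longrightarrow> \<exists>\<xi>. has_velocity A \<gamma> UNIV t \<xi>"
    using piecewise_C1_on_velocity arc unfolding admissible_curve_def by metis
  have "(speed \<gamma> has_integral integral {a..b} (speed \<gamma>)) (cbox a b)"
    using integrable_integral[OF admissible_curve_speed_integrable(1)[OF arc]] by simp
  from has_integral_affinity[OF this, of "-1" k]
  have "((\<lambda>t. speed \<gamma> (-1 * t + k)) has_integral integral {a..b} (speed \<gamma>)) {k - b..k - a}"
    by simp
  then have "(speed (\<lambda>t. \<gamma> (-1 * t + k)) has_integral integral {a..b} (speed \<gamma>)) {k - b..k - a}"
  proof (rule has_integral_spike_finite[rotated 2])
    show "finite ((\<lambda>u. k - u) ` F)" using F(1) by simp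
    fix t assume t: "t \<in> {k - b..k - a} - (\<lambda>u. k - u) ` F"
    have "-1 * t + k \<notin> F"
    proof
      assume "-1 * t + k \<in> F"
      then have "k - (-1 * t + k) \<in> (\<lambda>u. k - u) ` F" by (rule imageI)
      then show False using t by simp
    qed
    moreover have mt: "-1 * t + k \<in> {a..b}" using sub t by blast
    ultimately obtain \<xi> where \<xi>: "has_velocity A \<gamma> UNIV (-1 * t + k) \<xi>" using F(2) by blast
    have "\<gamma> (-1 * t + k) \<in> topspace X" using admissible_curve_in_topspace[OF arc] mt by simp
    from speed_affine[OF this \<xi>] show "speed (\<lambda>t. \<gamma> (-1 * t + k)) t = speed \<gamma> (-1 * t + k)" by simp
  qed
  then show "integral {k - b..k - a} (speed (\<lambda>t. \<gamma> (-1 * t + k))) = integral {a..b} (speed \<gamma>)"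
    by (rule integral_unique)
qed

lemma rdist_le_length:
  assumes arc: "admissible_curve \<gamma> a b" and ab: "a < b"
  shows "rdist (\<gamma> a) (\<gamma> b) \<le> ereal (integral {a..b} (speed \<gamma>))"
proof -
  define m where "m = b - a"
  have m: "m > 0" "(a - a) / m = 0" "(b - a) / m = 1" using ab by (auto simp: m_def)
  let ?\<gamma> = "\<lambda>t. \<gamma> (m * t + a)"
  have "admissible_curve ?\<gamma> 0 1" using admissible_curve_affine(1)[OF arc m(1), of a] m by simp
  then have "piecewise_C1_curve X A ?\<gamma>" by (simp add: piecewise_C1_curve_iff admissible_curve_def)
  moreover have "curve_length A g ?\<gamma> = integral {a..b} (speed \<gamma>)"
    using admissible_curve_affine(2)[OF arc m(1), of a] m by (simp add: curve_length_eq)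
  moreover have "?\<gamma> 0 = \<gamma> a" "?\<gamma> 1 = \<gamma> b" by (auto simp: m_def)
  ultimately show ?thesis
    unfolding riemannian_dist_def by (metis (mono_tags, lifting) INF_lower mem_Collect_eq)
qed

lemma rdist_lessE:
  assumes "rdist p q < ereal r"
  obtains \<gamma> where "admissible_curve \<gamma> 0 1" "\<gamma> 0 = p" "\<gamma> 1 = q" "integral {0..1} (speed \<gamma>) < r"
  using assms unfolding riemannian_dist_def INF_less_iff piecewise_C1_curve_iff
  by (auto simp: curve_length_eq admissible_curve_def)

lemma rdist_nonneg: "0 \<le> rdist p q"
  unfolding riemannian_dist_def
proof (rule INF_greatest)
  fix \<gamma> assume "\<gamma> \<in> {\<gamma>. piecewise_C1_curve X A \<gamma> \<and> \<gamma> 0 = p \<and> \<gamma> 1 = q}"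
  then have "admissible_curve \<gamma> 0 1" by (simp add: piecewise_C1_curve_iff admissible_curve_def)
  then show "0 \<le> ereal (curve_length A g \<gamma>)" by (simp add: curve_length_eq admissible_curve_speed_integrable(2))
qed

lemma rdist_commute: "rdist p q = rdist q p"
proof -
  have "rdist q p \<le> rdist p q" for p q
    unfolding riemannian_dist_def[of _ _ _ p q]
  proof (rule INF_greatest)
    fix \<gamma> assume "\<gamma> \<in> {\<gamma>. piecewise_C1_curve X A \<gamma> \<and> \<gamma> 0 = p \<and> \<gamma> 1 = q}"
    then have \<gamma>: "admissible_curve \<gamma> 0 1" "\<gamma> 0 = p" "\<gamma> 1 = q" by (auto simp: piecewise_C1_curve_iff admissible_curve_def)
    have r: "admissible_curve (\<lambda>t. \<gamma> (-1 * t + 1)) 0 1" using admissible_curve_reverse(1)[OF \<gamma>(1), of 1] by simp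
    have "integral {0..1} (speed (\<lambda>t. \<gamma> (-1 * t + 1))) = integral {0..1} (speed \<gamma>)"
      using admissible_curve_reverse(2)[OF \<gamma>(1), of 1] by simp
    then show "rdist q p \<le> ereal (curve_length A g \<gamma>)"
      using rdist_le_length[OF r] \<gamma> by (simp add: curve_length_eq)
  qed
  then show ?thesis by (intro antisym)
qed

text \<open>Strict real bounds select actual curves and avoid arithmetic with infinite distances.
  The curves are joined on \<open>{0..2}\<close>, the corner at time 1 being allowed for piecewise
  C1 curves.\<close>

lemma rdist_triangle_less:
  assumes "rdist p q < ereal a" "rdist q r < ereal b"
  shows "rdist p r < ereal (a + b)"
proof -
  obtain \<gamma>1 where \<gamma>1: "admissible_curve \<gamma>1 0 1" "\<gamma>1 0 = p" "\<gamma>1 1 = q" "integral {0..1} (speed \<gamma>1) < a"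
    using rdist_lessE[OF assms(1)] by blast
  obtain \<gamma>2' where \<gamma>2': "admissible_curve \<gamma>2' 0 1" "\<gamma>2' 0 = q" "\<gamma>2' 1 = r" "integral {0..1} (speed \<gamma>2') < b"
    using rdist_lessE[OF assms(2)] by blast
  define \<gamma>2 where "\<gamma>2 t = \<gamma>2' (1 * t + -1)" for t
  have \<gamma>2: "admissible_curve \<gamma>2 1 2" "\<gamma>2 1 = q" "\<gamma>2 2 = r" "integral {1..2} (speed \<gamma>2) < b"
    using admissible_curve_affine[OF \<gamma>2'(1), of 1 "-1"] \<gamma>2' unfolding \<gamma>2_def[abs_def] by auto
  define \<gamma> where "\<gamma> t = (if t \<le> 1 then \<gamma>1 t else \<gamma>2 t)" for t
  have eq1: "\<gamma> t = \<gamma>1 t" if "t \<le> 1" for t using that by (simp add: \<gamma>_def)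
  have eq2: "\<gamma> t = \<gamma>2 t" if "t \<ge> 1" for t using that \<gamma>1(3) \<gamma>2(2) by (auto simp: \<gamma>_def)
  have c1: "continuous_map (top_of_set {0..1}) X \<gamma>"
    by (rule continuous_map_eq[of _ _ \<gamma>1]) (use \<gamma>1(1) eq1 in \<open>auto simp: admissible_curve_def\<close>)
  have c2: "continuous_map (top_of_set {1..2}) X \<gamma>"
    by (rule continuous_map_eq[of _ _ \<gamma>2]) (use \<gamma>2(1) eq2 in \<open>auto simp: admissible_curve_def\<close>)
  have p1: "piecewise_C1_on A \<gamma> 0 1"
    by (rule piecewise_C1_on_cong[of _ \<gamma>1]) (use \<gamma>1(1) eq1 in \<open>auto simp: admissible_curve_def\<close>)
  have p2: "piecewise_C1_on A \<gamma> 1 2"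
    by (rule piecewise_C1_on_cong[of _ \<gamma>2]) (use \<gamma>2(1) eq2 in \<open>auto simp: admissible_curve_def\<close>)
  have arc: "admissible_curve \<gamma> 0 2"
    unfolding admissible_curve_def using continuous_map_paste_Icc[OF c1 c2] piecewise_C1_on.join[OF p1 p2] by simp
  have "integral {0..1} (speed \<gamma>) = integral {0..1} (speed \<gamma>1)"
  proof (rule integral_spike[of "{1}"])
    fix t :: real assume "t \<in> {0..1} - {1}"
    then show "speed \<gamma>1 t = speed \<gamma> t" by (intro speed_cong[of "{..<1}"]) (auto simp: eq1)
  qed simp
  moreover have "integral {1..2} (speed \<gamma>) = integral {1..2} (speed \<gamma>2)"
  proof (rule integral_spike[of "{1}"])
    fix t :: real assume "t \<in> {1..2} - {1}"
    then show "speed \<gamma>2 t = speed \<gamma> t" by (intro speed_cong[of "{1<..}"]) (auto simp: eq2)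
  qed simp
  moreover have "integral {0..1} (speed \<gamma>) + integral {1..2} (speed \<gamma>) = integral {0..2} (speed \<gamma>)"
    by (rule admissible_curve_length_combine[OF arc]) auto
  ultimately have "integral {0..2} (speed \<gamma>) < a + b" using \<gamma>1(4) \<gamma>2(4) by linarith
  moreover have "rdist (\<gamma> 0) (\<gamma> 2) \<le> ereal (integral {0..2} (speed \<gamma>))" by (rule rdist_le_length[OF arc]) simp
  moreover have "\<gamma> 0 = p" "\<gamma> 2 = r" using \<gamma>1 \<gamma>2 by (auto simp: \<gamma>_def)
  ultimately show ?thesis by (metis (no_types, lifting) ereal_less(4) less_ereal.simps(1) order_le_less_trans)
qed

text \<open>The coordinate segment is an admissible competitor whose velocity is constantly
  \<open>u\<close> in the chart. This is the upper estimate for distances;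
  \<open>chart_displacement\<close> is the lower one.\<close>

lemma rdist_chart_segment:
  assumes c: "c \<in> A" and seg: "\<And>t. t \<in> {0..1} \<Longrightarrow> x + t *\<^sub>R u \<in> chart_img c"
    and M: "\<And>t. t \<in> {0..1} \<Longrightarrow>
      sqrt (blinfun_apply (blinfun_apply (metric_in c (x + t *\<^sub>R u)) u) u) \<le> M"
  shows "rdist (chart_inv c x) (chart_inv c (x + u)) \<le> ereal M"
proof -
  define y where "y t = x + t *\<^sub>R u" for t :: real
  have y': "(y has_vector_derivative u) (at t within J)" for t J
    unfolding y_def by (auto intro!: derivative_eq_intros)
  have img: "y t \<in> chart_img c" if "t \<in> {0..1}" for t using seg[OF that] by (simp add: y_def)
  let ?\<gamma> = "\<lambda>t. chart_inv c (y t)"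
  have C1: "C1_curve_on A {0..1} ?\<gamma>" by (rule C1_curve_lift[OF c img y']) auto
  have y: "continuous_on {0..1} y" unfolding y_def by (intro continuous_intros)
  have arc: "admissible_curve ?\<gamma> 0 1"
    unfolding admissible_curve_def using continuous_map_chart_curve[OF c y img] piecewise_C1_on.piece[OF _ C1] by simp
  have sp: "speed ?\<gamma> t \<le> M" if t: "t \<in> {0..1} - {0, 1}" for t
  proof -
    have ti: "t \<in> interior {0..1}" and t01: "t \<in> {0..1}" using t by auto
    have ch: "c \<in> charts_at A (?\<gamma> t)" by (rule charts_at_inv[OF c img[OF t01]])
    have "has_velocity A ?\<gamma> {0..1} t (tangent_lift A (?\<gamma> t) c u)"
      by (rule has_velocity_lift[OF c t01 img y'])
    then have "has_velocity A ?\<gamma> UNIV t (tangent_lift A (?\<gamma> t) c u)"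
      using has_velocity_interior[OF ti, of A ?\<gamma>] by simp
    from speed_eq[OF this] have "speed ?\<gamma> t = sqrt (blinfun_apply (blinfun_apply (metric_in c (y t)) u) u)"
      using metric_in_eq[OF c img[OF t01]] by (simp add: tangent_norm_def)
    then show ?thesis using M[OF t01] by (simp add: y_def)
  qed
  have int: "speed ?\<gamma> integrable_on {0..1}" by (rule admissible_curve_speed_integrable(1)[OF arc])
  \<comment> \<open>The minimum enforces the bound at the endpoints too, where the speed may be
    arbitrary.\<close>
  have "integral {0..1} (speed ?\<gamma>) = integral {0..1} (\<lambda>t. min (speed ?\<gamma> t) M)"
    by (rule integral_spike[of "{0, 1}"]) (use sp in \<open>auto simp: min_absorb1\<close>)
  also have "\<dots> \<le> integral {0..1} (\<lambda>t::real. M)"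
  proof (rule integral_le)
    show "(\<lambda>t. min (speed ?\<gamma> t) M) integrable_on {0..1}"
      by (rule integrable_spike_finite[OF _ _ int, of "{0, 1}"]) (use sp in \<open>auto simp: min_absorb1\<close>)
  qed auto
  finally have "integral {0..1} (speed ?\<gamma>) \<le> M" by simp
  moreover have "rdist (?\<gamma> 0) (?\<gamma> 1) \<le> ereal (integral {0..1} (speed ?\<gamma>))" by (rule rdist_le_length[OF arc]) simp
  ultimately have "rdist (?\<gamma> 0) (?\<gamma> 1) \<le> ereal M" using ereal_less_eq(3) order_trans by blast
  then show ?thesis by (simp add: y_def)
qed

lemma rdist_self: "p \<in> topspace X \<Longrightarrow> rdist p p = 0"
proof -
  assume "p \<in> topspace X"
  then obtain c where c: "c \<in> charts_at A p" using charts_at_nonempty by blast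
  then have cA: "c \<in> A" and pc: "p \<in> chart_dom c" by (auto simp: charts_at_iff)
  \<comment> \<open>The constant curve, as a segment with direction 0.\<close>
  have "rdist (chart_inv c (chart_map c p)) (chart_inv c (chart_map c p + 0)) \<le> ereal 0"
    by (rule rdist_chart_segment[OF cA]) (use chart_map_img[OF pc] in auto)
  then show ?thesis using rdist_nonneg[of p p] cA pc by (simp add: zero_ereal_def)
qed

text \<open>
  In infinite dimension closed balls of a chart need not be closed in the manifold, so a curve might
  leave a ball without crossing its boundary. A short curve has a limit in the chart by completeness
  of the model space, and the Hausdorff property identifies it with the point of the curve.
\<close>

lemma short_curve_stays_in_chart:
  assumes arc: "admissible_curve \<gamma> a b" and c: "c \<in> A" "\<gamma> a \<in> chart_dom c" and r: "r > 0" and C: "C \<ge> 0"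
    and ball: "ball (chart_map c (\<gamma> a)) r \<subseteq> chart_img c"
    and bound: "\<And>z u. z \<in> ball (chart_map c (\<gamma> a)) r \<Longrightarrow>
      norm u \<le> C * sqrt (blinfun_apply (blinfun_apply (metric_in c z) u) u)"
    and short: "C * integral {a..b} (speed \<gamma>) < r"
    and t: "a \<le> t" "t \<le> b"
  shows "\<gamma> t \<in> chart_dom c \<and> chart_map c (\<gamma> t) \<in> ball (chart_map c (\<gamma> a)) r"
proof -
  define x where "x = chart_map c (\<gamma> a)"
  define P where "P t \<longleftrightarrow> \<gamma> t \<in> chart_dom c \<and> chart_map c (\<gamma> t) \<in> ball x r" for t
  have Pa: "P a" using c r by (simp add: P_def x_def)
  have cont: "continuous_map (top_of_set {a..b}) X \<gamma>" using arc by (simp add: admissible_curve_def)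
  have disp: "norm (chart_map c (\<gamma> s') - chart_map c (\<gamma> s)) \<le> C * integral {s..s'} (speed \<gamma>)"
    if "a \<le> s" "s \<le> s'" "s' \<le> b" "\<And>q. s \<le> q \<Longrightarrow> q \<le> s' \<Longrightarrow> P q" for s s'
    by (rule chart_displacement[where S = "ball x r", OF admissible_curve_sub[OF arc that(1-3)] c(1) C bound[folded x_def]])
      (use that(4) in \<open>simp_all add: P_def\<close>)
  have "P t"
  proof (rule real_interval_induct[where P = P and a = a and b = b])
    fix t assume t: "a \<le> t" "t \<le> b" and before: "\<And>s. a \<le> s \<Longrightarrow> s < t \<Longrightarrow> P s"
    show "P t"
    proof (cases "t = a")
      case True then show ?thesis using Pa by simp
    next
      case False
      then have at: "a < t" using t by simp
      \<comment> \<open>A sequence in \<open>[a, t)\<close> tending to \<open>t\<close>; it begins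
        at \<open>a\<close>, because the factor is 1 for \<open>n = 0\<close>.\<close>
      define s where "s n = t - (t - a) * inverse (real (Suc n))" for n
      have inv1: "inverse (real (Suc n)) \<le> 1" "inverse (real (Suc n)) > 0" for n
        by (auto simp: field_simps)
      have s: "a \<le> s n" "s n < t" for n
      proof -
        define w where "w = (t - a) * inverse (real (Suc n))"
        have "w \<le> (t - a) * 1" unfolding w_def using at inv1(1) by (intro mult_left_mono) auto
        moreover have "0 < w" unfolding w_def using at inv1(2) by (intro mult_pos_pos) auto
        ultimately show "a \<le> s n" "s n < t" unfolding s_def w_def[symmetric] by auto
      qed
      have s_le: "s n \<le> b" for n using s(2)[of n] t by linarith
      have s_lim: "s \<longlonglongrightarrow> t"
      proof -
        have "s \<longlonglongrightarrow> t - (t - a) * 0"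
          unfolding s_def by (intro tendsto_intros LIMSEQ_inverse_real_of_nat)
        then show ?thesis by simp
      qed
      \<comment> \<open>Arc length up to \<open>s\<close>. Its continuity makes
        \<open>I (s n)\<close> Cauchy, and it dominates coordinate displacements, so the coordinates
        are Cauchy as well.\<close>
      define I where "I s = integral {a..s} (speed \<gamma>)" for s
      have "continuous_on {a..b} I"
        unfolding I_def by (rule indefinite_integral_continuous_1[OF admissible_curve_speed_integrable(1)[OF arc]])
      then have "(\<lambda>n. I (s n)) \<longlonglongrightarrow> I t"
        by (rule continuous_on_tendsto_compose[OF _ s_lim]) (use s s_le t in auto)
      then have CI: "Cauchy (\<lambda>n. I (s n))" by (rule LIMSEQ_imp_Cauchy)
      define u where "u n = chart_map c (\<gamma> (s n))" for n
      have step: "norm (u j - u i) \<le> C * \<bar>I (s j) - I (s i)\<bar>" if "s i \<le> s j" for i j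
      proof -
        have "norm (u j - u i) \<le> C * integral {s i..s j} (speed \<gamma>)"
          unfolding u_def
        proof (rule disp[OF s(1) that])
          show "s j \<le> b" by (rule s_le)
          show "P q" if "s i \<le> q" "q \<le> s j" for q using before[of q] s(1)[of i] s(2)[of j] that by linarith
        qed
        moreover have "I (s i) + integral {s i..s j} (speed \<gamma>) = I (s j)"
          unfolding I_def by (rule admissible_curve_length_combine[OF admissible_curve_sub[OF arc]]) (use s s_le that order_trans in auto)
        moreover have "C * (I (s j) - I (s i)) \<le> C * \<bar>I (s j) - I (s i)\<bar>" using C by (intro mult_left_mono) auto
        ultimately show ?thesis by (metis add_diff_cancel_left' order_trans)
      qed
      have "Cauchy u"
      proof (rule metric_CauchyI)
        fix e :: real assume "e > 0"
        \<comment> \<open>\<open>C\<close> may be 0, hence the \<open>+ 1\<close> in the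
          denominator.\<close>
        then have "e / (C + 1) > 0" using C by simp
        then obtain N where N: "\<And>i j. i \<ge> N \<Longrightarrow> j \<ge> N \<Longrightarrow> \<bar>I (s i) - I (s j)\<bar> < e / (C + 1)"
          using metric_CauchyD[OF CI, of "e / (C + 1)"] by (auto simp: dist_real_def)
        have "dist (u i) (u j) < e" if "i \<ge> N" "j \<ge> N" for i j
        proof -
          have "norm (u i - u j) \<le> C * \<bar>I (s i) - I (s j)\<bar>"
            using step[of i j] step[of j i] by (cases "s i \<le> s j") (auto simp: norm_minus_commute abs_minus_commute)
          also have "\<dots> \<le> C * (e / (C + 1))" using N[OF that] C by (intro mult_left_mono) auto
          also have "\<dots> < e" using C \<open>e > 0\<close> by (simp add: field_simps)
          finally show ?thesis by (simp add: dist_norm)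
        qed
        then show "\<exists>M. \<forall>i\<ge>M. \<forall>j\<ge>M. dist (u i) (u j) < e" by blast
      qed
      then obtain y where y: "u \<longlonglongrightarrow> y" using Cauchy_convergent convergent_def by blast
      have near: "norm (u n - x) \<le> C * integral {a..b} (speed \<gamma>)" for n
      proof -
        have "norm (u n - x) \<le> C * integral {a..s n} (speed \<gamma>)"
          unfolding u_def x_def
        proof (rule disp[OF order_refl s(1) s_le])
          show "P q" if "a \<le> q" "q \<le> s n" for q using before[of q] s(2)[of n] that by linarith
        qed
        also have "\<dots> \<le> C * integral {a..b} (speed \<gamma>)"
          using C s(1) s_le by (intro mult_left_mono admissible_curve_length_mono[OF arc]) auto
        finally show ?thesis .
      qed
      have "norm (y - x) \<le> C * integral {a..b} (speed \<gamma>)"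
        by (rule LIMSEQ_le_const2[OF tendsto_norm[OF tendsto_diff[OF y tendsto_const]]]) (use near in auto)
      then have yb: "y \<in> ball x r" using short by (simp add: dist_norm norm_minus_commute)
      then have yimg: "y \<in> chart_img c" using ball by (auto simp: x_def)
      have un: "u n \<in> chart_img c" "chart_inv c (u n) = \<gamma> (s n)" for n
        using before[OF s] c(1) by (auto simp: u_def P_def chart_map_img)
      have "limitin X (chart_inv c \<circ> u) (chart_inv c y) sequentially"
        by (rule continuous_map_limit[OF continuous_map_chart_inv[OF c(1)]])
          (use y yimg un in \<open>auto simp: limitin_subtopology\<close>)
      moreover have "limitin X (\<gamma> \<circ> s) (\<gamma> t) sequentially"
        by (rule continuous_map_limit[OF cont])
          (use s_lim s s_le t in \<open>auto simp: limitin_subtopology\<close>)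
      moreover have "chart_inv c \<circ> u = \<gamma> \<circ> s" using un by auto
      ultimately have "\<gamma> t = chart_inv c y"
        using limitin_Hausdorff_unique[OF _ _ _ Hausdorff] by (metis trivial_limit_sequentially)
      then show ?thesis using yb yimg by (simp add: P_def chart_inv_dom)
    qed
  next
    fix t assume t: "a \<le> t" "t < b" and upto: "\<And>s. a \<le> s \<Longrightarrow> s \<le> t \<Longrightarrow> P s"
    have tt: "t \<in> {a..b}" and Pt: "P t" using t upto[of t] by auto
    obtain e where e: "e > 0" "\<And>s. s \<in> {a..b} \<Longrightarrow> dist s t < e \<Longrightarrow> \<gamma> s \<in> {p \<in> chart_dom c. chart_map c p \<in> ball x r}"
      using continuous_map_real_nhd[OF cont tt openin_chart_preimage[OF c(1) open_ball[of x r]]] Pt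
      unfolding P_def by blast
    have "P s" if "t < s" "s < t + e" "s \<le> b" for s
      using e(2)[of s] that t by (auto simp: P_def dist_real_def)
    then show "\<exists>u>t. \<forall>s. t < s \<longrightarrow> s < u \<longrightarrow> s \<le> b \<longrightarrow> P s" using e(1) by (intro exI[of _ "t + e"]) auto
  qed (use t in auto)
  then show ?thesis by (simp add: P_def x_def)
qed

lemma chart_norm_bound:
  assumes c: "c \<in> A" and x0: "x0 \<in> chart_img c"
  obtains r C where "r > 0" "C > 0" "cball x0 r \<subseteq> chart_img c"
    "\<And>z u. z \<in> cball x0 r \<Longrightarrow> norm u \<le> C * sqrt (blinfun_apply (blinfun_apply (metric_in c z) u) u)"
proof -
  have half: "0 < (1/2 :: real)" by simp
  obtain r where r: "r > 0" "cball x0 r \<subseteq> chart_img c"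
    "\<And>x u. x \<in> cball x0 r \<Longrightarrow> \<bar>blinfun_apply (blinfun_apply (metric_in c x) u) u
       - blinfun_apply (blinfun_apply (metric_in c x0) u) u\<bar> \<le> 1/2 * blinfun_apply (blinfun_apply (metric_in c x0) u) u"
    using metric_in_locally_coercive[OF c x0 half] by blast
  obtain m where m: "m > 0" "\<And>u. m * (norm u)\<^sup>2 \<le> blinfun_apply (blinfun_apply (metric_in c x0) u) u"
    using metric_in_coercive[OF c x0] by blast
  have "norm u \<le> (1 / sqrt (m/2)) * sqrt (blinfun_apply (blinfun_apply (metric_in c z) u) u)" if "z \<in> cball x0 r" for z u
  proof -
    have "(m/2) * (norm u)\<^sup>2 \<le> blinfun_apply (blinfun_apply (metric_in c z) u) u"
      using r(3)[OF that, of u] m(2)[of u] unfolding abs_le_iff by argo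
    from real_sqrt_le_mono[OF this] have "sqrt (m/2) * norm u \<le> sqrt (blinfun_apply (blinfun_apply (metric_in c z) u) u)"
      by (simp only: real_sqrt_mult real_sqrt_abs abs_norm_cancel)
    then show ?thesis using m(1) by (simp add: pos_le_divide_eq mult.commute)
  qed
  then show ?thesis using r m(1) by (intro that[of r "1 / sqrt (m/2)"]) auto
qed

text \<open>Short curves from \<open>p\<close> cannot leave a small chart ball, so distance balls
  fit into open sets. This links completeness, a statement about the distance, to lower
  semicontinuity, a statement about the topology.\<close>

lemma rdist_nhd:
  assumes U: "openin X U" "p \<in> U"
  obtains e where "e > 0" "\<And>q. rdist p q < ereal e \<Longrightarrow> q \<in> U"
proof -
  have "p \<in> topspace X" using U openin_subset by blast
  then obtain c where "c \<in> charts_at A p" using charts_at_nonempty by blast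
  then have c: "c \<in> A" "p \<in> chart_dom c" by (auto simp: charts_at_iff)
  define x0 where "x0 = chart_map c p"
  have x0: "x0 \<in> chart_img c" unfolding x0_def by (rule chart_map_img[OF c(2)])
  obtain r1 C where r1: "r1 > 0" "C > 0" "cball x0 r1 \<subseteq> chart_img c"
    "\<And>z u. z \<in> cball x0 r1 \<Longrightarrow> norm u \<le> C * sqrt (blinfun_apply (blinfun_apply (metric_in c z) u) u)"
    using chart_norm_bound[OF c(1) x0] by blast
  have "open {x \<in> chart_img c. chart_inv c x \<in> U}" "x0 \<in> {x \<in> chart_img c. chart_inv c x \<in> U}"
    using open_chart_image[OF c(1) U(1)] x0 c U by (auto simp: x0_def)
  then obtain r2 where r2: "r2 > 0" "ball x0 r2 \<subseteq> {x \<in> chart_img c. chart_inv c x \<in> U}"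
    using open_contains_ball by blast
  define r where "r = min r1 r2"
  have r: "r > 0" "r \<le> r1" "r \<le> r2" using r1 r2 by (auto simp: r_def)
  show ?thesis
  \<comment> \<open>Coordinates move by at most \<open>C\<close> times the length, hence by less
    than \<open>r\<close>.\<close>
  proof (rule that[of "r / C"])
    show "r / C > 0" using r r1 by simp
    fix q assume "rdist p q < ereal (r / C)"
    then obtain \<gamma> where \<gamma>: "admissible_curve \<gamma> 0 1" "\<gamma> 0 = p" "\<gamma> 1 = q" "integral {0..1} (speed \<gamma>) < r / C"
      using rdist_lessE by blast
    have "\<gamma> 1 \<in> chart_dom c \<and> chart_map c (\<gamma> 1) \<in> ball (chart_map c (\<gamma> 0)) r"
    proof (rule short_curve_stays_in_chart[OF \<gamma>(1) c(1)])
      show "C * integral {0..1} (speed \<gamma>) < r" using \<gamma>(4) r1(2) by (simp add: field_simps)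
      show "norm u \<le> C * sqrt (blinfun_apply (blinfun_apply (metric_in c z) u) u)" if "z \<in> ball (chart_map c (\<gamma> 0)) r" for z u
        using that r by (intro r1(4)) (auto simp: x0_def \<gamma>(2))
      show "ball (chart_map c (\<gamma> 0)) r \<subseteq> chart_img c" using r r1(3) by (auto simp: x0_def[symmetric] \<gamma>(2))
    qed (use r r1 c \<gamma> in auto)
    then have "q \<in> chart_dom c" "chart_map c q \<in> ball x0 r2" using r by (auto simp: \<gamma> x0_def)
    then show "q \<in> U" using r2(2) c(1) by force
  qed
qed

end

section \<open>The decrease principle\<close>

context riemannian_manifold
begin

text \<open>The local half of the argument. In the cone hypothesis \<open>t\<close> is any real
  upper bound of the distance, because the chart provides such bounds directly and the distance
  itself is an infimum.\<close>

lemma small_proximal_subgradient: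
  assumes lsc: "lower_semicontinuous_map X f" and fin: "\<And>x. x \<in> topspace X \<Longrightarrow> f x \<noteq> -\<infinity>"
    and q: "q \<in> topspace X" "f q = ereal a" and \<epsilon>: "\<epsilon> > 0" and K: "0 \<le> K" "K < \<delta>"
    and cone: "\<And>y t. y \<in> topspace X \<Longrightarrow> rdist q y \<le> ereal t \<Longrightarrow> t < \<epsilon> \<Longrightarrow> ereal (a - K * t) \<le> f y"
  obtains p \<zeta> where "p \<in> topspace X" "rdist q p < ereal \<epsilon>"
    "\<zeta> \<in> manifold_proximal_subdifferential X A g f p" "tangent_norm g p \<zeta> < \<delta>"
proof -
  obtain c where "c \<in> charts_at A q" using charts_at_nonempty[OF q(1)] by blast
  then have c: "c \<in> A" "q \<in> chart_dom c" by (auto simp: charts_at_iff)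
  define x0 where "x0 = chart_map c q"
  have x0: "x0 \<in> chart_img c" unfolding x0_def by (rule chart_map_img[OF c(2)])
  have qx0: "chart_inv c x0 = q" using c by (simp add: x0_def)
  define G where "G u v = blinfun_apply (blinfun_apply (metric_in c x0) u) v" for u v
  have G_bil: "bounded_bilinear G" unfolding G_def[abs_def] by (rule bounded_bilinear_blinfun_form)
  have G_sym: "G u v = G v u" for u v unfolding G_def by (rule metric_in_sym[OF c(1) x0])
  obtain m where m: "m > 0" "\<And>u. m * (norm u)\<^sup>2 \<le> G u u"
    using metric_in_coercive[OF c(1) x0] unfolding G_def by blast
  have Gnn: "0 \<le> G u u" for u using m(2)[of u] m(1) by (smt (verit) mult_nonneg_nonneg zero_le_power2)

  have \<delta>: "\<delta> > 0" "K\<^sup>2 < \<delta>\<^sup>2" using K by (auto intro: power_strict_mono)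
  \<comment> \<open>Spends half of the gap between the squares, so that \<open>K\<^sup>2 * (1 +
    \<theta>) < \<delta>\<^sup>2 * (1 - \<theta>)\<close>: the factor \<open>1 + \<theta>\<close> is
    lost when distances are bounded by the metric frozen at \<open>q\<close>, and
    \<open>1 - \<theta>\<close> when the subgradient is measured at \<open>p\<close>.\<close>
  define \<theta> where "\<theta> = (\<delta>\<^sup>2 - K\<^sup>2) / (2 * (\<delta>\<^sup>2 + K\<^sup>2))"
  have pos: "\<delta>\<^sup>2 + K\<^sup>2 > 0" using \<delta> by (simp add: add_pos_nonneg)
  have \<theta>_eq: "\<theta> * (\<delta>\<^sup>2 + K\<^sup>2) = (\<delta>\<^sup>2 - K\<^sup>2) / 2"
  proof -
    have "x / (2 * y) * y = x / 2" if "y > 0" for x y :: real using that by simp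
    from this[OF pos] show ?thesis unfolding \<theta>_def .
  qed
  have \<theta>: "0 < \<theta>" "\<theta> < 1"
    using \<delta> pos by (auto simp: \<theta>_def divide_less_eq intro!: divide_pos_pos) (smt (verit) zero_le_power2)
  have K12: "K * sqrt (1 + \<theta>) < \<delta> * sqrt (1 - \<theta>)"
  proof -
    have "K\<^sup>2 * (1 + \<theta>) < \<delta>\<^sup>2 * (1 - \<theta>)"
      using \<theta>_eq \<delta>(2) by (simp add: algebra_simps)
    then have "sqrt (K\<^sup>2 * (1 + \<theta>)) < sqrt (\<delta>\<^sup>2 * (1 - \<theta>))" by (rule real_sqrt_less_mono)
    then show ?thesis using K \<delta> by (simp add: real_sqrt_mult)
  qed
  define K1 where "K1 = K * sqrt (1 + \<theta>)"
  define K2 where "K2 = (K1 + \<delta> * sqrt (1 - \<theta>)) / 2"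
  have K1: "0 \<le> K1" "K1 < K2" "K2 < \<delta> * sqrt (1 - \<theta>)" using K \<theta> K12 by (auto simp: K1_def K2_def)

  obtain r1 where r1: "r1 > 0" "cball x0 r1 \<subseteq> chart_img c"
    "\<And>x u. x \<in> cball x0 r1 \<Longrightarrow> \<bar>blinfun_apply (blinfun_apply (metric_in c x) u) u
       - blinfun_apply (blinfun_apply (metric_in c x0) u) u\<bar> \<le> \<theta> * blinfun_apply (blinfun_apply (metric_in c x0) u) u"
    using metric_in_locally_coercive[OF c(1) x0 \<theta>(1)] by blast
  have upper: "sqrt (blinfun_apply (blinfun_apply (metric_in c x) u) u) \<le> sqrt (1 + \<theta>) * sqrt (G u u)"
    and lower: "sqrt (1 - \<theta>) * sqrt (G u u) \<le> sqrt (blinfun_apply (blinfun_apply (metric_in c x) u) u)"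
    if "x \<in> cball x0 r1" for x u
  proof -
    have "(1 - \<theta>) * G u u \<le> blinfun_apply (blinfun_apply (metric_in c x) u) u"
      "blinfun_apply (blinfun_apply (metric_in c x) u) u \<le> (1 + \<theta>) * G u u"
      using r1(3)[OF that, of u] unfolding G_def abs_le_iff by (auto simp: algebra_simps)
    then show "sqrt (blinfun_apply (blinfun_apply (metric_in c x) u) u) \<le> sqrt (1 + \<theta>) * sqrt (G u u)"
      "sqrt (1 - \<theta>) * sqrt (G u u) \<le> sqrt (blinfun_apply (blinfun_apply (metric_in c x) u) u)"
      unfolding real_sqrt_mult[symmetric] by (auto intro: real_sqrt_le_mono)
  qed
  define M where "M = norm (metric_in c x0) + 1"
  have M: "M > 0" "G u u \<le> M * (norm u)\<^sup>2" for u
  proof -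
    show "M > 0" unfolding M_def by (simp add: add_nonneg_pos)
    have "G u u \<le> norm (metric_in c x0) * norm u * norm u"
      using norm_blinfun2_le[of "metric_in c x0" u u] unfolding G_def by simp
    also have "\<dots> \<le> M * norm u * norm u" unfolding M_def by (intro mult_right_mono) auto
    finally show "G u u \<le> M * (norm u)\<^sup>2" by (simp add: power2_eq_square)
  qed
  \<comment> \<open>The second bound keeps \<open>len v\<close> at most
    \<open>\<epsilon> / 2\<close> on the ball, within reach of the cone hypothesis.\<close>
  define r where "r = min r1 (\<epsilon> / (2 * (sqrt (1 + \<theta>) * sqrt M)))"
  have sM: "sqrt (1 + \<theta>) * sqrt M > 0" using \<theta> M by simp
  have r: "r > 0" "r \<le> r1" "r \<le> \<epsilon> / (2 * (sqrt (1 + \<theta>) * sqrt M))"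
    using r1 \<epsilon> sM by (auto simp: r_def)
  define len where "len v = sqrt (1 + \<theta>) * sqrt (G v v)" for v
  have len_small: "len v < \<epsilon>" if "norm v \<le> r" for v
  proof -
    have "sqrt (G v v) \<le> sqrt (M * (norm v)\<^sup>2)" by (rule real_sqrt_le_mono[OF M(2)])
    then have "sqrt (G v v) \<le> sqrt M * norm v" by (simp add: real_sqrt_mult)
    then have "len v \<le> sqrt (1 + \<theta>) * (sqrt M * norm v)" unfolding len_def using \<theta> by (intro mult_left_mono) auto
    also have "\<dots> = (sqrt (1 + \<theta>) * sqrt M) * norm v" by simp
    also have "\<dots> \<le> (sqrt (1 + \<theta>) * sqrt M) * (\<epsilon> / (2 * (sqrt (1 + \<theta>) * sqrt M)))"
      using that r sM by (intro mult_left_mono) auto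
    also have "\<dots> = \<epsilon> / 2"
    proof -
      have "y * (x / (2 * y)) = x / 2" if "y > 0" for x y :: real using that by simp
      from this[OF sM] show ?thesis .
    qed
    finally show ?thesis using \<epsilon> by simp
  qed
  have img: "x0 + v \<in> chart_img c" if "norm v \<le> r" for v
    using that r r1(2) by (auto simp: subset_iff dist_norm)
  have top: "chart_inv c (x0 + v) \<in> topspace X" if "norm v \<le> r" for v
    using chart_inv_dom[OF img[OF that]] chart_dom_subset[OF c(1)] by blast
  have near: "rdist q (chart_inv c (x0 + v)) \<le> ereal (len v)" if v: "norm v \<le> r" for v
  proof -
    have seg: "x0 + t *\<^sub>R v \<in> cball x0 r1" if "t \<in> {0..1}" for t
    proof -
      have "\<bar>t\<bar> * norm v \<le> 1 * norm v" using that by (intro mult_right_mono) auto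
      then show ?thesis using v r by (simp add: dist_norm)
    qed
    have "rdist (chart_inv c x0) (chart_inv c (x0 + v)) \<le> ereal (len v)"
    proof (rule rdist_chart_segment[OF c(1)])
      show "x0 + t *\<^sub>R v \<in> chart_img c" if "t \<in> {0..1}" for t using seg[OF that] r1(2) by blast
      show "sqrt (blinfun_apply (blinfun_apply (metric_in c (x0 + t *\<^sub>R v)) v) v) \<le> len v" if "t \<in> {0..1}" for t
        unfolding len_def by (rule upper[OF seg[OF that]])
    qed
    then show ?thesis by (simp add: qx0)
  qed

  \<comment> \<open>Restricting to finite values makes \<open>h\<close> real; where \<open>f\<close>
    is infinite, the minorant holds trivially. Lower semicontinuity makes the sublevel sets of
    \<open>h\<close> in \<open>S\<close> closed.\<close>
  define S where "S = {v. norm v \<le> r \<and> f (chart_inv c (x0 + v)) < \<infinity>}"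
  define h where "h v = real_of_ereal (f (chart_inv c (x0 + v)))" for v
  have fh: "f (chart_inv c (x0 + v)) = ereal (h v)" if "v \<in> S" for v
    using that fin[OF top, of v] by (cases "f (chart_inv c (x0 + v))") (auto simp: S_def h_def)
  have S0: "0 \<in> S" "h 0 = a" using r q by (auto simp: S_def h_def qx0)
  have closed: "l \<in> S \<and> h l \<le> b" if s: "\<And>n. s n \<in> S" "s \<longlonglongrightarrow> l" "\<And>n. h (s n) \<le> b" for s l b
  proof -
    have lr: "norm l \<le> r"
      by (rule LIMSEQ_le_const2[OF tendsto_norm[OF s(2)]]) (use s(1) in \<open>auto simp: S_def\<close>)
    have "f (chart_inv c (x0 + l)) \<le> ereal b"
    proof (rule ccontr)
      assume "\<not> f (chart_inv c (x0 + l)) \<le> ereal b"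
      then have fl: "f (chart_inv c (x0 + l)) > ereal b" by simp
      define U where "U = {x \<in> topspace X. f x > ereal b}"
      have "openin X U" using lsc by (simp add: lower_semicontinuous_map_def U_def)
      then have "open {x \<in> chart_img c. chart_inv c x \<in> U}" by (rule open_chart_image[OF c(1)])
      moreover have "x0 + l \<in> {x \<in> chart_img c. chart_inv c x \<in> U}"
        using img[OF lr] top[OF lr] fl by (simp add: U_def)
      moreover have "(\<lambda>n. x0 + s n) \<longlonglongrightarrow> x0 + l" by (intro tendsto_intros s)
      ultimately have "eventually (\<lambda>n. x0 + s n \<in> {x \<in> chart_img c. chart_inv c x \<in> U}) sequentially"
        by (intro topological_tendstoD)
      then obtain n where "chart_inv c (x0 + s n) \<in> U" by (auto simp: eventually_sequentially)
      then show False using fh[OF s(1)[of n]] s(3)[of n] by (simp add: U_def)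
    qed
    then have "l \<in> S" using lr by (auto simp: S_def intro: le_less_trans)
    then show ?thesis using \<open>f _ \<le> ereal b\<close> fh[of l] by simp
  qed
  have hcone: "h 0 - K1 * sqrt (G v v) \<le> h v" if v: "v \<in> S" for v
  proof -
    have vr: "norm v \<le> r" using v by (simp add: S_def)
    have "ereal (a - K * len v) \<le> f (chart_inv c (x0 + v))"
      by (rule cone[OF top[OF vr] near[OF vr] len_small[OF vr]])
    then show ?thesis using fh[OF v] S0 by (simp add: K1_def len_def)
  qed
  obtain v \<sigma> l where v: "v \<in> S" "norm v < r" and \<sigma>: "\<sigma> \<ge> 0" and l: "bounded_linear l"
    "\<And>w. \<bar>l w\<bar> \<le> K2 * sqrt (G w w)"
    and touch: "\<And>x. x \<in> S \<Longrightarrow> h v + l (x - v) - \<sigma> * (norm (x - v))\<^sup>2 \<le> h x"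
  proof (rule proximal_touching[OF G_bil G_sym m r(1) _ S0(1) closed hcone K1(1,2)])
    show "norm x \<le> r" if "x \<in> S" for x using that by (simp add: S_def)
    fix v l \<sigma>
    assume "v \<in> S" "norm v < r" "\<sigma> \<ge> 0" "bounded_linear l" "\<And>w. \<bar>l w\<bar> \<le> K2 * sqrt (G w w)"
      "\<And>x. x \<in> S \<Longrightarrow> h v + l (x - v) - \<sigma> * (norm (x - v))\<^sup>2 \<le> h x"
    then show thesis by (rule that)
  qed

  define p where "p = chart_inv c (x0 + v)"
  have vr: "norm v \<le> r" using v(2) by simp
  have cp: "c \<in> charts_at A p" unfolding p_def by (rule charts_at_inv[OF c(1) img[OF vr]])
  have px: "chart_map c p = x0 + v" unfolding p_def by (rule chart_map_inv[OF img[OF vr]])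
  have fp: "f p = ereal (h v)" unfolding p_def by (rule fh[OF v(1)])
  obtain \<zeta> where \<zeta>: "\<zeta> \<in> manifold_proximal_subdifferential X A g f p"
    "\<And>\<xi>. \<xi> \<in> tangent_space A p \<Longrightarrow> g p \<zeta> \<xi> = l (\<xi> c)"
  proof (rule proximal_subgradient_from_chart[of c p f "h v" l \<sigma> "r - norm v", OF cp fp l(1) \<sigma>])
    show "0 < r - norm v" using v(2) by simp
    fix w :: 'e assume w: "norm w < r - norm v"
    have vw: "norm (v + w) \<le> r" using w norm_triangle_ineq[of v w] by simp
    show "ereal (h v + l w - \<sigma> * (norm w)\<^sup>2) \<le> f (chart_inv c (chart_map c p + w))"
    proof (cases "f (chart_inv c (x0 + (v + w))) < \<infinity>")
      case True
      then have "v + w \<in> S" using vw by (simp add: S_def)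
      from touch[OF this] fh[OF this] show ?thesis by (simp add: px add.assoc)
    next
      case False
      then show ?thesis by (simp add: px add.assoc)
    qed
  qed blast
  have \<zeta>T: "\<zeta> \<in> tangent_space A p"
    using \<zeta>(1) by (simp add: manifold_proximal_subdifferential_def proximal_subdifferential_def)
  \<comment> \<open>Evaluating \<open>\<zeta>\<close> on itself gives
    \<open>N\<^sup>2 = l (\<zeta> c)\<close>, which is at most
    \<open>K2 * sqrt (G (\<zeta> c) (\<zeta> c))\<close>, hence at most
    \<open>K2 * N / sqrt (1 - \<theta>)\<close>. Cancelling \<open>N\<close> leaves a bound below
    \<open>\<delta>\<close>.\<close>
  define N where "N = tangent_norm g p \<zeta>"
  have pt: "p \<in> topspace X" unfolding p_def by (rule top[OF vr])
  have N0: "N \<ge> 0" "N\<^sup>2 = g p \<zeta> \<zeta>"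
    using metric_nonneg[OF pt \<zeta>T] by (auto simp: N_def tangent_norm_def)
  have "sqrt (1 - \<theta>) * sqrt (G (\<zeta> c) (\<zeta> c)) \<le> N"
    unfolding N_def tangent_norm_def local_metric_eq[OF cp \<zeta>T \<zeta>T] px
    by (rule lower) (use vr r in \<open>simp add: dist_norm\<close>)
  then have "sqrt (G (\<zeta> c) (\<zeta> c)) \<le> N / sqrt (1 - \<theta>)" using \<theta> by (simp add: pos_le_divide_eq mult.commute)
  then have "K2 * sqrt (G (\<zeta> c) (\<zeta> c)) \<le> K2 * (N / sqrt (1 - \<theta>))" using K1 by (intro mult_left_mono) auto
  moreover have "N\<^sup>2 \<le> K2 * sqrt (G (\<zeta> c) (\<zeta> c))"
    unfolding N0 \<zeta>(2)[OF \<zeta>T] using l(2)[of "\<zeta> c"] by simp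
  ultimately have "N * N \<le> (K2 / sqrt (1 - \<theta>)) * N" by (simp add: power2_eq_square)
  then have "N \<le> K2 / sqrt (1 - \<theta>) \<or> N = 0" using N0 mult_right_le_imp_le[of N N "K2 / sqrt (1 - \<theta>)"] by linarith
  moreover have "K2 / sqrt (1 - \<theta>) < \<delta>" using K1(3) \<theta> by (simp add: pos_divide_less_eq)
  ultimately have "N < \<delta>" using \<delta> by auto
  moreover have "rdist q p < ereal \<epsilon>"
    using near[OF vr] len_small[OF vr] unfolding p_def by (meson ereal_less_ereal_Ex order_le_less_trans less_ereal.simps(1))
  ultimately show ?thesis using that[OF pt _ \<zeta>(1)] by (simp add: N_def)
qed

end

theorem theorem23:
  fixes X :: "'m topology"
    and A :: "('m, 'e::{real_inner, complete_space}) chart set"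
    and g :: "('m, 'e) metric"
    and f :: "'m \<Rightarrow> ereal"
    and x0 :: 'm
    and \<delta> \<rho> :: real
  assumes "complete_riemannian_manifold X A g"
    and "\<And>x. x \<in> topspace X \<Longrightarrow> f x \<noteq> -\<infinity>"
    and "lower_semicontinuous_map X f"
    and "x0 \<in> topspace X" and "f x0 < \<infinity>"
    and "\<delta> > 0" and "\<rho> > 0"
    and "\<And>x \<zeta>. x \<in> topspace X \<Longrightarrow> riemannian_dist X A g x x0 < ereal \<rho> \<Longrightarrow>
           \<zeta> \<in> manifold_proximal_subdifferential X A g f x \<Longrightarrow> tangent_norm g x \<zeta> \<ge> \<delta>"
  shows "(INF x\<in>{x \<in> topspace X. riemannian_dist X A g x x0 < ereal \<rho>}. f x)
           \<le> f x0 - ereal (\<rho> * \<delta>)"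
proof (rule ccontr)
  interpret complete_riemannian_manifold X A g by fact
  define I where "I = (INF x\<in>{x \<in> topspace X. rdist x x0 < ereal \<rho>}. f x)"
  assume "\<not> (INF x\<in>{x \<in> topspace X. rdist x x0 < ereal \<rho>}. f x) \<le> f x0 - ereal (\<rho> * \<delta>)"
  then have I_gt: "f x0 - ereal (\<rho> * \<delta>) < I" by (simp add: I_def)
  obtain r0 where r0: "f x0 = ereal r0" using assms(2)[OF assms(4)] assms(5) by (cases "f x0") auto
  have d00: "rdist x0 x0 < ereal \<rho>" using rdist_self[OF assms(4)] assms(7) by simp
  have I_le: "I \<le> f x" if "x \<in> topspace X" "rdist x x0 < ereal \<rho>" for x
    unfolding I_def using that by (intro INF_lower) auto
  \<comment> \<open>The infimum is finite: it exceeds a real number by assumption and is at most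
    \<open>f x0\<close>.\<close>
  obtain i where i: "I = ereal i" using I_le[OF assms(4) d00] I_gt r0 by (cases I) auto
  have i_bounds: "r0 - \<rho> * \<delta> < i" "i \<le> r0" using I_gt I_le[OF assms(4) d00] by (auto simp: r0 i)
  \<comment> \<open>The average slope \<open>w\<close> is below \<open>\<delta>\<close>, and
    \<open>K\<close> is taken halfway. From \<open>w < K\<close> it follows that descending from
    \<open>x0\<close> at slope \<open>K\<close> down to the level \<open>i\<close> covers a distance
    less than \<open>\<rho>\<close>.\<close>
  define w where "w = (r0 - i) / \<rho>"
  define K where "K = (w + \<delta>) / 2"
  have "(r0 - i) / \<rho> < \<delta>" using i_bounds assms(7) by (simp add: pos_divide_less_eq mult.commute)
  moreover have "0 \<le> (r0 - i) / \<rho>" using i_bounds assms(7) by simp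
  ultimately have K: "K > 0" "K < \<delta>" "(r0 - i) / \<rho> < K" using assms(6) unfolding w_def[symmetric] K_def by auto
  have \<rho>': "(r0 - i) / K < \<rho>" using K assms(7) by (simp add: pos_divide_less_eq mult.commute)

  \<comment> \<open>Points of infinite value are left out so that \<open>F\<close> and
    \<open>D\<close> are real; distances within the ball are finite through
    \<open>x0\<close>.\<close>
  define B where "B = {x \<in> topspace X. rdist x x0 < ereal \<rho> \<and> f x < \<infinity>}"
  define F where "F x = real_of_ereal (f x)" for x
  define D where "D x y = real_of_ereal (rdist x y)" for x y
  have x0B: "x0 \<in> B" using assms(4,5) d00 by (simp add: B_def)
  have fF: "f x = ereal (F x)" if "x \<in> B" for x
    using that assms(2)[of x] by (cases "f x") (auto simp: B_def F_def)
  have dD: "rdist x y = ereal (D x y)" if "x \<in> B" "y \<in> B" for x y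
  proof -
    have "rdist x0 y < ereal \<rho>" using that(2) rdist_commute[of x0 y] by (simp add: B_def)
    then have "rdist x y < ereal (\<rho> + \<rho>)" using that(1) rdist_triangle_less[of x x0 \<rho> y \<rho>] by (simp add: B_def)
    then show ?thesis using rdist_nonneg[of x y] by (cases "rdist x y") (auto simp: D_def)
  qed
  have iF: "i \<le> F x" if "x \<in> B" for x using I_le[of x] that fF[OF that] by (simp add: B_def i)
  obtain q where q: "q \<in> B" "\<And>y. y \<in> B \<Longrightarrow> F q - K * D q y \<le> F y"
  proof (rule ekeland_pseudometric[OF x0B K(1), of D i F])
    show "0 \<le> D x y" if "x \<in> B" "y \<in> B" for x y using rdist_nonneg[of x y] dD[OF that] by simp
    show "D x x = 0" if "x \<in> B" for x using rdist_self[of x] that by (simp add: D_def B_def)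
    show "D x y = D y x" for x y using rdist_commute[of x y] by (simp add: D_def)
    show "D x z \<le> D x y + D y z" if xyz: "x \<in> B" "y \<in> B" "z \<in> B" for x y z
    proof (rule field_le_epsilon)
      fix e :: real assume "e > 0"
      then have "rdist x y < ereal (D x y + e / 2)" "rdist y z < ereal (D y z + e / 2)" using dD xyz by auto
      from rdist_triangle_less[OF this] show "D x z \<le> D x y + D y z + e" using dD xyz by simp
    qed
    show "i \<le> F x" if "x \<in> B" for x by (rule iF[OF that])
    fix s :: "nat \<Rightarrow> 'm"
    assume sB: "\<And>n. s n \<in> B" and s0: "\<And>n. F (s n) + K * D x0 (s n) \<le> F x0"
      and dec: "\<And>i j. i \<le> j \<Longrightarrow> F (s j) \<le> F (s i)"
      and cau: "\<And>e. e > 0 \<Longrightarrow> \<exists>N. \<forall>i\<ge>N. \<forall>j\<ge>N. D (s i) (s j) < e"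
    have "\<exists>l\<in>topspace X. (\<lambda>n. rdist (s n) l) \<longlonglongrightarrow> 0"
    proof (rule complete)
      show "s n \<in> topspace X" for n using sB[of n] by (simp add: B_def)
      show "\<exists>N. \<forall>m\<ge>N. \<forall>n\<ge>N. rdist (s m) (s n) < ereal e" if "e > 0" for e
        using cau[OF that] dD[OF sB sB] by simp
    qed
    then obtain l where l: "l \<in> topspace X" "(\<lambda>n. rdist (s n) l) \<longlonglongrightarrow> 0" by blast
    have ev: "eventually (\<lambda>n. rdist l (s n) < ereal e) sequentially" if "e > 0" for e
      using order_tendstoD(2)[OF l(2), of "ereal e"] that by (simp add: rdist_commute[of l])
    have "rdist l x0 < ereal \<rho>"
    proof -
      \<comment> \<open>All terms have distance at most \<open>k < \<rho>\<close> from
        \<open>x0\<close>, because \<open>F\<close> cannot fall below \<open>i\<close>. This uniform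
        margin keeps the limit in the open ball, which need not be complete.\<close>
      define k where "k = (r0 - i) / K"
      define e where "e = (\<rho> - k) / 2"
      have e: "e > 0" "k < \<rho> - e" using \<rho>' unfolding k_def[symmetric] by (auto simp: e_def field_simps)
      obtain n where n: "rdist l (s n) < ereal e" using ev[OF e(1)] by (auto simp: eventually_sequentially)
      have "K * D x0 (s n) \<le> r0 - i" using s0[of n] iF[OF sB[of n]] r0 by (simp add: F_def)
      then have "D x0 (s n) < \<rho> - e" using e(2) K(1) unfolding k_def by (smt (verit) pos_le_divide_eq mult.commute)
      then have "rdist (s n) x0 < ereal (\<rho> - e)"
        unfolding rdist_commute[of "s n"] dD[OF x0B sB] by simp
      from rdist_triangle_less[OF n this] show ?thesis by simp
    qed
    \<comment> \<open>Otherwise \<open>f\<close> exceeds \<open>F (s n)\<close> on a neighbourhood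
      of \<open>l\<close>, hence on a distance ball that contains later terms, whose values are not
      larger.\<close>
    have fl: "f l \<le> ereal (F (s n))" for n
    proof (rule ccontr)
      assume "\<not> f l \<le> ereal (F (s n))"
      then have "l \<in> {x \<in> topspace X. f x > ereal (F (s n))}" using l(1) by simp
      moreover have "openin X {x \<in> topspace X. f x > ereal (F (s n))}"
        using assms(3) by (simp add: lower_semicontinuous_map_def)
      ultimately obtain e where e: "e > 0" "\<And>q. rdist l q < ereal e \<Longrightarrow> q \<in> {x \<in> topspace X. f x > ereal (F (s n))}"
        using rdist_nhd by metis
      have "eventually (\<lambda>k. rdist l (s k) < ereal e \<and> n \<le> k) sequentially"
        using ev[OF e(1)] eventually_ge_at_top[of n] by (rule eventually_conj)
      then obtain k where "rdist l (s k) < ereal e" "n \<le> k" by (auto simp: eventually_sequentially)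
      then show False using e(2)[of "s k"] fF[OF sB[of k]] dec[of n k] by simp
    qed
    have lB: "l \<in> B" using l(1) \<open>rdist l x0 < ereal \<rho>\<close> fl[of 0] by (auto simp: B_def)
    have "(\<lambda>n. D (s n) l) \<longlonglongrightarrow> 0" using l(2) by (simp add: dD[OF sB lB] zero_ereal_def)
    then show "\<exists>l\<in>B. (\<lambda>n. D (s n) l) \<longlonglongrightarrow> 0 \<and> (\<forall>n. F l \<le> F (s n))"
      using fl fF[OF lB] lB by (intro bexI[of _ l]) auto
  qed blast

  \<comment> \<open>The room between \<open>q\<close> and the boundary of the ball: points closer to
    \<open>q\<close> than this obey both the Ekeland inequality and the lower bound on
    subgradients.\<close>
  define \<epsilon> where "\<epsilon> = \<rho> - D q x0"
  have qt: "q \<in> topspace X" and \<epsilon>: "\<epsilon> > 0" using q(1) dD[OF q(1) x0B] by (auto simp: B_def \<epsilon>_def)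
  have in_ball: "rdist y x0 < ereal \<rho>" if y: "rdist q y < ereal \<epsilon>" for y
  proof -
    have "ereal 0 \<le> rdist q y" using rdist_nonneg[of q y] by (simp add: zero_ereal_def)
    then obtain t where t: "rdist q y = ereal t" "t < \<epsilon>" using y by (cases "rdist q y") auto
    define e where "e = (\<epsilon> - t) / 2"
    have "rdist y q < ereal (t + e)" "rdist q x0 < ereal (D q x0 + e)"
      using t rdist_commute[of q y] dD[OF q(1) x0B] by (auto simp: e_def)
    from rdist_triangle_less[OF this] show ?thesis by (simp add: e_def \<epsilon>_def field_simps)
  qed
  obtain p \<zeta> where p: "p \<in> topspace X" "rdist q p < ereal \<epsilon>"
    "\<zeta> \<in> manifold_proximal_subdifferential X A g f p" "tangent_norm g p \<zeta> < \<delta>"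
  proof (rule small_proximal_subgradient[OF assms(3) assms(2) qt fF[OF q(1)] \<epsilon> less_imp_le[OF K(1)] K(2)])
    fix y t assume y: "y \<in> topspace X" "rdist q y \<le> ereal t" "t < \<epsilon>"
    show "ereal (F q - K * t) \<le> f y"
    proof (cases "f y < \<infinity>")
      case True
      have "rdist q y < ereal \<epsilon>" using y by (meson less_ereal.simps(1) order_le_less_trans)
      then have yB: "y \<in> B" using in_ball y(1) True by (simp add: B_def)
      have "K * D q y \<le> K * t" using y(2) dD[OF q(1) yB] K(1) by simp
      then show ?thesis using q(2)[OF yB] fF[OF yB] by simp
    qed simp
  qed blast+
  show False using assms(8)[OF p(1) in_ball[OF p(2)] p(3)] p(4) by simp
qed

end
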